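(* In order that an adapted right-continuous process $M=(M_t)_{t\in\mathbb R_+}$ be a $\sigma$-martingale with respect to $\mathbb F$ it is necessary and sufficient that, up to $\mathsf P$-indistinguishability, it have a representation $$M_t=F(t)\mathbf 1_{\{t<\gamma\}}+\bigl(H(\gamma)+L'\bigr)\mathbf 1_{\{t\geqslant\gamma\}},\qquad t\in\mathbb R_+,$$ where a pair $(F,H)$ satisfies Condition M and a random variable $L'$ satisfies $$\mathsf E\bigl[|L'|\mathbf 1_{\{\gamma>0\}}\,\big|\,\gamma\bigr]<\infty\qquad\text{and}\qquad \mathsf E[L'\,|\,\gamma]=0.$$
   Context: Setting. $(\Omega,\mathscr F,\mathsf P)$ is a probability space, $\gamma$ is a random variable with values in $[0,+\infty]$ with $\mathsf P(\gamma>0)>0$, $\mathbb R_+=[0,\infty)$, $G(t)=\mathsf P(\gamma\leqslant t)$ for $t\in\mathbb R_+$, $\overline G=1-G$, $t_G=\sup\{t\in\mathbb R_+: G(t)<1\}$, $\mathcal T=\{t\in\mathbb R_+:\mathsf P(\gamma\geqslant t)>0\}$. Case A: $\mathsf P(\gamma=t_G<\infty)=0$ (then $\mathcal T=[0,t_G)$). Case B: $\mathsf P(\gamma=t_G<\infty)>0$ (then $\mathcal T=[0,t_G]$). Single jump filtration: $\mathbb F=(\mathscr F_t)_{t\in\mathbb R_+}$, where $\mathscr F_t$ is the collection of all $A\in\mathscr F$ such that $A\cap\{t<\gamma\}$ is either $\varnothing$ or equal to $\{t<\gamma\}$; it is increasing and right-continuous, not assumed complete. All notions depending on a filtration refer to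 $\mathbb F$. $L^1_{\mathrm{loc}}(dG)$ is the set of Borel functions $z:\mathcal T\to\mathbb R$ with $\int_{[0,t]}|z(s)|\,dG(s)<\infty$ for all $t\in\mathcal T$ (the measure $dG$ has mass $G(0)$ at $0$). For $Z:[0,t_G)\to\mathbb R$ write $Z\overset{\mathrm{loc}}{\ll}G$ if there is $z\in L^1_{\mathrm{loc}}(dG)$ with $Z(t)=Z(0)+\int_{(0,t]}z(s)\,dG(s)$ for all $t<t_G$. A pair $(F,H)$ satisfies Condition M if: $F:[0,t_G)\to\mathbb R$ with $F\overset{\mathrm{loc}}{\ll}G$; $H:\mathcal T\to\mathbb R$ with $H\in L^1_{\mathrm{loc}}(dG)$; $$F(t)\overline G(t)+\int_{(0,t]}H(s)\,dG(s)=F(0)\overline G(0),\qquad t<t_G;$$ and, additionally in Case B, $\lim_{t\uparrow t_G,\,t<t_G}F(t)=H(t_G)$. Conventions. In the representation, $F$ is extended arbitrarily to a right-continuous function on $[t_G,\infty)$ if $t_G<\infty$, and $H$ is extended by $0$ outside $\mathcal T$. Conditional expectations are understood in the generalized sense, $\mathsf E[Y|\gamma]=\mathsf E[Y^+|\gamma]-\mathsf E[Y^-|\gamma]$, and relations between them hold a.s. Two processes are $\mathsf P$-indistinguishable if the set where they differ is contained in $N\times\mathbb R_+$ with $\mathsf P(N)=0$. A local martingale is an adapted process $M$ with a.s. càdlàg paths for which there are stopping times $T_n\uparrow\infty$ a.s. such that each stopped process $M^{T_n}$ is a uniformly integrable martingale. A semimartingale is the sum of a local martingale and an adapted process with a.s.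 càdlàg paths of finite variation on compact intervals. A process $M$ is a $\sigma$-martingale if it is a semimartingale and there is an increasing sequence of predictable sets $\Sigma_n$ with $\bigcup_n\Sigma_n=\Omega\times\mathbb R_+$ such that for every $n$ the integral process $\int_{(0,t]}\mathbf 1_{\Sigma_n}\,dM$ is a uniformly integrable martingale. (For the filtration $\mathbb F$ every semimartingale has a.s. finite variation on compact intervals, so the integral is a Lebesgue–Stieltjes integral.)
   Formalization: The condition E[L'|γ]=0 is required only almost surely where E[|L'| | γ]<∞ (automatic on {γ>0}); literally, necessity fails when P(γ=0)>0 and M_0 is not integrable on {γ=0}. *)

theory Defs
  imports "HOL-Probability.Probability"
begin

section \<open>Paths\<close>

text \<open>A path on \<open>[0,\<infinity>)\<close> is a function on all reals; only its values at times
  \<open>t \<ge> 0\<close> matter.\<close>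

definition right_cont_path :: "(real \<Rightarrow> real) \<Rightarrow> bool" where
  "right_cont_path f \<longleftrightarrow> (\<forall>t\<ge>0. continuous (at_right t) f)"

definition cadlag_path :: "(real \<Rightarrow> real) \<Rightarrow> bool" where
  "cadlag_path f \<longleftrightarrow> right_cont_path f \<and> (\<forall>t>0. \<exists>l. (f \<longlongrightarrow> l) (at_left t))"

definition variation :: "(real \<Rightarrow> real) \<Rightarrow> real \<Rightarrow> real \<Rightarrow> ennreal" where
  "variation f a b =
     (SUP (n, x) \<in> {(n :: nat, x :: nat \<Rightarrow> real). mono x \<and> range x \<subseteq> {a..b}}.
        \<Sum>i<n. ennreal \<bar>f (x (Suc i)) - f (x i)\<bar>)"

definition finite_variation_path :: "(real \<Rightarrow> real) \<Rightarrow> bool" where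
  "finite_variation_path f \<longleftrightarrow> (\<forall>t\<ge>0. variation f 0 t < \<infinity>)"

definition variation_fun :: "(real \<Rightarrow> real) \<Rightarrow> real \<Rightarrow> real" where
  "variation_fun f t = enn2real (variation f 0 t)"

text \<open>The Lebesgue-Stieltjes integral of \<open>g\<close> over \<open>(0,t]\<close> with respect to a right-continuous path
  \<open>f\<close> of finite variation on compact intervals. With \<open>V = variation_fun f\<close>, both \<open>V\<close> and \<open>V - f\<close>
  are nondecreasing and right-continuous and \<open>f = V - (V - f)\<close>. To the left of \<open>0\<close>,
  \<open>V\<close> vanishes and \<open>f\<close> is frozen at \<open>f 0\<close>.\<close>

definition stieltjes_integral :: "(real \<Rightarrow> real) \<Rightarrow> (real \<Rightarrow> real) \<Rightarrow> real \<Rightarrow> real" where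
  "stieltjes_integral f g t =
     set_lebesgue_integral (interval_measure (variation_fun f)) {0<..t} g
   - set_lebesgue_integral (interval_measure (\<lambda>s. variation_fun f s - f (max 0 s))) {0<..t} g"


section \<open>Martingale notions for a general filtration\<close>

text \<open>A process is a function \<open>X :: real \<Rightarrow> 'a \<Rightarrow> real\<close>, of which only the times \<open>t \<ge> 0\<close> matter.
  Filtrations are indexed by \<^typ>\<open>ennreal\<close> because \<^const>\<open>stopping_time\<close> requires indices and
  values of stopping times to have the same type, and stopping times may be infinite. The
  sigma-field at index \<open>\<infinity>\<close> has no influence on any of the notions below.\<close>

definition adapted :: "(ennreal \<Rightarrow> 'a measure) \<Rightarrow> (real \<Rightarrow> 'a \<Rightarrow> real) \<Rightarrow> bool" where
  "adapted \<F> X \<longleftrightarrow> (\<forall>t\<ge>0. X t \<in> borel_measurable (\<F> (ennreal t)))"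

definition martingale ::
  "'a measure \<Rightarrow> (ennreal \<Rightarrow> 'a measure) \<Rightarrow> (real \<Rightarrow> 'a \<Rightarrow> real) \<Rightarrow> bool" where
  "martingale P \<F> X \<longleftrightarrow>
     adapted \<F> X \<and> (\<forall>t\<ge>0. integrable P (X t)) \<and>
     (\<forall>s t. 0 \<le> s \<and> s \<le> t \<longrightarrow>
        (AE \<omega> in P. real_cond_exp P (\<F> (ennreal s)) (X t) \<omega> = X s \<omega>))"

definition uniformly_integrable :: "'a measure \<Rightarrow> (real \<Rightarrow> 'a \<Rightarrow> real) \<Rightarrow> bool" where
  "uniformly_integrable P X \<longleftrightarrow>
     (\<forall>e>0. \<exists>c. \<forall>t\<ge>0.
        (\<integral>\<^sup>+\<omega>. ennreal \<bar>X t \<omega>\<bar> * indicator {\<omega>. \<bar>X t \<omega>\<bar> > c} \<omega> \<partial>P) \<le> ennreal e)"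

definition ui_martingale ::
  "'a measure \<Rightarrow> (ennreal \<Rightarrow> 'a measure) \<Rightarrow> (real \<Rightarrow> 'a \<Rightarrow> real) \<Rightarrow> bool" where
  "ui_martingale P \<F> X \<longleftrightarrow> martingale P \<F> X \<and> uniformly_integrable P X"

definition stopped :: "(real \<Rightarrow> 'a \<Rightarrow> real) \<Rightarrow> ('a \<Rightarrow> ennreal) \<Rightarrow> real \<Rightarrow> 'a \<Rightarrow> real" where
  "stopped X T t \<omega> = X (enn2real (min (ennreal t) (T \<omega>))) \<omega>"

definition local_martingale ::
  "'a measure \<Rightarrow> (ennreal \<Rightarrow> 'a measure) \<Rightarrow> (real \<Rightarrow> 'a \<Rightarrow> real) \<Rightarrow> bool" where
  "local_martingale P \<F> X \<longleftrightarrow>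
     adapted \<F> X \<and> (AE \<omega> in P. cadlag_path (\<lambda>t. X t \<omega>)) \<and>
     (\<exists>T :: nat \<Rightarrow> 'a \<Rightarrow> ennreal.
        (\<forall>n. stopping_time \<F> (T n)) \<and>
        (AE \<omega> in P. incseq (\<lambda>n. T n \<omega>) \<and> (\<lambda>n. T n \<omega>) \<longlonglongrightarrow> \<infinity>) \<and>
        (\<forall>n. ui_martingale P \<F> (stopped X (T n))))"

definition semimartingale ::
  "'a measure \<Rightarrow> (ennreal \<Rightarrow> 'a measure) \<Rightarrow> (real \<Rightarrow> 'a \<Rightarrow> real) \<Rightarrow> bool" where
  "semimartingale P \<F> X \<longleftrightarrow>
     (\<exists>N A. local_martingale P \<F> N \<and> adapted \<F> A \<and>
        (AE \<omega> in P. cadlag_path (\<lambda>t. A t \<omega>) \<and> finite_variation_path (\<lambda>t. A t \<omega>)) \<and>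
        (\<forall>t\<ge>0. \<forall>\<omega>\<in>space P. X t \<omega> = N t \<omega> + A t \<omega>))"

definition predictable_sigma ::
  "'a measure \<Rightarrow> (ennreal \<Rightarrow> 'a measure) \<Rightarrow> ('a \<times> real) measure" where
  "predictable_sigma P \<F> =
     sigma (space P \<times> {0..})
       ({A \<times> {0} | A. A \<in> sets (\<F> 0)} \<union>
        {A \<times> {s<..t} | A s t. 0 \<le> s \<and> s \<le> t \<and> A \<in> sets (\<F> (ennreal s))})"

text \<open>The integral of the indicator of a predictable set is taken pathwise, so this definition is
  meant for filtrations whose semimartingales have paths of finite variation almost surely, such as
  the single jump filtration below. The integral is then determined up to indistinguishability
  only and, the filtration not being complete, its being a uniformly integrable martingale is
  understood as having a version with this property.\<close>

definition sigma_martingale ::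
  "'a measure \<Rightarrow> (ennreal \<Rightarrow> 'a measure) \<Rightarrow> (real \<Rightarrow> 'a \<Rightarrow> real) \<Rightarrow> bool" where
  "sigma_martingale P \<F> X \<longleftrightarrow>
     semimartingale P \<F> X \<and>
     (\<exists>S :: nat \<Rightarrow> ('a \<times> real) set.
        incseq S \<and> (\<forall>n. S n \<in> sets (predictable_sigma P \<F>)) \<and>
        (\<Union>n. S n) = space P \<times> {0..} \<and>
        (\<forall>n. \<exists>Y. ui_martingale P \<F> Y \<and>
           (AE \<omega> in P. \<forall>t\<ge>0.
              Y t \<omega> = stieltjes_integral (\<lambda>s. X s \<omega>) (\<lambda>s. indicator (S n) (\<omega>, s)) t)))"


section \<open>The single jump filtration\<close>

definition sj_filtration :: "'a measure \<Rightarrow> ('a \<Rightarrow> ennreal) \<Rightarrow> ennreal \<Rightarrow> 'a measure" where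
  "sj_filtration P \<gamma> t =
     sigma (space P)
       {A \<in> sets P. A \<inter> {\<omega> \<in> space P. t < \<gamma> \<omega>} = {} \<or>
                    A \<inter> {\<omega> \<in> space P. t < \<gamma> \<omega>} = {\<omega> \<in> space P. t < \<gamma> \<omega>}}"

lemma space_sj_filtration: "space (sj_filtration P \<gamma> t) = space P"
  unfolding sj_filtration_def by (rule space_measure_of) (auto dest: sets.sets_into_space)

text \<open>The generating collection is already a sigma-field.\<close>

lemma sets_sj_filtration:
  "sets (sj_filtration P \<gamma> t) =
     {A \<in> sets P. A \<inter> {\<omega> \<in> space P. t < \<gamma> \<omega>} = {} \<or>
                  A \<inter> {\<omega> \<in> space P. t < \<gamma> \<omega>} = {\<omega> \<in> space P. t < \<gamma> \<omega>}}"
  (is "_ = ?C")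
proof -
  have "sigma_algebra (space P) ?C"
    unfolding sigma_algebra_iff2
  proof (intro conjI ballI allI impI)
    show "?C \<subseteq> Pow (space P)"
      by (auto dest: sets.sets_into_space)
    show "{} \<in> ?C"
      by simp
    show "space P - A \<in> ?C" if "A \<in> ?C" for A
      using that by auto
    show "(\<Union>i. A i) \<in> ?C" if A: "range A \<subseteq> ?C" for A :: "nat \<Rightarrow> 'a set"
    proof -
      let ?B = "{\<omega> \<in> space P. t < \<gamma> \<omega>}"
      have "(\<Union>i. A i) \<in> sets P"
        using A by auto
      moreover have "(\<Union>i. A i) \<inter> ?B = {} \<or> (\<Union>i. A i) \<inter> ?B = ?B"
      proof (cases "\<exists>i. A i \<inter> ?B = ?B")
        case True
        then show ?thesis by blast
      next
        case False
        then have "A i \<inter> ?B = {}" for i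
          using A by blast
        then show ?thesis by blast
      qed
      ultimately show ?thesis by blast
    qed
  qed
  then show ?thesis
    unfolding sj_filtration_def by (rule sigma_algebra.sets_measure_of_eq)
qed

lemma filtration_sj_filtration: "filtration (space P) (sj_filtration P \<gamma>)"
proof
  show "space (sj_filtration P \<gamma> t) = space P" for t
    by (rule space_sj_filtration)
  show "sets (sj_filtration P \<gamma> s) \<subseteq> sets (sj_filtration P \<gamma> t)" if "s \<le> t" for s t
  proof -
    have "{\<omega> \<in> space P. t < \<gamma> \<omega>} \<subseteq> {\<omega> \<in> space P. s < \<gamma> \<omega>}"
      using that by auto
    then show ?thesis
      unfolding sets_sj_filtration by blast
  qed
qed


section \<open>Condition M\<close>

text \<open>\<open>jump_cdf\<close> vanishes on the negative half-line, so that \<open>jump_law\<close>, the measure \<open>dG\<close>,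
  has mass \<open>G 0\<close> at \<open>0\<close>.\<close>

definition jump_cdf :: "'a measure \<Rightarrow> ('a \<Rightarrow> ennreal) \<Rightarrow> real \<Rightarrow> real" where
  "jump_cdf P \<gamma> t = (if t < 0 then 0 else measure P {\<omega> \<in> space P. \<gamma> \<omega> \<le> ennreal t})"

definition jump_law :: "'a measure \<Rightarrow> ('a \<Rightarrow> ennreal) \<Rightarrow> real measure" where
  "jump_law P \<gamma> = interval_measure (jump_cdf P \<gamma>)"

definition jump_end :: "'a measure \<Rightarrow> ('a \<Rightarrow> ennreal) \<Rightarrow> ennreal" where
  "jump_end P \<gamma> = (SUP t \<in> {t. 0 \<le> t \<and> jump_cdf P \<gamma> t < 1}. ennreal t)"

definition jump_times :: "'a measure \<Rightarrow> ('a \<Rightarrow> ennreal) \<Rightarrow> real set" where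
  "jump_times P \<gamma> = {t. 0 \<le> t \<and> measure P {\<omega> \<in> space P. ennreal t \<le> \<gamma> \<omega>} > 0}"

definition case_B :: "'a measure \<Rightarrow> ('a \<Rightarrow> ennreal) \<Rightarrow> bool" where
  "case_B P \<gamma> \<longleftrightarrow> measure P {\<omega> \<in> space P. \<gamma> \<omega> = jump_end P \<gamma> \<and> \<gamma> \<omega> < \<infinity>} > 0"

definition L1_loc :: "'a measure \<Rightarrow> ('a \<Rightarrow> ennreal) \<Rightarrow> (real \<Rightarrow> real) set" where
  "L1_loc P \<gamma> =
     {z. set_borel_measurable borel (jump_times P \<gamma>) z \<and>
         (\<forall>t\<in>jump_times P \<gamma>. set_integrable (jump_law P \<gamma>) {0..t} z)}"

definition loc_abs_cont :: "'a measure \<Rightarrow> ('a \<Rightarrow> ennreal) \<Rightarrow> (real \<Rightarrow> real) \<Rightarrow> bool" where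
  "loc_abs_cont P \<gamma> Z \<longleftrightarrow>
     (\<exists>z\<in>L1_loc P \<gamma>. \<forall>t. 0 \<le> t \<and> ennreal t < jump_end P \<gamma> \<longrightarrow>
        Z t = Z 0 + set_lebesgue_integral (jump_law P \<gamma>) {0<..t} z)"

text \<open>Only the values of \<open>F\<close> on \<open>[0, jump_end P \<gamma>)\<close> and of \<open>H\<close> on \<open>jump_times P \<gamma>\<close> matter.\<close>

definition condition_M ::
  "'a measure \<Rightarrow> ('a \<Rightarrow> ennreal) \<Rightarrow> (real \<Rightarrow> real) \<Rightarrow> (real \<Rightarrow> real) \<Rightarrow> bool" where
  "condition_M P \<gamma> F H \<longleftrightarrow>
     loc_abs_cont P \<gamma> F \<and> H \<in> L1_loc P \<gamma> \<and>
     (\<forall>t. 0 \<le> t \<and> ennreal t < jump_end P \<gamma> \<longrightarrow>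
        F t * (1 - jump_cdf P \<gamma> t) + set_lebesgue_integral (jump_law P \<gamma>) {0<..t} H
          = F 0 * (1 - jump_cdf P \<gamma> 0)) \<and>
     (case_B P \<gamma> \<longrightarrow>
        (F \<longlongrightarrow> H (enn2real (jump_end P \<gamma>))) (at_left (enn2real (jump_end P \<gamma>))))"


section \<open>Conditioning on the jump time\<close>

definition jump_sigma :: "'a measure \<Rightarrow> ('a \<Rightarrow> ennreal) \<Rightarrow> 'a measure" where
  "jump_sigma P \<gamma> = vimage_algebra (space P) \<gamma> borel"

text \<open>\<open>E[Y | G] = 0\<close> for the generalized conditional expectation
  \<open>E[Y | G] = E[Y\<^sup>+ | G] - E[Y\<^sup>- | G]\<close>, which is regarded as defined where \<open>E[\<bar>Y\<bar> | G] < \<infinity>\<close>;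
  the equality is required almost surely on that set. There, \<^const>\<open>real_cond_exp\<close> is this
  difference; elsewhere it replaces infinite terms by \<open>0\<close>.

  In the representation of sigma-martingales the restriction to that set matters only on
  \<open>{\<gamma> = 0}\<close>. It cannot be dropped if \<open>P(\<gamma> = 0) > 0\<close>: a process constant in time that
  equals a nonnegative nonintegrable variable on \<open>{\<gamma> = 0}\<close> and \<open>0\<close> elsewhere is a
  sigma-martingale, but \<open>H(0) + L'\<close> is that variable on \<open>{\<gamma> = 0}\<close>, so
  \<open>E[L' | \<gamma>] = \<infinity>\<close> there for every choice of \<open>H(0)\<close>.\<close>

definition gen_cond_exp_zero :: "'a measure \<Rightarrow> 'a measure \<Rightarrow> ('a \<Rightarrow> real) \<Rightarrow> bool" where
  "gen_cond_exp_zero P G Y \<longleftrightarrow>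
     (AE \<omega> in P. nn_cond_exp P G (\<lambda>\<omega>. ennreal \<bar>Y \<omega>\<bar>) \<omega> < \<infinity> \<longrightarrow> real_cond_exp P G Y \<omega> = 0)"

end

theory Submission
  imports Defs
begin

text \<open>Before the jump every adapted process is deterministic, after the jump a martingale is constant, and
  a predictable set agrees up to the jump with a deterministic Borel set. Hence the integral \<open>Y\<close> of a predictable
  indicator with respect to \<open>M\<close> is a martingale as soon as it is constant after the jump and
  \<open>E[Y\<^sub>t]\<close> does not depend on \<open>t\<close>. Writing \<open>M = F\<close> before the jump and \<open>M = K\<close> after it, Fubini's theorem
  turns \<open>E[Y\<^sub>t] = 0\<close> into \<open>P(\<gamma> > s) dF(s) = - (k(s) - F(s-)) dG(s)\<close> on the Borel set
  \<open>B\<^sub>n\<close> in question, where \<open>k(s) = E[K | \<gamma> = s]\<close>; by Fubini again this is Condition M for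
  \<open>H = k\<close>, and \<open>L' = K - k(\<gamma>)\<close>. Integrability of \<open>k\<close> comes for free, since the left-hand side is a locally finite
  measure. Conversely, one cuts off where \<open>E[\<bar>L'\<bar> | \<gamma>]\<close> is large and before the end of the time set.\<close>

section \<open>Paths of finite variation\<close>

text \<open>Two obstacles shape the proof. First, the value \<open>K\<close> of the process at the
  jump need not be integrable, so its conditional mean given \<open>\<gamma>\<close> cannot be
  assumed to exist. It is represented by the densities of its positive and negative parts with
  respect to dG, which make sense in [0,\<infinity>]; finiteness is proved afterwards by balancing
  them against finite measures. Since differences of measures may be undefined on the way, signed
  identities are kept as equations a + b = c + d between nonnegative measures. Second, in Case B the
  factor P(\<gamma> > s) vanishes at the last point of the time set. There the balance says nothing
  about dF; at this atom it degenerates to k(s) = F(s-), which is exactly the additional limit in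
  Condition M. The pathwise integral moreover presupposes that semimartingale paths have finite
  variation. For martingales before the jump this rests on P(\<gamma> > s) being bounded away from 0
  on [0,u) for each u in the time set.\<close>

lemma chain_le_variation:
  fixes x :: "nat \<Rightarrow> real"
  assumes "mono x" "range x \<subseteq> {a..b}"
  shows "(\<Sum>i<n. ennreal \<bar>f (x (Suc i)) - f (x i)\<bar>) \<le> variation f a b"
  unfolding variation_def
  by (rule SUP_upper2[of "(n, x)"]) (use assms in auto)

lemma variation_least:
  assumes "\<And>n x. mono x \<Longrightarrow> range x \<subseteq> {a..b} \<Longrightarrow>
    (\<Sum>i<n. ennreal \<bar>f (x (Suc i)) - f (x i)\<bar>) \<le> C"
  shows "variation f a b \<le> C"
  unfolding variation_def using assms by (auto intro!: SUP_least)

lemma variation_mono: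
  assumes "{a..b} \<subseteq> {c..d}"
  shows "variation f a b \<le> variation f c d"
  by (rule variation_least, rule chain_le_variation) (use assms in auto)

lemma variation_empty: "b < a \<Longrightarrow> variation f a b = 0"
  unfolding variation_def by (simp add: bot_ennreal)

lemma variation_point: "variation f a a = 0"
proof -
  have "(\<Sum>i<n. ennreal \<bar>f (x (Suc i)) - f (x i)\<bar>) \<le> 0"
    if "range x \<subseteq> {a..a}" for n and x :: "nat \<Rightarrow> real"
  proof -
    have "x i = a" for i using that by auto
    then show ?thesis by simp
  qed
  then show ?thesis
    by (intro antisym variation_least) auto
qed

lemma increment_le_variation:
  assumes "a \<le> s" "s \<le> t" "t \<le> b"
  shows "ennreal \<bar>f t - f s\<bar> \<le> variation f a b"
proof -
  have "mono (\<lambda>i::nat. if i = 0 then s else t)"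
    using assms by (auto simp: mono_def)
  moreover have "range (\<lambda>i::nat. if i = 0 then s else t) \<subseteq> {a..b}"
    using assms by auto
  ultimately show ?thesis
    using chain_le_variation[of "\<lambda>i. if i = 0 then s else t" a b f 1] by simp
qed

lemma sum_lessThan_concat:
  "(\<Sum>i<n + k. g i) = (\<Sum>i<n. g i) + (\<Sum>i<k. g (n + i :: nat))" for g :: "nat \<Rightarrow> 'b::comm_monoid_add"
  by (induction k) (auto simp: add.assoc)

lemma SUP_add_SUP_least:
  fixes g h :: "_ \<Rightarrow> ennreal"
  assumes "I \<noteq> {}" "J \<noteq> {}" "\<And>i j. i \<in> I \<Longrightarrow> j \<in> J \<Longrightarrow> g i + h j \<le> C"
  shows "(SUP i\<in>I. g i) + (SUP j\<in>J. h j) \<le> C"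
proof -
  have "g i + (SUP j\<in>J. h j) \<le> C" if "i \<in> I" for i
    using assms(3) that by (subst ennreal_SUP_add_right[OF assms(2)]) (auto intro!: SUP_least)
  then show ?thesis
    by (subst ennreal_SUP_add_left[OF assms(1), symmetric]) (auto intro!: SUP_least)
qed

lemma variation_superadditive:
  assumes "a \<le> b" "b \<le> c"
  shows "variation f a b + variation f b c \<le> variation f a c"
proof -
  let ?S = "\<lambda>n x. (\<Sum>i<n. ennreal \<bar>f (x (Suc i)) - f (x i :: real)\<bar>)"
  let ?X = "\<lambda>a b. {(n :: nat, x :: nat \<Rightarrow> real). mono x \<and> range x \<subseteq> {a..b}}"
  have ne: "?X a b \<noteq> {}" if "a \<le> b" for a b
    using that by (auto intro!: exI[of _ "\<lambda>_. a"] simp: mono_def)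
  have two: "?S n x + ?S m y \<le> variation f a c"
    if x: "mono x" "range x \<subseteq> {a..b}" and y: "mono y" "range y \<subseteq> {b..c}" for n m x y
  proof -
    \<comment> \<open>The two chains are joined by one extra step from \<open>x n\<close> to
      \<open>y 0\<close>. This is why \<open>Suc m\<close> steps follow the first \<open>n\<close>;
      the increment over the extra step is nonnegative and is dropped.\<close>
    define z where "z i = (if i \<le> n then x i else y (i - Suc n))" for i
    have xz: "x i \<le> y j" for i j
      using x y by (meson atLeastAtMost_iff order_trans range_subsetD)
    have "mono z"
      unfolding mono_def z_def using x(1) y(1) xz by (auto simp: mono_def)
    moreover have "range z \<subseteq> {a..c}"
      using x(2) y(2) assms by (auto simp: z_def image_subset_iff intro: order_trans)
    ultimately have upper: "?S (n + Suc m) z \<le> variation f a c"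
      by (rule chain_le_variation)
    have split: "?S (n + Suc m) z = ?S n z + (\<Sum>i<Suc m. ennreal \<bar>f (z (Suc (n + i))) - f (z (n + i))\<bar>)"
      by (rule sum_lessThan_concat)
    have left: "?S n z = ?S n x"
      by (rule sum.cong) (auto simp: z_def)
    have right: "(\<Sum>i<Suc m. ennreal \<bar>f (z (Suc (n + i))) - f (z (n + i))\<bar>) \<ge> ?S m y"
      by (subst sum.lessThan_Suc_shift) (auto simp: z_def add_increasing)
    show ?thesis
      using add_left_mono[OF right, of "?S n x"] upper unfolding split left by (rule order_trans)
  qed
  show ?thesis
    unfolding variation_def[of f a b] variation_def[of f b c]
    by (rule SUP_add_SUP_least) (use ne assms two in auto)
qed

lemma variation_subadditive:
  assumes "a \<le> b" "b \<le> c"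
  shows "variation f a c \<le> variation f a b + variation f b c"
proof (rule variation_least)
  fix n and x :: "nat \<Rightarrow> real"
  assume x: "mono x" "range x \<subseteq> {a..c}"
  \<comment> \<open>Clipping the chain at \<open>b\<close> from above and from below gives chains in
    the two halves. Only a step that straddles \<open>b\<close> is cut, and there the triangle
    inequality applies.\<close>
  let ?l = "\<lambda>i. min (x i) b" and ?r = "\<lambda>i. max (x i) b"
  have "ennreal \<bar>f (x (Suc i)) - f (x i)\<bar> \<le>
      ennreal \<bar>f (?l (Suc i)) - f (?l i)\<bar> + ennreal \<bar>f (?r (Suc i)) - f (?r i)\<bar>" for i
  proof -
    have "x i \<le> x (Suc i)" using x(1) by (simp add: mono_def)
    then show ?thesis
      by (auto simp: min_def max_def simp flip: ennreal_plus intro!: ennreal_leI)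
  qed
  then have "(\<Sum>i<n. ennreal \<bar>f (x (Suc i)) - f (x i)\<bar>) \<le>
      (\<Sum>i<n. ennreal \<bar>f (?l (Suc i)) - f (?l i)\<bar> + ennreal \<bar>f (?r (Suc i)) - f (?r i)\<bar>)"
    by (rule sum_mono)
  also have "\<dots> = (\<Sum>i<n. ennreal \<bar>f (?l (Suc i)) - f (?l i)\<bar>) + (\<Sum>i<n. ennreal \<bar>f (?r (Suc i)) - f (?r i)\<bar>)"
    by (rule sum.distrib)
  also have "\<dots> \<le> variation f a b + variation f b c"
  proof (intro add_mono chain_le_variation)
    show "mono ?l" "mono ?r" using x(1) by (auto simp: mono_def min_def max_def intro: order_trans)
    show "range ?l \<subseteq> {a..b}" "range ?r \<subseteq> {b..c}" using x(2) assms by (auto simp: image_subset_iff)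
  qed
  finally show "(\<Sum>i<n. ennreal \<bar>f (x (Suc i)) - f (x i)\<bar>) \<le> variation f a b + variation f b c" .
qed

lemma variation_add:
  "a \<le> b \<Longrightarrow> b \<le> c \<Longrightarrow> variation f a b + variation f b c = variation f a c"
  by (intro antisym variation_superadditive variation_subadditive)

text \<open>The increments of \<phi> telescope along any chain. Domination by such a \<phi> is the
  criterion through which all finite variation statements are proved, because dominating functions
  add up and can be glued at a jump.\<close>

lemma variation_le_dominating:
  assumes ab: "a \<le> b" and dom: "\<And>s t. a \<le> s \<Longrightarrow> s \<le> t \<Longrightarrow> t \<le> b \<Longrightarrow> \<bar>f t - f s\<bar> \<le> \<phi> t - \<phi> s"
  shows "variation f a b \<le> ennreal (\<phi> b - \<phi> a)"
proof (rule variation_least)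
  fix n and x :: "nat \<Rightarrow> real"
  assume x: "mono x" "range x \<subseteq> {a..b}"
  have mem: "a \<le> x i" "x i \<le> b" for i using x(2) by (auto simp: image_subset_iff)
  have le: "x i \<le> x (Suc i)" for i using x(1) by (simp add: mono_def)
  have "(\<Sum>i<n. ennreal \<bar>f (x (Suc i)) - f (x i)\<bar>) = ennreal (\<Sum>i<n. \<bar>f (x (Suc i)) - f (x i)\<bar>)"
    by (rule sum_ennreal) simp
  also have "\<dots> \<le> ennreal (\<Sum>i<n. \<phi> (x (Suc i)) - \<phi> (x i))"
    by (intro ennreal_leI sum_mono dom mem le)
  also have "(\<Sum>i<n. \<phi> (x (Suc i)) - \<phi> (x i)) = \<phi> (x n) - \<phi> (x 0)"
    by (rule sum_lessThan_telescope)
  also have "\<dots> \<le> \<phi> b - \<phi> a"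
    using dom[of a "x 0"] dom[of "x n" b] mem[of 0] mem[of n] by auto
  finally show "(\<Sum>i<n. ennreal \<bar>f (x (Suc i)) - f (x i)\<bar>) \<le> ennreal (\<phi> b - \<phi> a)"
    by (auto intro: ennreal_leI)
qed

lemma ennreal_add_eqD:
  assumes "ennreal a + v = ennreal b" "0 \<le> a"
  shows "v = ennreal (b - a)"
proof -
  have "v = ennreal b - ennreal a"
    unfolding assms(1)[symmetric] by (simp add: ennreal_add_diff_cancel_left)
  then show ?thesis using assms(2) by (simp add: ennreal_minus)
qed

lemma finite_variation_pathI:
  assumes "\<And>T. 0 \<le> T \<Longrightarrow> \<exists>\<phi>. \<forall>s t. 0 \<le> s \<longrightarrow> s \<le> t \<longrightarrow> t \<le> T \<longrightarrow> \<bar>f t - f s\<bar> \<le> \<phi> t - \<phi> (s :: real)"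
  shows "finite_variation_path f"
  unfolding finite_variation_path_def
proof safe
  fix T :: real assume "0 \<le> T"
  with assms[of T] obtain \<phi> where "variation f 0 T \<le> ennreal (\<phi> T - \<phi> 0)"
    using variation_le_dominating[of 0 T f] by blast
  then show "variation f 0 T < \<infinity>"
    by (metis ennreal_less_top infinity_ennreal_def order_le_less_trans)
qed

text \<open>A dominating function known only before \<open>g\<close> extends past \<open>g\<close>
  by a single upward jump, since the path is constant afterwards. Here \<open>g\<close> will be the
  jump time of a sample point.\<close>

lemma dominated_with_jump:
  fixes f \<phi> :: "real \<Rightarrow> real"
  assumes dom: "\<And>s t. 0 \<le> s \<Longrightarrow> s \<le> t \<Longrightarrow> t < g \<Longrightarrow> \<bar>f t - f s\<bar> \<le> \<phi> t - \<phi> s"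
    and bound: "\<And>t. 0 \<le> t \<Longrightarrow> t < g \<Longrightarrow> \<phi> t \<le> C"
    and const: "\<And>s. g \<le> s \<Longrightarrow> f s = f g"
  shows "\<exists>\<psi>. \<forall>s t. 0 \<le> s \<longrightarrow> s \<le> t \<longrightarrow> \<bar>f t - f s\<bar> \<le> \<psi> t - \<psi> s"
proof (intro exI allI impI)
  \<comment> \<open>For s < g \<le> t the increment is at most \<bar>f g - f 0\<bar> + \<phi> s -
    \<phi> 0, and \<phi> s is subtracted once more as \<psi> s. The two occurrences of \<phi> s
    account for the \<open>2 * C\<close>.\<close>
  let ?\<psi> = "\<lambda>t. if t < g then \<phi> t else 2 * C + \<bar>f g - f 0\<bar> - \<phi> 0"
  fix s t :: real assume st: "0 \<le> s" "s \<le> t"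
  consider "t < g" | "s < g" "g \<le> t" | "g \<le> s" using st by linarith
  then show "\<bar>f t - f s\<bar> \<le> ?\<psi> t - ?\<psi> s"
  proof cases
    case 1
    then show ?thesis using dom[OF st 1] st by simp
  next
    case 2
    then show ?thesis using dom[of 0 s] bound[of s] const[of t] st by simp
  next
    case 3
    then show ?thesis using const[of s] const[of t] st by simp
  qed
qed

context
  fixes f :: "real \<Rightarrow> real"
  assumes fv: "finite_variation_path f"
begin

lemma variation_fun_nonneg: "0 \<le> variation_fun f t"
  by (simp add: variation_fun_def)

lemma variation_eq_variation_fun: "variation f 0 t = ennreal (variation_fun f t)"
  using fv variation_empty[of t 0 f]
  by (cases "0 \<le> t") (auto simp: finite_variation_path_def variation_fun_def)

lemma variation_fun_increment:
  assumes "0 \<le> s" "s \<le> t"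
  shows "\<bar>f t - f s\<bar> \<le> variation_fun f t - variation_fun f s"
proof -
  have "variation f 0 s + ennreal \<bar>f t - f s\<bar> \<le> variation f 0 s + variation f s t"
    by (intro add_left_mono increment_le_variation) (use assms in auto)
  also have "\<dots> \<le> variation f 0 t"
    using assms by (intro variation_superadditive)
  finally have "ennreal (variation_fun f s + \<bar>f t - f s\<bar>) \<le> ennreal (variation_fun f t)"
    by (simp add: variation_eq_variation_fun variation_fun_nonneg)
  then show ?thesis
    by (subst (asm) ennreal_le_iff) (auto simp: variation_fun_def)
qed

lemma variation_fun_neg: "t \<le> 0 \<Longrightarrow> variation_fun f t = 0"
  using variation_empty[of t 0 f] variation_point[of f 0] by (cases "t = 0") (auto simp: variation_fun_def)

lemma variation_fun_mono: "s \<le> t \<Longrightarrow> variation_fun f s \<le> variation_fun f t"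
  using variation_fun_increment[of s t] variation_fun_neg[of s]
  by (cases "0 \<le> s") (auto simp: variation_fun_def)

lemma variation_fun_minus_mono:
  "s \<le> t \<Longrightarrow> variation_fun f s - f (max 0 s) \<le> variation_fun f t - f (max 0 t)"
  using variation_fun_increment[of "max 0 s" "max 0 t"] variation_fun_neg[of s] variation_fun_neg[of t]
    variation_fun_neg[of 0]
  by (auto simp: max_def split: if_splits)

text \<open>The path is a difference of two nondecreasing functions, each of which has left
  limits.\<close>

lemma finite_variation_left_limit:
  assumes "0 < t"
  shows "\<exists>l. (f \<longlongrightarrow> l) (at_left t)"
proof -
  let ?V = "variation_fun f"
  have lim: "\<exists>l. (\<phi> \<longlongrightarrow> l) (at_left t)" if "\<And>a b. a \<le> b \<Longrightarrow> \<phi> a \<le> \<phi> b" for \<phi> :: "real \<Rightarrow> real"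
    using Lim_left_bound[of UNIV t \<phi> "\<phi> t"] that by auto
  obtain l1 l2 where "(?V \<longlongrightarrow> l1) (at_left t)" "((\<lambda>s. ?V s - f (max 0 s)) \<longlongrightarrow> l2) (at_left t)"
    using lim[of ?V, OF variation_fun_mono]
      lim[of "\<lambda>s. ?V s - f (max 0 s)", OF variation_fun_minus_mono] by blast
  then have "((\<lambda>s. ?V s - (?V s - f (max 0 s))) \<longlongrightarrow> l1 - l2) (at_left t)"
    by (rule tendsto_diff)
  moreover have "eventually (\<lambda>s. ?V s - (?V s - f (max 0 s)) = f s) (at_left t)"
    using eventually_at_left_real[OF assms] by eventually_elim auto
  ultimately show ?thesis
    by (intro exI[of _ "l1 - l2"]) (rule Lim_transform_eventually)
qed

lemma finite_variation_cadlag: "right_cont_path f \<Longrightarrow> cadlag_path f"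
  using finite_variation_left_limit by (auto simp: cadlag_path_def)

text \<open>Pushing a partition of \<open>[t,b]\<close> to the right of \<open>t\<close> changes its increments arbitrarily
  little, so \<open>s \<mapsto> variation f s b\<close> is lower semicontinuous from the right.\<close>

lemma variation_fun_right_cont:
  assumes rc: "right_cont_path f"
  shows "continuous (at_right t) (variation_fun f)"
proof (cases "0 \<le> t")
  case False
  have "eventually (\<lambda>s. variation_fun f s = 0) (at_right t)"
    using eventually_at_right_real[of t 0] False by (auto elim!: eventually_mono simp: variation_fun_neg)
  then show ?thesis
    using False by (auto simp: continuous_within variation_fun_neg intro: tendsto_eventually)
next
  case True
  let ?V = "variation_fun f"
  have "(?V \<longlongrightarrow> ?V t) (at_right t)"
  proof (rule order_tendstoI)
    fix c assume "c < ?V t"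
    then have "c < ?V s" if "t < s" for s
      using variation_fun_mono[of t s] that by auto
    then show "eventually (\<lambda>s. c < ?V s) (at_right t)"
      using eventually_at_right_less[of t] by (auto elim: eventually_mono)
  next
    fix c assume c: "?V t < c"
    define b where "b = t + 1"
    have b: "t < b" "0 \<le> b" using True by (auto simp: b_def)
    have split: "ennreal (?V s) + variation f s b = ennreal (?V b)" if "t \<le> s" "s \<le> b" for s
      using variation_add[of 0 s b f] that True by (simp add: variation_eq_variation_fun)
    have fin: "variation f t b = ennreal (?V b - ?V t)"
      by (rule ennreal_add_eqD[OF split]) (use b in \<open>auto simp: variation_fun_def\<close>)
    show "eventually (\<lambda>s. ?V s < c) (at_right t)"
    proof (cases "?V b < c")
      case True
      have "eventually (\<lambda>s. s < b) (at_right t)"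
        using eventually_at_right_real[of t b] b by (auto elim!: eventually_mono)
      then show ?thesis
        by eventually_elim (use variation_fun_mono True in \<open>meson less_imp_le order_le_less_trans\<close>)
    next
      case False
      \<comment> \<open>By additivity, V s < c amounts to the variation over [s,b] exceeding V b -
        c. A chain in [t,b] already exceeds this bound strictly, and so will the chain pushed to the
        right of s once s is close to t.\<close>
      then have "ennreal (?V b - c) < variation f t b"
        unfolding fin using c by (intro ennreal_lessI) auto
      then obtain n x where x: "mono x" "range x \<subseteq> {t..b}"
        and lt: "ennreal (?V b - c) < (\<Sum>i<n. ennreal \<bar>f (x (Suc i)) - f (x i)\<bar>)"
        unfolding variation_def less_SUP_iff by auto
      have mem: "t \<le> x i" "x i \<le> b" for i using x(2) by (auto simp: image_subset_iff)
      let ?x = "\<lambda>s i. max s (x i)"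
      \<comment> \<open>Chain points equal to t move along with s, which is where right continuity
        enters; all other points stay fixed once s is close to t.\<close>
      have lim: "((\<lambda>s. f (?x s i)) \<longlongrightarrow> f (x i)) (at_right t)" for i
      proof (cases "x i = t")
        case True
        have "(f \<longlongrightarrow> f t) (at_right t)"
          using rc \<open>0 \<le> t\<close> by (auto simp: right_cont_path_def continuous_within)
        moreover have "eventually (\<lambda>s. f s = f (?x s i)) (at_right t)"
          using eventually_at_right_less[of t] by eventually_elim (use True in auto)
        ultimately show ?thesis
          using True by (auto intro: Lim_transform_eventually)
      next
        case False
        with mem[of i] have "eventually (\<lambda>s. s < x i) (at_right t)"
          using eventually_at_right_real[of t "x i"] by (auto elim!: eventually_mono)
        then have "eventually (\<lambda>s. f (?x s i) = f (x i)) (at_right t)"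
          by eventually_elim auto
        then show ?thesis by (rule tendsto_eventually)
      qed
      have "((\<lambda>s. \<Sum>i<n. \<bar>f (?x s (Suc i)) - f (?x s i)\<bar>) \<longlongrightarrow> (\<Sum>i<n. \<bar>f (x (Suc i)) - f (x i)\<bar>)) (at_right t)"
        by (intro tendsto_sum tendsto_rabs tendsto_diff lim)
      moreover have "?V b - c < (\<Sum>i<n. \<bar>f (x (Suc i)) - f (x i)\<bar>)"
        using lt False by (subst (asm) sum_ennreal) (auto simp: ennreal_less_iff)
      ultimately have "eventually (\<lambda>s. ?V b - c < (\<Sum>i<n. \<bar>f (?x s (Suc i)) - f (?x s i)\<bar>)) (at_right t)"
        by (rule order_tendstoD)
      moreover have "eventually (\<lambda>s. t < s \<and> s < b) (at_right t)"
        using b eventually_at_right_real[of t b] by (auto elim: eventually_mono)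
      ultimately show ?thesis
      proof eventually_elim
        case (elim s)
        have "ennreal (\<Sum>i<n. \<bar>f (?x s (Suc i)) - f (?x s i)\<bar>) \<le> variation f s b"
        proof -
          have "mono (?x s)" using x(1) by (auto simp: mono_def intro: max.coboundedI2)
          moreover have "range (?x s) \<subseteq> {s..b}" using mem elim by auto
          ultimately show ?thesis
            using chain_le_variation[of "?x s" s b f n] by (subst (asm) sum_ennreal) auto
        qed
        moreover have "variation f s b = ennreal (?V b - ?V s)"
          by (rule ennreal_add_eqD[OF split]) (use elim in \<open>auto simp: variation_fun_def\<close>)
        moreover have "?V s \<le> ?V b" using elim variation_fun_mono by auto
        ultimately have "(\<Sum>i<n. \<bar>f (?x s (Suc i)) - f (?x s i)\<bar>) \<le> ?V b - ?V s"
          by (simp add: ennreal_le_iff)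
        with elim show ?case by linarith
      qed
    qed
  qed
  then show ?thesis by (simp add: continuous_within)
qed

lemma variation_fun_minus_right_cont:
  assumes rc: "right_cont_path f"
  shows "continuous (at_right t) (\<lambda>s. variation_fun f s - f (max 0 s))"
proof (intro continuous_diff variation_fun_right_cont[OF rc])
  show "continuous (at_right t) (\<lambda>s. f (max 0 s))"
  proof (cases "0 \<le> t")
    case True
    have "(f \<longlongrightarrow> f t) (at_right t)"
      using rc True by (auto simp: right_cont_path_def continuous_within)
    moreover have "eventually (\<lambda>s. f s = f (max 0 s)) (at_right t)"
      using eventually_at_right_less[of t] by eventually_elim (use True in auto)
    ultimately show ?thesis
      using True by (auto simp: continuous_within intro: Lim_transform_eventually)
  next
    case False
    then have "eventually (\<lambda>s. s < 0) (at_right t)"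
      using eventually_at_right_real[of t 0] by (auto elim!: eventually_mono)
    then have "eventually (\<lambda>s. f (max 0 s) = f 0) (at_right t)"
      by eventually_elim auto
    then show ?thesis
      using False by (auto simp: continuous_within intro: tendsto_eventually)
  qed
qed

end

section \<open>Stieltjes integrals of indicators\<close>

lemma measure_Ioo_tendsto:
  fixes g :: real
  assumes [simp]: "sets m = sets borel" and fin: "emeasure m {0<..<g} \<noteq> \<infinity>"
  shows "((\<lambda>s. measure m {0<..s}) \<longlongrightarrow> measure m {0<..<g}) (at_left g)"
proof (rule tendsto_at_left_sequentially[of "g - 1"])
  fix X :: "nat \<Rightarrow> real"
  assume X: "\<And>n. X n < g" "incseq X" "X \<longlonglongrightarrow> g"
  have eq: "(\<Union>n. {0<..X n}) = {0<..<g}"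
  proof safe
    fix y assume "y \<in> {0<..<g}"
    moreover from this have "eventually (\<lambda>n. y < X n) sequentially"
      using X(3) by (auto dest: order_tendstoD)
    ultimately show "y \<in> (\<Union>n. {0<..X n})"
      by (auto simp: eventually_sequentially) (meson less_imp_le order_refl)
  qed (use X(1) in \<open>auto intro: le_less_trans\<close>)
  have "incseq (\<lambda>n. {0<..X n})"
    by (rule incseq_SucI) (use incseq_SucD[OF X(2)] in \<open>fastforce intro: order_trans\<close>)
  then have "(\<lambda>n. measure m {0<..X n}) \<longlonglongrightarrow> measure m (\<Union>n. {0<..X n})"
    using fin unfolding eq[symmetric] by (intro Lim_measure_incseq) auto
  then show "(\<lambda>n. measure m {0<..X n}) \<longlonglongrightarrow> measure m {0<..<g}"
    unfolding eq .
qed auto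

text \<open>This is uniqueness of signed measures given on half-lines, written without signed
  measures. Half-lines form an intersection-stable generator of the Borel sets; closure under
  complements requires equal total masses, which are the limits of the hypothesis along
  \<open>{..real n}\<close>.\<close>

lemma balanced_measures:
  fixes a b c d :: "real measure"
  assumes fin: "finite_measure a" "finite_measure b" "finite_measure c" "finite_measure d"
    and sets [simp]: "sets a = sets borel" "sets b = sets borel" "sets c = sets borel" "sets d = sets borel"
    and eq: "\<And>s. measure a {..s} + measure b {..s} = measure c {..s} + measure d {..s}"
    and C: "C \<in> sets borel"
  shows "measure a C + measure b C = measure c C + measure d C"
proof -
  interpret a: finite_measure a by fact
  interpret b: finite_measure b by fact
  interpret c: finite_measure c by fact
  interpret d: finite_measure d by fact
  have space [simp]: "space a = UNIV" "space b = UNIV" "space c = UNIV" "space d = UNIV"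
    using sets_eq_imp_space_eq[OF sets(1)] sets_eq_imp_space_eq[OF sets(2)]
      sets_eq_imp_space_eq[OF sets(3)] sets_eq_imp_space_eq[OF sets(4)] by auto
  have UN: "(\<Union>n. {..real n}) = UNIV"
    using real_arch_simple by auto
  have lim: "(\<lambda>n. measure m {..real n}) \<longlonglongrightarrow> measure m UNIV"
    if "finite_measure m" and [simp]: "sets m = sets borel" for m
    using finite_measure.finite_Lim_measure_incseq[OF that(1), of "\<lambda>n. {..real n}"]
    unfolding UN by (force simp: incseq_def)
  have total: "measure a UNIV + measure b UNIV = measure c UNIV + measure d UNIV"
  proof (rule LIMSEQ_unique)
    show "(\<lambda>n. measure a {..real n} + measure b {..real n}) \<longlonglongrightarrow> measure a UNIV + measure b UNIV"
      by (intro tendsto_add lim fin sets)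
    show "(\<lambda>n. measure a {..real n} + measure b {..real n}) \<longlonglongrightarrow> measure c UNIV + measure d UNIV"
      unfolding eq by (intro tendsto_add lim fin sets)
  qed
  have "Int_stable (range (atMost :: real \<Rightarrow> _))"
    by (auto simp: Int_stable_def)
  moreover have "range atMost \<subseteq> Pow (UNIV :: real set)"
    by simp
  moreover have "C \<in> sigma_sets UNIV (range atMost)"
    using C by (simp add: borel_eq_atMost)
  ultimately show ?thesis
  proof (induction rule: sigma_sets_induct_disjoint)
    case (basic A)
    then show ?case using eq by auto
  next
    case empty
    show ?case by simp
  next
    case (compl A)
    then have "A \<in> sets borel" by (simp add: borel_eq_atMost)
    then show ?case
      using compl(2) total a.finite_measure_compl[of A] b.finite_measure_compl[of A]
        c.finite_measure_compl[of A] d.finite_measure_compl[of A] by simp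
  next
    case (union A)
    then have A: "range A \<subseteq> sets borel" by (simp add: borel_eq_atMost)
    have "(\<lambda>i. measure a (A i) + measure b (A i)) sums (measure a (\<Union>i. A i) + measure b (\<Union>i. A i))"
      using a.finite_measure_UNION[of A] b.finite_measure_UNION[of A] A union(1) by (intro sums_add) auto
    moreover have "(\<lambda>i. measure a (A i) + measure b (A i)) sums (measure c (\<Union>i. A i) + measure d (\<Union>i. A i))"
      unfolding union(3)
      using c.finite_measure_UNION[of A] d.finite_measure_UNION[of A] A union(1) by (intro sums_add) auto
    ultimately show ?case by (rule sums_unique2)
  qed
qed

text \<open>The measures of a path are finite on bounded intervals only, so they are first
  restricted to \<open>I\<close>.\<close>

lemma balanced_measures_on:
  fixes a b c d :: "real measure"
  assumes fin: "emeasure a I \<noteq> \<infinity>" "emeasure b I \<noteq> \<infinity>" "emeasure c I \<noteq> \<infinity>" "emeasure d I \<noteq> \<infinity>"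
    and sets [simp]: "sets a = sets borel" "sets b = sets borel" "sets c = sets borel" "sets d = sets borel"
    and I [simp]: "I \<in> sets borel"
    and eq: "\<And>s. measure a (I \<inter> {..s}) + measure b (I \<inter> {..s}) = measure c (I \<inter> {..s}) + measure d (I \<inter> {..s})"
    and C [simp]: "C \<in> sets borel"
  shows "measure a (I \<inter> C) + measure b (I \<inter> C) = measure c (I \<inter> C) + measure d (I \<inter> C)"
proof -
  have *: "finite_measure (density m (indicator I))"
    if "sets m = sets borel" "emeasure m I \<noteq> \<infinity>" for m
    using that sets_eq_imp_space_eq[OF that(1)]
    by (auto intro!: finite_measureI simp: emeasure_restricted)
  have **: "measure (density m (indicator I)) B = measure m (I \<inter> B)"
    if "sets m = sets borel" "B \<in> sets borel" for m B
    using that by (simp add: emeasure_restricted measure_def)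
  show ?thesis
    using balanced_measures[of "density a (indicator I)" "density b (indicator I)"
        "density c (indicator I)" "density d (indicator I)" C] eq fin
    by (simp add: * **)
qed

text \<open>Serves to integrate the reciprocal of \<open>Gbar\<close> against a balance, which
  removes the weight P(\<gamma> > s) from dF(s).\<close>

lemma balanced_nn_integrals:
  fixes h :: "real \<Rightarrow> ennreal"
  assumes sets [measurable_cong, simp]: "sets a = sets borel" "sets b = sets borel" "sets c = sets borel" "sets d = sets borel"
    and eq: "\<And>C. C \<in> sets borel \<Longrightarrow> emeasure a C + emeasure b C = emeasure c C + emeasure d C"
    and h: "h \<in> borel_measurable borel"
  shows "(\<integral>\<^sup>+x. h x \<partial>a) + (\<integral>\<^sup>+x. h x \<partial>b) = (\<integral>\<^sup>+x. h x \<partial>c) + (\<integral>\<^sup>+x. h x \<partial>d)"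
  using h
proof (induction rule: borel_measurable_induct)
  case (cong f g)
  then show ?case by simp
next
  case (set A)
  then show ?case using eq[of A] by simp
next
  case (mult u v)
  then show ?case by (simp add: nn_integral_cmult flip: distrib_left)
next
  case (add u v)
  have "(\<integral>\<^sup>+x. u x \<partial>a) + (\<integral>\<^sup>+x. v x \<partial>a) + ((\<integral>\<^sup>+x. u x \<partial>b) + (\<integral>\<^sup>+x. v x \<partial>b)) =
      ((\<integral>\<^sup>+x. u x \<partial>a) + (\<integral>\<^sup>+x. u x \<partial>b)) + ((\<integral>\<^sup>+x. v x \<partial>a) + (\<integral>\<^sup>+x. v x \<partial>b))"
    by (simp add: ac_simps)
  also have "\<dots> = (\<integral>\<^sup>+x. u x \<partial>c) + (\<integral>\<^sup>+x. v x \<partial>c) + ((\<integral>\<^sup>+x. u x \<partial>d) + (\<integral>\<^sup>+x. v x \<partial>d))"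
    unfolding add.IH by (simp add: ac_simps)
  finally show ?case
    using add.hyps by (simp add: nn_integral_add ac_simps)
next
  case (seq U)
  have U [measurable]: "U i \<in> borel_measurable borel" for i using seq by auto
  have mono: "incseq (\<lambda>i. \<integral>\<^sup>+x. U i x \<partial>m)" for m
    using seq(3) by (auto simp: incseq_def le_fun_def intro!: nn_integral_mono)
  have sup: "(\<integral>\<^sup>+x. (SUP i. U i x) \<partial>m) = (SUP i. \<integral>\<^sup>+x. U i x \<partial>m)"
    if [measurable_cong]: "sets m = sets borel" for m
    using seq(3) by (intro nn_integral_monotone_convergence_SUP) measurable
  have key: "(\<integral>\<^sup>+x. (SUP i. U i x) \<partial>m) + (\<integral>\<^sup>+x. (SUP i. U i x) \<partial>m') =
      (SUP i. (\<integral>\<^sup>+x. U i x \<partial>m) + (\<integral>\<^sup>+x. U i x \<partial>m'))"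
    if "sets m = sets borel" "sets m' = sets borel" for m m'
    unfolding sup[OF that(1)] sup[OF that(2)] by (rule ennreal_SUP_add[symmetric]; rule mono)
  have U_eq: "(SUP i. U i) = (\<lambda>x. SUP i. U i x)"
    by (auto simp: SUP_apply[abs_def] image_image)
  show ?case
    unfolding U_eq by (simp only: key sets seq.IH)
qed

definition variation_measure :: "(real \<Rightarrow> real) \<Rightarrow> real measure" where
  "variation_measure f = interval_measure (variation_fun f)"

text \<open>With V the variation function, V - f is up to a constant twice the negative variation of
  a path of finite variation. The difference of \<open>variation_measure\<close> and this measure is
  df on bounded subsets of (0,\<infinity>).\<close>

definition excess_measure :: "(real \<Rightarrow> real) \<Rightarrow> real measure" where
  "excess_measure f = interval_measure (\<lambda>s. variation_fun f s - f (max 0 s))"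

lemma sets_variation_measure [simp, measurable_cong]: "sets (variation_measure f) = sets borel"
  and sets_excess_measure [simp, measurable_cong]: "sets (excess_measure f) = sets borel"
  by (simp_all add: variation_measure_def excess_measure_def)

lemma stieltjes_integral_indicator:
  assumes "C \<in> sets borel"
  shows "stieltjes_integral f (indicator C) t =
    measure (variation_measure f) ({0<..t} \<inter> C) - measure (excess_measure f) ({0<..t} \<inter> C)"
  using assms unfolding stieltjes_integral_def variation_measure_def excess_measure_def set_lebesgue_integral_def
  by (simp flip: indicator_inter_arith)

context
  fixes f :: "real \<Rightarrow> real"
  assumes rc: "right_cont_path f" and fv: "finite_variation_path f"
begin

lemma emeasure_variation_measure_Ioc:
    "a \<le> b \<Longrightarrow> emeasure (variation_measure f) {a<..b} = ennreal (variation_fun f b - variation_fun f a)"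
  and emeasure_excess_measure_Ioc:
    "a \<le> b \<Longrightarrow> emeasure (excess_measure f) {a<..b} =
      ennreal ((variation_fun f b - f (max 0 b)) - (variation_fun f a - f (max 0 a)))"
  unfolding variation_measure_def excess_measure_def
  by (intro emeasure_interval_measure_Ioc variation_fun_mono[OF fv] variation_fun_minus_mono[OF fv]
      variation_fun_right_cont[OF fv rc] variation_fun_minus_right_cont[OF fv rc]; assumption)+

lemma measure_variation_measure_Ioc:
    "a \<le> b \<Longrightarrow> measure (variation_measure f) {a<..b} = variation_fun f b - variation_fun f a"
  and measure_excess_measure_Ioc:
    "a \<le> b \<Longrightarrow> measure (excess_measure f) {a<..b} =
      (variation_fun f b - f (max 0 b)) - (variation_fun f a - f (max 0 a))"
  using variation_fun_mono[OF fv, of a b] variation_fun_minus_mono[OF fv, of a b]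
  by (simp_all add: measure_def emeasure_variation_measure_Ioc emeasure_excess_measure_Ioc)

lemma emeasure_path_finite:
  assumes "0 \<le> t" "A \<subseteq> {0<..t}" "A \<in> sets borel"
  shows "emeasure (variation_measure f) A \<noteq> \<infinity>" "emeasure (excess_measure f) A \<noteq> \<infinity>"
  using emeasure_mono[OF assms(2), of "variation_measure f"] emeasure_mono[OF assms(2), of "excess_measure f"]
    assms by (auto simp: emeasure_variation_measure_Ioc emeasure_excess_measure_Ioc top_unique)

lemma path_eq_measures:
  assumes "0 \<le> t"
  shows "f t = f 0 + measure (variation_measure f) {0<..t} - measure (excess_measure f) {0<..t}"
  using assms by (simp add: measure_variation_measure_Ioc measure_excess_measure_Ioc)

text \<open>Recovers the path from its integrals over an exhausting sequence of sets, by continuity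
  from below of both measures. Whatever the integrals have in common, such as being constant after
  the jump, is thereby passed on to the path.\<close>

lemma stieltjes_integral_tendsto:
  assumes C: "\<And>n. C n \<in> sets borel" "incseq C" "{0<..} \<subseteq> (\<Union>n. C n)" and t: "0 \<le> t"
  shows "(\<lambda>n. stieltjes_integral f (indicator (C n)) t) \<longlonglongrightarrow> f t - f 0"
proof -
  have UN: "(\<Union>n. {0<..t} \<inter> C n) = {0<..t}" using C(3) by auto
  have inc: "incseq (\<lambda>n. {0<..t} \<inter> C n)" using C(2) by (auto simp: incseq_def)
  have "(\<lambda>n. measure m ({0<..t} \<inter> C n)) \<longlonglongrightarrow> measure m (\<Union>n. {0<..t} \<inter> C n)"
    if "sets m = sets borel" "emeasure m {0<..t} \<noteq> \<infinity>" for m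
    using inc C(1) that UN by (intro Lim_measure_incseq) auto
  from tendsto_diff[OF this[of "variation_measure f"] this[of "excess_measure f"]]
  show ?thesis
    unfolding UN using path_eq_measures[OF t] emeasure_path_finite[OF t] C(1)
    by (simp add: stieltjes_integral_indicator)
qed

text \<open>The integral depends on df only: any finite measures whose difference reproduces the
  increments of the path may replace the pair built from its own variation. On half-lines in (0,t]
  the two pairs are balanced, hence on all Borel sets.\<close>

lemma stieltjes_integral_eq_measures:
  assumes m: "finite_measure m1" "finite_measure m2" "sets m1 = sets borel" "sets m2 = sets borel"
    and eq: "\<And>s. 0 \<le> s \<Longrightarrow> s \<le> t \<Longrightarrow> f s = f 0 + measure m1 {0<..s} - measure m2 {0<..s}"
    and C: "C \<in> sets borel" and t: "0 \<le> t"
  shows "stieltjes_integral f (indicator C) t = measure m1 ({0<..t} \<inter> C) - measure m2 ({0<..t} \<inter> C)"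
proof -
  have fin: "emeasure m1 A \<noteq> \<infinity>" "emeasure m2 A \<noteq> \<infinity>" for A
    using m by (auto simp: finite_measure.emeasure_eq_measure)
  have "measure (variation_measure f) ({0<..t} \<inter> C) + measure m2 ({0<..t} \<inter> C) =
      measure (excess_measure f) ({0<..t} \<inter> C) + measure m1 ({0<..t} \<inter> C)"
  proof (rule balanced_measures_on)
    fix s
    consider "s < 0" | "0 \<le> s" "s \<le> t" | "t \<le> s" by linarith
    then show "measure (variation_measure f) ({0<..t} \<inter> {..s}) + measure m2 ({0<..t} \<inter> {..s}) =
      measure (excess_measure f) ({0<..t} \<inter> {..s}) + measure m1 ({0<..t} \<inter> {..s})"
    proof cases
      case 1
      then have "{0<..t} \<inter> {..s} = {}" by auto
      then show ?thesis by simp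
    next
      case 2
      then have "{0<..t} \<inter> {..s} = {0<..s}" by auto
      then show ?thesis using eq[OF 2] path_eq_measures[OF 2(1)] by simp
    next
      case 3
      then have "{0<..t} \<inter> {..s} = {0<..t}" by auto
      then show ?thesis using eq[OF t] path_eq_measures[OF t] by simp
    qed
  qed (use m C t emeasure_path_finite[OF t order_refl] fin in auto)
  then show ?thesis
    using stieltjes_integral_indicator[OF C, of f t] by simp
qed

text \<open>Here \<open>m1\<close> and \<open>m2\<close> describe the path strictly before
  \<open>g\<close>, so that they can be chosen independently of the sample point. By left limits f 0
  + m1(0,g) - m2(0,g) equals f(g-) if g > 0, so the bracket is the jump at \<open>g\<close>.\<close>

lemma stieltjes_integral_eq_measures_jump:
  assumes m: "finite_measure m1" "finite_measure m2" "sets m1 = sets borel" "sets m2 = sets borel"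
    and eq: "\<And>s. 0 \<le> s \<Longrightarrow> s < g \<Longrightarrow> f s = f 0 + measure m1 {0<..s} - measure m2 {0<..s}"
    and const: "\<And>s. g \<le> s \<Longrightarrow> f s = f g"
    and C: "C \<in> sets borel" and g: "0 \<le> g" "g \<le> t"
  shows "stieltjes_integral f (indicator C) t =
    measure m1 ({0<..<g} \<inter> C) - measure m2 ({0<..<g} \<inter> C)
    + indicator C g * (f g - f 0 - measure m1 {0<..<g} + measure m2 {0<..<g})"
proof (cases "g = 0")
  case True
  \<comment> \<open>For g = 0 the path is constant from time 0 on and is represented by two zero
    measures; the bracket vanishes as well.\<close>
  have "stieltjes_integral f (indicator C) t =
      measure (null_measure borel) ({0<..t} \<inter> C) - measure (null_measure borel) ({0<..t} \<inter> C)"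
  proof (rule stieltjes_integral_eq_measures)
    show "f s = f 0 + measure (null_measure borel) {0<..s} - measure (null_measure borel) {0<..s}"
      if "0 \<le> s" for s using const[of s] that True by simp
  qed (use True C g in \<open>auto intro!: finite_measureI\<close>)
  then show ?thesis using True by simp
next
  case False
  with g have g0: "0 < g" by simp
  let ?V = "variation_measure f" and ?E = "excess_measure f"
  note m(3,4)[simp] C[simp]
  have fin: "emeasure m1 A \<noteq> \<infinity>" "emeasure m2 A \<noteq> \<infinity>" for A
    using m by (auto simp: finite_measure.emeasure_eq_measure)
  have finV: "emeasure ?V A \<noteq> \<infinity>" "emeasure ?E A \<noteq> \<infinity>" if "A \<subseteq> {0<..t}" "A \<in> sets borel" for A
    using emeasure_path_finite[of t A] g that by auto
  have sub: "{0<..<g} \<subseteq> {0<..t}" using g by auto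
  have ev: "eventually (\<lambda>s. 0 < s \<and> s < g) (at_left g)"
    using eventually_at_left_real[OF g0] by (auto elim: eventually_mono)
  have step: "measure ?V {0<..s} + measure m2 {0<..s} = measure ?E {0<..s} + measure m1 {0<..s}"
    if "0 \<le> s" "s < g" for s
    using eq[OF that] path_eq_measures[OF that(1)] by linarith
  \<comment> \<open>The representation holds on (0,s] for s < g only. Its left limit at
    \<open>g\<close> gives the balance of the full masses of (0,g), needed for half-lines reaching
    beyond \<open>g\<close>.\<close>
  have total: "measure ?V {0<..<g} + measure m2 {0<..<g} = measure ?E {0<..<g} + measure m1 {0<..<g}"
  proof (rule tendsto_unique)
    show "((\<lambda>s. measure ?V {0<..s} + measure m2 {0<..s}) \<longlongrightarrow> measure ?V {0<..<g} + measure m2 {0<..<g}) (at_left g)"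
      by (intro tendsto_add measure_Ioo_tendsto fin finV sub) auto
    have "((\<lambda>s. measure ?E {0<..s} + measure m1 {0<..s}) \<longlongrightarrow> measure ?E {0<..<g} + measure m1 {0<..<g}) (at_left g)"
      by (intro tendsto_add measure_Ioo_tendsto fin finV sub) auto
    then show "((\<lambda>s. measure ?V {0<..s} + measure m2 {0<..s}) \<longlongrightarrow> measure ?E {0<..<g} + measure m1 {0<..<g}) (at_left g)"
      by (rule Lim_transform_eventually) (use ev in eventually_elim, simp add: step)
  qed simp
  have open_part: "measure ?V ({0<..<g} \<inter> C) + measure m2 ({0<..<g} \<inter> C) =
      measure ?E ({0<..<g} \<inter> C) + measure m1 ({0<..<g} \<inter> C)"
  proof (rule balanced_measures_on)
    fix s
    consider "s < 0" | "0 \<le> s" "s < g" | "g \<le> s" by linarith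
    then show "measure ?V ({0<..<g} \<inter> {..s}) + measure m2 ({0<..<g} \<inter> {..s}) =
      measure ?E ({0<..<g} \<inter> {..s}) + measure m1 ({0<..<g} \<inter> {..s})"
    proof cases
      case 1
      then have "{0<..<g} \<inter> {..s} = {}" by auto
      then show ?thesis by simp
    next
      case 2
      then have "{0<..<g} \<inter> {..s} = {0<..s}" by auto
      then show ?thesis using step 2 by simp
    next
      case 3
      then have "{0<..<g} \<inter> {..s} = {0<..<g}" by auto
      then show ?thesis using total by simp
    qed
  qed (use finV sub fin in auto)
  have point: "measure m {0<..g} = measure m {0<..<g} + measure m {g}"
    if "sets m = sets borel" "emeasure m {0<..t} \<noteq> \<infinity>" for m
  proof -
    have "{0<..g} = {0<..<g} \<union> {g}" using g0 by auto
    moreover have "emeasure m {0<..<g} \<noteq> \<infinity>" "emeasure m {g} \<noteq> \<infinity>"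
      using emeasure_mono[OF sub, of m] emeasure_mono[of "{g}" "{0<..t}" m] that g g0
      by (auto simp: top_unique)
    ultimately show ?thesis
      using that by (simp only:) (rule measure_Union, auto)
  qed
  have jump: "measure ?V {g} - measure ?E {g} = f g - f 0 - measure m1 {0<..<g} + measure m2 {0<..<g}"
    using point[of ?V] point[of ?E] finV[of "{0<..t}"] path_eq_measures[of g] g total by simp
  \<comment> \<open>Constancy after \<open>g\<close> makes the variation over [g,t] vanish, so both
    measures are null there.\<close>
  have tail: "measure ?V {g<..t} = 0" "measure ?E {g<..t} = 0"
  proof -
    have "variation f g t \<le> ennreal (0 - 0)"
    proof (rule variation_le_dominating[of g t f "\<lambda>_. 0"])
      show "\<bar>f b - f a\<bar> \<le> 0 - 0" if "g \<le> a" "a \<le> b" for a b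
        using const[of a] const[of b] that by simp
    qed (use g in simp)
    then have "variation_fun f t = variation_fun f g"
      using variation_subadditive[of 0 g t f] variation_mono[of 0 g 0 t f] g
      unfolding variation_eq_variation_fun[OF fv]
      by (auto simp: variation_fun_nonneg[OF fv])
    then show "measure ?V {g<..t} = 0" "measure ?E {g<..t} = 0"
      using g const[of t] by (auto simp: measure_variation_measure_Ioc measure_excess_measure_Ioc)
  qed
  have subset_tail: "{g<..t} \<subseteq> {0<..t}"
    using g by (auto intro: le_less_trans)
  have tailC: "measure ?V ({g<..t} \<inter> C) = 0" "measure ?E ({g<..t} \<inter> C) = 0"
  proof -
    have "measure m ({g<..t} \<inter> C) = 0"
      if [simp]: "sets m = sets borel" and "emeasure m {g<..t} \<noteq> \<infinity>" and zero: "measure m {g<..t} = 0" for m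
    proof -
      have "{g<..t} \<in> fmeasurable m"
        using that(2) by (simp add: fmeasurable_def less_top)
      then have "measure m ({g<..t} \<inter> C) \<le> measure m {g<..t}"
        by (intro measure_mono_fmeasurable) auto
      then show ?thesis
        unfolding zero by (simp add: measure_le_0_iff)
    qed
    then show "measure ?V ({g<..t} \<inter> C) = 0" "measure ?E ({g<..t} \<inter> C) = 0"
      using tail finV[of "{g<..t}"] subset_tail by auto
  qed
  have decomp: "measure m ({0<..t} \<inter> C) =
      measure m ({0<..<g} \<inter> C) + indicator C g * measure m {g} + measure m ({g<..t} \<inter> C)"
    if "sets m = sets borel" "emeasure m {0<..t} \<noteq> \<infinity>" for m
  proof -
    have finm: "emeasure m A \<noteq> \<infinity>" if "A \<subseteq> {0<..t}" for A
      using emeasure_mono[OF that, of m] \<open>emeasure m {0<..t} \<noteq> \<infinity>\<close> \<open>sets m = sets borel\<close>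
      by (auto simp: top_unique)
    have "{0<..t} \<inter> C = (({0<..<g} \<inter> C) \<union> ({g} \<inter> C)) \<union> ({g<..t} \<inter> C)"
      using g g0 by auto
    moreover have "measure m ((({0<..<g} \<inter> C) \<union> ({g} \<inter> C)) \<union> ({g<..t} \<inter> C)) =
        measure m (({0<..<g} \<inter> C) \<union> ({g} \<inter> C)) + measure m ({g<..t} \<inter> C)"
    proof (rule measure_Union)
      show "{0<..<g} \<inter> C \<union> {g} \<inter> C \<in> sets m"
        unfolding that(1) by (intro sets.Un sets.Int) auto
      show "emeasure m (({0<..<g} \<inter> C) \<union> ({g} \<inter> C)) \<noteq> \<infinity>"
        by (rule finm) (use sub g g0 in auto)
      show "emeasure m ({g<..t} \<inter> C) \<noteq> \<infinity>"
        by (rule finm) (use subset_tail in blast)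
    qed (use g g0 in \<open>auto simp: that(1)\<close>)
    moreover have "measure m (({0<..<g} \<inter> C) \<union> ({g} \<inter> C)) = measure m ({0<..<g} \<inter> C) + measure m ({g} \<inter> C)"
    proof (rule measure_Union)
      show "emeasure m ({0<..<g} \<inter> C) \<noteq> \<infinity>"
        by (rule finm) (use sub in blast)
      show "emeasure m ({g} \<inter> C) \<noteq> \<infinity>"
        by (rule finm) (use g g0 in auto)
    qed (use g g0 in \<open>auto simp: that(1)\<close>)
    moreover have "measure m ({g} \<inter> C) = indicator C g * measure m {g}"
      by (auto split: split_indicator)
    ultimately show ?thesis by simp
  qed
  show ?thesis
    unfolding stieltjes_integral_indicator[OF C] jump[symmetric]
    using decomp[of ?V] decomp[of ?E] finV[of "{0<..t}"] open_part tailC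
    by (simp add: algebra_simps)
qed

end

section \<open>The law of the jump time\<close>

locale single_jump = prob_space P for P :: "'a measure" +
  fixes \<gamma> :: "'a \<Rightarrow> ennreal"
  assumes measurable_jump [measurable]: "\<gamma> \<in> borel_measurable P"
    and jump_pos: "measure P {\<omega> \<in> space P. \<gamma> \<omega> > 0} > 0"
begin

abbreviation "\<nu> \<equiv> jump_law P \<gamma>"
abbreviation "\<F> \<equiv> sj_filtration P \<gamma>"

text \<open>Its value is 0 where \<open>\<gamma>\<close> is infinite. For this reason integrals of
  functions of \<open>jump\<close> carry the indicator of
  \<open>\<gamma> \<omega> < \<infinity>\<close>.\<close>

definition jump :: "'a \<Rightarrow> real" where
  "jump \<omega> = enn2real (\<gamma> \<omega>)"

definition Gbar :: "real \<Rightarrow> real" where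
  "Gbar t = measure P {\<omega> \<in> space P. ennreal t < \<gamma> \<omega>}"

lemma measurable_jump_real [measurable]: "jump \<in> borel_measurable P"
  unfolding jump_def[abs_def] by measurable

lemma jump_nonneg: "0 \<le> jump \<omega>"
  by (simp add: jump_def)

lemma ennreal_jump: "\<gamma> \<omega> < \<infinity> \<Longrightarrow> ennreal (jump \<omega>) = \<gamma> \<omega>"
  by (simp add: jump_def)

lemma jump_le_iff: "0 \<le> t \<Longrightarrow> \<gamma> \<omega> \<le> ennreal t \<longleftrightarrow> \<gamma> \<omega> < \<infinity> \<and> jump \<omega> \<le> t"
  unfolding jump_def by (cases "\<gamma> \<omega>") (auto simp: top_unique)

lemma less_jump_iff: "0 \<le> t \<Longrightarrow> ennreal t < \<gamma> \<omega> \<longleftrightarrow> (\<gamma> \<omega> < \<infinity> \<longrightarrow> t < jump \<omega>)"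
  using jump_le_iff[of t \<omega>] by (auto simp: not_le[symmetric])

text \<open>Both measures are finite and have the same distribution function. Writing dG as the law
  of the finite jump times, a measure of mass P(\<gamma> < \<infinity>), turns integrals against dG
  into expectations.\<close>

lemma jump_law_eq_distr:
  "\<nu> = distr (density P (indicator {\<omega> \<in> space P. \<gamma> \<omega> < \<infinity>})) borel jump" (is "_ = ?N")
proof -
  let ?D = "density P (indicator {\<omega> \<in> space P. \<gamma> \<omega> < \<infinity>} :: _ \<Rightarrow> ennreal)"
  have "finite_measure ?D"
    by (rule finite_measureI) (simp add: emeasure_restricted)
  then have "finite_measure ?N"
    by (rule finite_measure.finite_measure_distr) measurable
  then interpret N: finite_borel_measure ?N
    by (simp add: finite_borel_measure_def finite_borel_measure_axioms_def)
  have "cdf ?N t = jump_cdf P \<gamma> t" for t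
  proof -
    have "cdf ?N t = measure ?D {\<omega> \<in> space P. jump \<omega> \<le> t}"
      unfolding cdf_def by (subst measure_distr) (auto intro!: arg_cong2[where f=measure])
    also have "\<dots> = measure P ({\<omega> \<in> space P. \<gamma> \<omega> < \<infinity>} \<inter> {\<omega> \<in> space P. jump \<omega> \<le> t})"
      by (subst measure_restricted) auto
    also have "\<dots> = jump_cdf P \<gamma> t"
    proof (cases "t < 0")
      case True
      then have empty: "{\<omega> \<in> space P. jump \<omega> \<le> t} = {}"
        using jump_nonneg by (auto simp: not_le intro: less_le_trans)
      show ?thesis unfolding empty using True by (simp add: jump_cdf_def)
    next
      case False
      then show ?thesis
        by (auto simp: jump_cdf_def jump_le_iff intro!: arg_cong[where f="measure P"])
    qed
    finally show ?thesis .
  qed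
  then have cdf: "cdf ?N = jump_cdf P \<gamma>" by auto
  have "cdf \<nu> = cdf ?N"
    unfolding jump_law_def cdf[symmetric]
    by (rule cdf_interval_measure[OF N.cdf_nondecreasing N.cdf_is_right_cont N.cdf_lim_at_bot])
  moreover have "finite_borel_measure \<nu>"
    unfolding jump_law_def cdf[symmetric]
    by (rule finite_borel_measure_interval_measure[OF N.cdf_nondecreasing N.cdf_is_right_cont
          N.cdf_lim_at_bot N.cdf_lim_at_top]) auto
  ultimately show ?thesis
    using N.finite_borel_measure_axioms by (intro cdf_unique')
qed

lemma sets_jump_law [simp, measurable_cong]: "sets \<nu> = sets borel"
  by (simp add: jump_law_def)

lemma space_jump_law [simp]: "space \<nu> = UNIV"
  by (simp add: jump_law_def)

lemma nn_integral_jump_law: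
  assumes [measurable]: "h \<in> borel_measurable borel"
  shows "(\<integral>\<^sup>+t. h t \<partial>\<nu>) = (\<integral>\<^sup>+\<omega>. h (jump \<omega>) * indicator {\<omega>. \<gamma> \<omega> < \<infinity>} \<omega> \<partial>P)"
  unfolding jump_law_eq_distr
  by (subst nn_integral_distr, simp, simp, subst nn_integral_density)
    (auto intro!: nn_integral_cong split: split_indicator)

lemma finite_jump_law: "finite_measure \<nu>"
proof -
  have "finite_measure (density P (indicator {\<omega> \<in> space P. \<gamma> \<omega> < \<infinity>}))"
    by (rule finite_measureI) (simp add: emeasure_restricted)
  then show ?thesis
    unfolding jump_law_eq_distr by (rule finite_measure.finite_measure_distr) measurable
qed

sublocale law: finite_measure \<nu>
  by (rule finite_jump_law)

lemma integrable_jump_law_iff: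
  fixes h :: "real \<Rightarrow> real"
  assumes [measurable]: "h \<in> borel_measurable borel"
  shows "integrable \<nu> h \<longleftrightarrow> integrable P (\<lambda>\<omega>. h (jump \<omega>) * indicator {\<omega>. \<gamma> \<omega> < \<infinity>} \<omega>)"
  unfolding integrable_iff_bounded
  by (subst nn_integral_jump_law) (auto simp: abs_mult ennreal_mult' ennreal_indicator)

lemma integral_jump_law:
  fixes h :: "real \<Rightarrow> real"
  assumes [measurable]: "h \<in> borel_measurable borel"
  shows "(\<integral>t. h t \<partial>\<nu>) = (\<integral>\<omega>. h (jump \<omega>) * indicator {\<omega>. \<gamma> \<omega> < \<infinity>} \<omega> \<partial>P)"
proof -
  let ?D = "density P (\<lambda>\<omega>. ennreal (indicator {\<omega> \<in> space P. \<gamma> \<omega> < \<infinity>} \<omega>))"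
  have "(\<integral>t. h t \<partial>\<nu>) = (\<integral>\<omega>. h (jump \<omega>) \<partial>?D)"
    unfolding jump_law_eq_distr by (subst integral_distr) (auto simp: ennreal_indicator)
  also have "\<dots> = (\<integral>\<omega>. indicator {\<omega> \<in> space P. \<gamma> \<omega> < \<infinity>} \<omega> * h (jump \<omega>) \<partial>P)"
    by (subst integral_density) auto
  also have "\<dots> = (\<integral>\<omega>. h (jump \<omega>) * indicator {\<omega>. \<gamma> \<omega> < \<infinity>} \<omega> \<partial>P)"
    by (rule Bochner_Integration.integral_cong) (auto split: split_indicator)
  finally show ?thesis .
qed

lemma AE_jump_law_iff:
  assumes "{t. Q t} \<in> sets borel"
  shows "(AE t in \<nu>. Q t) \<longleftrightarrow> (AE \<omega> in P. \<gamma> \<omega> < \<infinity> \<longrightarrow> Q (jump \<omega>))"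
proof -
  have [measurable]: "Measurable.pred borel Q" using assms by (simp add: pred_def)
  show ?thesis
    unfolding jump_law_eq_distr
    by (subst AE_distr_iff) (auto simp: AE_density pred_def split: split_indicator)
qed

lemma jump_cdf_eq: "0 \<le> t \<Longrightarrow> jump_cdf P \<gamma> t = 1 - Gbar t"
proof -
  assume t: "0 \<le> t"
  have "prob (space P - {\<omega> \<in> space P. ennreal t < \<gamma> \<omega>}) = 1 - Gbar t"
    unfolding Gbar_def by (rule prob_compl) measurable
  moreover have "space P - {\<omega> \<in> space P. ennreal t < \<gamma> \<omega>} = {\<omega> \<in> space P. \<gamma> \<omega> \<le> ennreal t}"
    by auto
  ultimately show ?thesis using t by (simp add: jump_cdf_def)
qed

lemma Gbar_nonneg: "0 \<le> Gbar t" and Gbar_le_1: "Gbar t \<le> 1"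
  by (auto simp: Gbar_def)

lemma Gbar_antimono: "s \<le> t \<Longrightarrow> Gbar t \<le> Gbar s"
  unfolding Gbar_def
  by (intro finite_measure_mono) (auto intro: le_less_trans ennreal_leI)

lemma measurable_Gbar [measurable]: "Gbar \<in> borel_measurable borel"
proof -
  have "(\<lambda>t. - Gbar t) \<in> borel_measurable borel"
    by (rule borel_measurable_mono) (auto simp: mono_def Gbar_antimono)
  then show ?thesis by simp
qed

lemma Gbar_0_pos: "0 < Gbar 0"
  using jump_pos by (simp add: Gbar_def)

lemma measure_jump_law_Ioc:
  assumes "0 \<le> s" "s \<le> t"
  shows "measure \<nu> {s<..t} = Gbar s - Gbar t"
proof -
  interpret N: finite_borel_measure \<nu>
    by (simp add: finite_borel_measure_def finite_borel_measure_axioms_def finite_jump_law)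
  have "measure \<nu> {..r} = jump_cdf P \<gamma> r" if "0 \<le> r" for r
  proof -
    have "measure \<nu> {..r} = (\<integral>t. indicator {..r} t \<partial>\<nu>)" by simp
    also have "\<dots> = (\<integral>\<omega>. indicator {\<omega> \<in> space P. \<gamma> \<omega> \<le> ennreal r} \<omega> \<partial>P)"
      by (subst integral_jump_law, simp, rule Bochner_Integration.integral_cong[OF refl])
        (auto simp: jump_le_iff that split: split_indicator)
    also have "\<dots> = jump_cdf P \<gamma> r"
      using that by (auto simp: jump_cdf_def intro!: arg_cong[where f=prob])
    finally show ?thesis .
  qed
  then show ?thesis
    using N.cdf_diff_eq[of s t] assms by (cases "s = t") (auto simp: cdf_def jump_cdf_eq)
qed

section \<open>The end of the jump law and the time set\<close>

lemma less_jump_end_iff: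
  assumes t: "0 \<le> t"
  shows "ennreal t < jump_end P \<gamma> \<longleftrightarrow> 0 < Gbar t"
proof
  assume "ennreal t < jump_end P \<gamma>"
  then obtain s where "0 \<le> s" "jump_cdf P \<gamma> s < 1" "ennreal t < ennreal s"
    unfolding jump_end_def less_SUP_iff by auto
  then show "0 < Gbar t"
    using Gbar_antimono[of t s] t by (auto simp: jump_cdf_eq ennreal_less_iff)
next
  assume G: "0 < Gbar t"
  \<comment> \<open>Right continuity of \<open>Gbar\<close>: a positive value at t persists slightly
    to the right, at a point that lies strictly beyond t and enters the supremum defining the
    end.\<close>
  have "(\<lambda>n. Gbar (t + 1 / Suc n)) \<longlonglongrightarrow> prob (\<Union>n. {\<omega> \<in> space P. ennreal (t + 1 / Suc n) < \<gamma> \<omega>})"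
    unfolding Gbar_def
  proof (rule finite_Lim_measure_incseq)
    have "ennreal (t + 1 / Suc n) \<le> ennreal (t + 1 / Suc m)" if "m \<le> n" for m n
      using that by (intro ennreal_leI) (simp add: frac_le)
    then show "incseq (\<lambda>n. {\<omega> \<in> space P. ennreal (t + 1 / Suc n) < \<gamma> \<omega>})"
      unfolding incseq_def by (blast intro: le_less_trans)
  qed auto
  also have "(\<Union>n. {\<omega> \<in> space P. ennreal (t + 1 / Suc n) < \<gamma> \<omega>}) = {\<omega> \<in> space P. ennreal t < \<gamma> \<omega>}"
  proof safe
    fix \<omega> n assume "ennreal (t + 1 / Suc n) < \<gamma> \<omega>"
    then show "ennreal t < \<gamma> \<omega>" by (rule le_less_trans[rotated]) (auto intro: ennreal_leI)
  next
    fix \<omega> assume \<omega>: "\<omega> \<in> space P" "ennreal t < \<gamma> \<omega>"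
    have "(\<lambda>n. ennreal (t + 1 / Suc n)) \<longlonglongrightarrow> ennreal (t + 0)"
      by (intro tendsto_ennrealI tendsto_add tendsto_const LIMSEQ_Suc[OF lim_1_over_n])
    then have "eventually (\<lambda>n. ennreal (t + 1 / Suc n) < \<gamma> \<omega>) sequentially"
      using \<omega>(2) by (auto dest: order_tendstoD)
    then show "\<omega> \<in> (\<Union>n. {\<omega> \<in> space P. ennreal (t + 1 / Suc n) < \<gamma> \<omega>})"
      using \<omega> by (auto simp: eventually_sequentially)
  qed
  finally have "(\<lambda>n. Gbar (t + 1 / Suc n)) \<longlonglongrightarrow> Gbar t" by (simp add: Gbar_def)
  then have "eventually (\<lambda>n. 0 < Gbar (t + 1 / Suc n)) sequentially"
    using G by (rule order_tendstoD)
  then obtain n where n: "0 < Gbar (t + 1 / Suc n)" by (auto simp: eventually_sequentially)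
  let ?s = "t + 1 / Suc n"
  have "ennreal t < ennreal ?s" using t by (simp add: ennreal_less_iff)
  also have "\<dots> \<le> jump_end P \<gamma>"
    unfolding jump_end_def using n t by (intro SUP_upper) (auto simp: jump_cdf_eq)
  finally show "ennreal t < jump_end P \<gamma>" .
qed

lemma jump_end_pos: "0 < jump_end P \<gamma>"
  using less_jump_end_iff[of 0] Gbar_0_pos by simp

lemma AE_jump_le_end: "AE \<omega> in P. \<gamma> \<omega> \<le> jump_end P \<gamma>"
proof (cases "jump_end P \<gamma>")
  case (real r)
  then have "Gbar r = 0"
    using less_jump_end_iff[of r] Gbar_nonneg[of r] by auto
  then have "AE \<omega> in P. \<not> ennreal r < \<gamma> \<omega>"
    unfolding Gbar_def by (subst (asm) prob_eq_0) auto
  then show ?thesis using real by auto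
qed auto

lemma jump_times_nonneg: "t \<in> jump_times P \<gamma> \<Longrightarrow> 0 \<le> t"
  by (simp add: jump_times_def)

lemma jump_times_downward: "t \<in> jump_times P \<gamma> \<Longrightarrow> 0 \<le> s \<Longrightarrow> s \<le> t \<Longrightarrow> s \<in> jump_times P \<gamma>"
proof -
  assume t: "t \<in> jump_times P \<gamma>" and s: "0 \<le> s" "s \<le> t"
  have "prob {\<omega> \<in> space P. ennreal t \<le> \<gamma> \<omega>} \<le> prob {\<omega> \<in> space P. ennreal s \<le> \<gamma> \<omega>}"
    using ennreal_leI[OF s(2)] by (intro finite_measure_mono) (auto intro: order_trans)
  with t s show ?thesis by (simp add: jump_times_def)
qed

lemma jump_times_below_end: "0 \<le> t \<Longrightarrow> ennreal t < jump_end P \<gamma> \<Longrightarrow> t \<in> jump_times P \<gamma>"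
proof -
  assume t: "0 \<le> t" "ennreal t < jump_end P \<gamma>"
  have "Gbar t \<le> prob {\<omega> \<in> space P. ennreal t \<le> \<gamma> \<omega>}"
    unfolding Gbar_def by (intro finite_measure_mono) auto
  with t show ?thesis by (simp add: jump_times_def less_jump_end_iff)
qed

lemma zero_jump_times: "0 \<in> jump_times P \<gamma>"
  using jump_times_below_end[of 0] jump_end_pos by simp

lemma jump_times_le_end:
  assumes t: "t \<in> jump_times P \<gamma>"
  shows "ennreal t \<le> jump_end P \<gamma>"
proof (rule ccontr)
  assume "\<not> ennreal t \<le> jump_end P \<gamma>"
  with AE_jump_le_end have "AE \<omega> in P. \<not> ennreal t \<le> \<gamma> \<omega>"
    by (auto elim!: eventually_mono)
  then have "prob {\<omega> \<in> space P. ennreal t \<le> \<gamma> \<omega>} = 0"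
    by (subst prob_eq_0) auto
  with t show False by (simp add: jump_times_def)
qed

lemma Gbar_ge_jump_time:
  assumes "0 \<le> s" "s < t"
  shows "prob {\<omega> \<in> space P. ennreal t \<le> \<gamma> \<omega>} \<le> Gbar s"
proof -
  have "ennreal s < ennreal t" using assms by (simp add: ennreal_less_iff)
  then show ?thesis
    unfolding Gbar_def by (intro finite_measure_mono) (auto intro: less_le_trans)
qed

lemma less_jump_end_of_less_jump_time:
  assumes "t \<in> jump_times P \<gamma>" "0 \<le> s" "s < t"
  shows "ennreal s < jump_end P \<gamma>"
proof -
  have "ennreal s < ennreal t" using assms by (simp add: ennreal_less_iff)
  then show ?thesis using jump_times_le_end[OF assms(1)] by (rule less_le_trans)
qed

text \<open>Since \<open>\<gamma>\<close> does not exceed the end almost surely, the positive mass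
  of {t \<le> \<gamma>} sits on {\<gamma> = t}. The only point of the time set not strictly below
  the end is thus an atom, and this occurs in Case B alone.\<close>

lemma jump_times_end:
  assumes t: "t \<in> jump_times P \<gamma>" and not_less: "\<not> ennreal t < jump_end P \<gamma>"
  shows "jump_end P \<gamma> = ennreal t" "case_B P \<gamma>" "AE \<omega> in P. \<gamma> \<omega> \<le> ennreal t"
    "measure P {\<omega> \<in> space P. \<gamma> \<omega> = ennreal t} > 0"
proof -
  show eq: "jump_end P \<gamma> = ennreal t"
    using jump_times_le_end[OF t] not_less by auto
  show le: "AE \<omega> in P. \<gamma> \<omega> \<le> ennreal t"
    using AE_jump_le_end unfolding eq .
  have "prob {\<omega> \<in> space P. \<gamma> \<omega> = ennreal t} = prob {\<omega> \<in> space P. ennreal t \<le> \<gamma> \<omega>}"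
    using le by (intro finite_measure_eq_AE) auto
  then show *: "measure P {\<omega> \<in> space P. \<gamma> \<omega> = ennreal t} > 0"
    using t by (simp add: jump_times_def)
  have "{\<omega> \<in> space P. \<gamma> \<omega> = ennreal t} = {\<omega> \<in> space P. \<gamma> \<omega> = jump_end P \<gamma> \<and> \<gamma> \<omega> < \<infinity>}"
    by (auto simp: eq)
  with * show "case_B P \<gamma>" by (simp add: case_B_def)
qed

lemma case_B_jump_times:
  assumes "case_B P \<gamma>"
  shows "jump_end P \<gamma> < \<infinity>" "enn2real (jump_end P \<gamma>) \<in> jump_times P \<gamma>"
proof -
  show fin: "jump_end P \<gamma> < \<infinity>"
  proof (rule ccontr)
    assume "\<not> jump_end P \<gamma> < \<infinity>"
    then have empty: "{\<omega> \<in> space P. \<gamma> \<omega> = jump_end P \<gamma> \<and> \<gamma> \<omega> < \<infinity>} = {}" by auto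
    show False using assms unfolding case_B_def empty by simp
  qed
  have "prob {\<omega> \<in> space P. \<gamma> \<omega> = jump_end P \<gamma> \<and> \<gamma> \<omega> < \<infinity>} \<le> prob {\<omega> \<in> space P. jump_end P \<gamma> \<le> \<gamma> \<omega>}"
    by (intro finite_measure_mono) auto
  with assms fin show "enn2real (jump_end P \<gamma>) \<in> jump_times P \<gamma>"
    by (auto simp: case_B_def jump_times_def)
qed

text \<open>A finite jump time strictly below the end is in the time set; one equal to the end has
  positive probability only in Case B, where the end belongs to the time set.\<close>

lemma AE_jump_times: "AE \<omega> in P. \<gamma> \<omega> < \<infinity> \<longrightarrow> jump \<omega> \<in> jump_times P \<gamma>"
proof -
  have "AE \<omega> in P. \<gamma> \<omega> = jump_end P \<gamma> \<longrightarrow> \<gamma> \<omega> < \<infinity> \<longrightarrow> case_B P \<gamma>"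
  proof (cases "case_B P \<gamma>")
    case False
    then have "prob {\<omega> \<in> space P. \<gamma> \<omega> = jump_end P \<gamma> \<and> \<gamma> \<omega> < \<infinity>} = 0"
      by (simp add: case_B_def zero_less_measure_iff)
    then show ?thesis by (subst (asm) prob_eq_0) auto
  qed auto
  with AE_jump_le_end show ?thesis
  proof eventually_elim
    case (elim \<omega>)
    show ?case
    proof
      assume fin: "\<gamma> \<omega> < \<infinity>"
      show "jump \<omega> \<in> jump_times P \<gamma>"
      proof (cases "\<gamma> \<omega> = jump_end P \<gamma>")
        case True
        with elim fin case_B_jump_times show ?thesis by (simp add: jump_def)
      next
        case False
        with elim fin show ?thesis
          by (intro jump_times_below_end jump_nonneg) (simp add: ennreal_jump)
      qed
    qed
  qed
qed

text \<open>Exhausts the time set by intervals with right endpoint inside it, whether it is closed,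
  half-open or unbounded. In Case B the sequence is constantly the end, so that the atom there is
  not lost.\<close>

lemma jump_times_sequence:
  obtains u :: "nat \<Rightarrow> real" where "incseq u" "\<And>n. u n \<in> jump_times P \<gamma>"
    "\<And>t. t \<in> jump_times P \<gamma> \<Longrightarrow> \<exists>n. t \<le> u n"
proof (cases "jump_end P \<gamma>")
  case (real r)
  show ?thesis
  proof (cases "r \<in> jump_times P \<gamma>")
    case True
    show ?thesis
      by (rule that[of "\<lambda>_. r"]) (use True real jump_times_le_end in \<open>auto simp: incseq_def\<close>)
  next
    case False
    have r: "0 < r" using jump_end_pos real by simp
    show ?thesis
    proof (rule that[of "\<lambda>n. r * (1 - 1 / Suc n)"])
      show "incseq (\<lambda>n. r * (1 - 1 / Suc n))"
        using r by (auto simp: incseq_def intro!: mult_left_mono divide_left_mono)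
      show "r * (1 - 1 / Suc n) \<in> jump_times P \<gamma>" for n
        using r real by (intro jump_times_below_end) (auto simp: ennreal_less_iff field_simps)
      fix t assume t: "t \<in> jump_times P \<gamma>"
      then have "t < r" using False jump_times_le_end[OF t] real by (cases "t = r") auto
      have "(\<lambda>n. r * (1 - 1 / Suc n)) \<longlonglongrightarrow> r * (1 - 0)"
        by (intro tendsto_mult tendsto_diff tendsto_const LIMSEQ_Suc[OF lim_1_over_n])
      then have "eventually (\<lambda>n. t < r * (1 - 1 / Suc n)) sequentially"
        using \<open>t < r\<close> by (intro order_tendstoD) auto
      then show "\<exists>n. t \<le> r * (1 - 1 / Suc n)"
        by (auto simp: eventually_sequentially intro: less_imp_le)
    qed
  qed
next
  case top
  show ?thesis
    by (rule that[of real])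
      (use top real_arch_simple in \<open>auto simp: incseq_def less_top[symmetric] intro!: jump_times_below_end\<close>)
qed

lemma measurable_jump_times [measurable]: "jump_times P \<gamma> \<in> sets borel"
proof -
  obtain u :: "nat \<Rightarrow> real" where u: "\<And>n. u n \<in> jump_times P \<gamma>"
    "\<And>t. t \<in> jump_times P \<gamma> \<Longrightarrow> \<exists>n. t \<le> u n"
    using jump_times_sequence by metis
  have "jump_times P \<gamma> = (\<Union>n. {0..u n})"
    using u jump_times_downward[OF u(1)] jump_times_nonneg by auto
  then show ?thesis by simp
qed

section \<open>Martingales and predictable sets of the single jump filtration\<close>

text \<open>Fubini's theorem for P and \<open>m\<close>: the section of {u < \<gamma>} at a fixed u
  has probability \<open>Gbar u\<close>.\<close>

lemma nn_expectation_before_jump: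
  assumes "finite_measure m" and [measurable_cong]: "sets m = sets borel" and [measurable]: "A \<in> sets borel"
  shows "(\<integral>\<^sup>+\<omega>. emeasure m (A \<inter> {u. ennreal u < \<gamma> \<omega>}) \<partial>P) = (\<integral>\<^sup>+u. ennreal (Gbar u) * indicator A u \<partial>m)"
    and "(\<lambda>\<omega>. emeasure m (A \<inter> {u. ennreal u < \<gamma> \<omega>})) \<in> borel_measurable P"
proof -
  interpret m: finite_measure m by fact
  interpret pair_sigma_finite P m ..
  let ?h = "\<lambda>\<omega> u. indicator {u. ennreal u < \<gamma> \<omega>} u * indicator A u :: ennreal"
  have h [measurable]: "(\<lambda>(\<omega>, u). ?h \<omega> u) \<in> borel_measurable (P \<Otimes>\<^sub>M m)"
    unfolding indicator_def mem_Collect_eq by measurable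
  have eq: "emeasure m (A \<inter> {u. ennreal u < \<gamma> \<omega>}) = (\<integral>\<^sup>+u. ?h \<omega> u \<partial>m)" for \<omega>
  proof -
    have "emeasure m (A \<inter> {u. ennreal u < \<gamma> \<omega>}) = (\<integral>\<^sup>+u. indicator (A \<inter> {u. ennreal u < \<gamma> \<omega>}) u \<partial>m)"
      by (rule nn_integral_indicator[symmetric]) measurable
    then show ?thesis by (simp add: indicator_inter_arith mult.commute)
  qed
  show "(\<lambda>\<omega>. emeasure m (A \<inter> {u. ennreal u < \<gamma> \<omega>})) \<in> borel_measurable P"
    unfolding eq by measurable
  have "(\<integral>\<^sup>+\<omega>. \<integral>\<^sup>+u. ?h \<omega> u \<partial>m \<partial>P) = (\<integral>\<^sup>+u. \<integral>\<^sup>+\<omega>. ?h \<omega> u \<partial>P \<partial>m)"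
    by (rule Fubini'[symmetric]) measurable
  also have "\<dots> = (\<integral>\<^sup>+u. ennreal (Gbar u) * indicator A u \<partial>m)"
  proof (rule nn_integral_cong)
    fix u
    have "(\<integral>\<^sup>+\<omega>. ?h \<omega> u \<partial>P) = (\<integral>\<^sup>+\<omega>. indicator A u * indicator {\<omega> \<in> space P. ennreal u < \<gamma> \<omega>} \<omega> \<partial>P)"
      by (rule nn_integral_cong) (auto split: split_indicator)
    also have "\<dots> = indicator A u * emeasure P {\<omega> \<in> space P. ennreal u < \<gamma> \<omega>}"
      by (rule nn_integral_cmult_indicator) measurable
    finally show "(\<integral>\<^sup>+\<omega>. ?h \<omega> u \<partial>P) = ennreal (Gbar u) * indicator A u"
      by (simp add: Gbar_def emeasure_eq_measure mult.commute)
  qed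
  finally show "(\<integral>\<^sup>+\<omega>. emeasure m (A \<inter> {u. ennreal u < \<gamma> \<omega>}) \<partial>P) = (\<integral>\<^sup>+u. ennreal (Gbar u) * indicator A u \<partial>m)"
    unfolding eq .
qed

lemma expectation_before_jump:
  assumes m: "finite_measure m" "sets m = sets borel" and A: "A \<in> sets borel"
  shows "(\<integral>\<omega>. measure m (A \<inter> {u. ennreal u < \<gamma> \<omega>}) \<partial>P) = (\<integral>u. Gbar u * indicator A u \<partial>m)"
    and "integrable P (\<lambda>\<omega>. measure m (A \<inter> {u. ennreal u < \<gamma> \<omega>}))"
proof -
  note [measurable_cong] = m(2) and [measurable] = A nn_expectation_before_jump(2)[OF m A]
  interpret m: finite_measure m by fact
  have [measurable]: "(\<lambda>\<omega>. measure m (A \<inter> {u. ennreal u < \<gamma> \<omega>})) \<in> borel_measurable P"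
    unfolding measure_def by measurable
  show "integrable P (\<lambda>\<omega>. measure m (A \<inter> {u. ennreal u < \<gamma> \<omega>}))"
    by (rule integrable_const_bound[where B = "measure m (space m)"])
      (auto intro!: AE_I2 m.bounded_measure)
  have "(\<integral>\<omega>. measure m (A \<inter> {u. ennreal u < \<gamma> \<omega>}) \<partial>P) =
      enn2real (\<integral>\<^sup>+\<omega>. emeasure m (A \<inter> {u. ennreal u < \<gamma> \<omega>}) \<partial>P)"
    by (subst integral_eq_nn_integral) (auto simp: m.emeasure_eq_measure)
  also have "\<dots> = enn2real (\<integral>\<^sup>+u. ennreal (Gbar u * indicator A u) \<partial>m)"
    unfolding nn_expectation_before_jump(1)[OF m A]
    by (simp add: ennreal_mult' Gbar_nonneg ennreal_indicator)
  also have "\<dots> = (\<integral>u. Gbar u * indicator A u \<partial>m)"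
    by (subst integral_eq_nn_integral) (auto simp: Gbar_nonneg)
  finally show "(\<integral>\<omega>. measure m (A \<inter> {u. ennreal u < \<gamma> \<omega>}) \<partial>P) = (\<integral>u. Gbar u * indicator A u \<partial>m)" .
qed

text \<open>Because u < \<gamma> is strict, the jump time itself is excluded after the jump. This
  isolates the deterministic part of the integral from its jump at \<open>\<gamma>\<close>.\<close>

lemma before_jump_eq:
  assumes "0 \<le> t"
  shows "ennreal t < \<gamma> \<omega> \<Longrightarrow> {0<..t} \<inter> A \<inter> {u. ennreal u < \<gamma> \<omega>} = {0<..t} \<inter> A"
    and "\<gamma> \<omega> \<le> ennreal t \<Longrightarrow> {0<..t} \<inter> A \<inter> {u. ennreal u < \<gamma> \<omega>} = {0<..<jump \<omega>} \<inter> A"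
proof -
  assume "ennreal t < \<gamma> \<omega>"
  then have "ennreal u < \<gamma> \<omega>" if "u \<le> t" for u
    using ennreal_leI[OF that] by (rule le_less_trans[rotated])
  then show "{0<..t} \<inter> A \<inter> {u. ennreal u < \<gamma> \<omega>} = {0<..t} \<inter> A"
    by auto
next
  assume "\<gamma> \<omega> \<le> ennreal t"
  then show "{0<..t} \<inter> A \<inter> {u. ennreal u < \<gamma> \<omega>} = {0<..<jump \<omega>} \<inter> A"
    using assms by (auto simp: jump_le_iff less_jump_iff)
qed

text \<open>The preimage of a value attained on {t < \<gamma>} meets this set and belongs to the
  filtration, so it contains all of it. This makes every adapted process deterministic before the
  jump.\<close>

lemma borel_measurable_sj_iff:
  fixes f :: "'a \<Rightarrow> real"
  shows "f \<in> borel_measurable (\<F> t) \<longleftrightarrow>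
    f \<in> borel_measurable P \<and> (\<exists>c. \<forall>\<omega>\<in>space P. t < \<gamma> \<omega> \<longrightarrow> f \<omega> = c)"
proof safe
  assume f: "f \<in> borel_measurable (\<F> t)"
  show "f \<in> borel_measurable P"
    using f by (rule measurable_from_subalg[rotated])
      (auto simp: subalgebra_def space_sj_filtration sets_sj_filtration)
  show "\<exists>c. \<forall>\<omega>\<in>space P. t < \<gamma> \<omega> \<longrightarrow> f \<omega> = c"
  proof (cases "\<exists>\<omega>\<in>space P. t < \<gamma> \<omega>")
    case True
    then obtain \<omega>0 where \<omega>0: "\<omega>0 \<in> space P" "t < \<gamma> \<omega>0" by blast
    have "f -` {f \<omega>0} \<inter> space P \<in> sets (\<F> t)"
      using measurable_sets[OF f, of "{f \<omega>0}"] by (simp add: space_sj_filtration)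
    then have "(f -` {f \<omega>0} \<inter> space P) \<inter> {\<omega> \<in> space P. t < \<gamma> \<omega>} = {\<omega> \<in> space P. t < \<gamma> \<omega>}"
      using \<omega>0 by (auto simp: sets_sj_filtration)
    then show ?thesis by (intro exI[of _ "f \<omega>0"]) blast
  qed auto
next
  fix c assume f: "f \<in> borel_measurable P" and c: "\<forall>\<omega>\<in>space P. t < \<gamma> \<omega> \<longrightarrow> f \<omega> = c"
  show "f \<in> borel_measurable (\<F> t)"
  proof (rule measurableI)
    fix B :: "real set" assume "B \<in> sets borel"
    then have "f -` B \<inter> space P \<in> sets P" using f by (rule measurable_sets[rotated])
    then show "f -` B \<inter> space (\<F> t) \<in> sets (\<F> t)"
      using c by (cases "c \<in> B") (auto simp: sets_sj_filtration space_sj_filtration)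
  qed simp
qed

lemma subalgebra_sj: "subalgebra P (\<F> t)"
  by (auto simp: subalgebra_def space_sj_filtration sets_sj_filtration)

lemma sigma_finite_subalgebra_sj: "sigma_finite_subalgebra P (\<F> t)"
  by (rule finite_measure_subalgebra_is_sigma_finite)
    (simp add: finite_measure_subalgebra_def finite_measure_subalgebra_axioms_def subalgebra_sj finite_measure_axioms)

lemma measurable_sj_before: "{\<omega> \<in> space P. \<gamma> \<omega> \<le> t} \<in> sets (\<F> t)"
  by (auto simp: sets_sj_filtration)

lemma martingale_integrable: "martingale P \<F> X \<Longrightarrow> 0 \<le> t \<Longrightarrow> integrable P (X t)"
  by (simp add: martingale_def)

text \<open>The variable \<open>X t\<close> multiplied by the indicator of {\<gamma> \<le> s}
  vanishes on {s < \<gamma>} and hence is measurable at time s already, so conditioning at time s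
  leaves it unchanged.\<close>

lemma martingale_const_after:
  assumes X: "martingale P \<F> X" and st: "0 \<le> s" "s \<le> t"
  shows "AE \<omega> in P. \<gamma> \<omega> \<le> ennreal s \<longrightarrow> X t \<omega> = X s \<omega>"
proof -
  interpret S: sigma_finite_subalgebra P "\<F> (ennreal s)" by (rule sigma_finite_subalgebra_sj)
  let ?A = "{\<omega> \<in> space P. \<gamma> \<omega> \<le> ennreal s}"
  have [measurable]: "?A \<in> sets (\<F> (ennreal s))" by (rule measurable_sj_before)
  have int: "integrable P (X t)" and [measurable]: "X t \<in> borel_measurable P"
    using martingale_integrable[OF X, of t] st by auto
  have intA: "integrable P (\<lambda>\<omega>. indicator ?A \<omega> * X t \<omega>)"
    using integrable_real_mult_indicator[OF _ int, of ?A] by (simp add: mult.commute)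
  have "(\<lambda>\<omega>. indicator ?A \<omega> * X t \<omega>) \<in> borel_measurable (\<F> (ennreal s))"
    unfolding borel_measurable_sj_iff by (auto intro!: exI[of _ 0])
  from S.real_cond_exp_F_meas[OF intA this]
  have "AE \<omega> in P. real_cond_exp P (\<F> (ennreal s)) (\<lambda>\<omega>. indicator ?A \<omega> * X t \<omega>) \<omega> = indicator ?A \<omega> * X t \<omega>" .
  moreover have "AE \<omega> in P. real_cond_exp P (\<F> (ennreal s)) (\<lambda>\<omega>. indicator ?A \<omega> * X t \<omega>) \<omega> =
      indicator ?A \<omega> * real_cond_exp P (\<F> (ennreal s)) (X t) \<omega>"
    by (rule S.real_cond_exp_mult) (use intA in auto)
  moreover have "AE \<omega> in P. real_cond_exp P (\<F> (ennreal s)) (X t) \<omega> = X s \<omega>"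
    using X st by (simp add: martingale_def)
  ultimately show ?thesis
    using AE_space by eventually_elim (auto simp: indicator_def)
qed

lemma martingale_expectation:
  assumes X: "martingale P \<F> X" and t: "0 \<le> t"
  shows "expectation (X t) = expectation (X 0)"
proof -
  interpret S: sigma_finite_subalgebra P "\<F> (ennreal 0)" by (rule sigma_finite_subalgebra_sj)
  have int: "integrable P (X t)" using martingale_integrable[OF X t] .
  have "expectation (X t) = expectation (real_cond_exp P (\<F> (ennreal 0)) (X t))"
    using S.real_cond_exp_int(2)[OF int] by simp
  also have "\<dots> = expectation (X 0)"
  proof (rule integral_cong_AE)
    show "AE \<omega> in P. real_cond_exp P (\<F> (ennreal 0)) (X t) \<omega> = X 0 \<omega>"
      using X t order_refl[of 0] unfolding martingale_def by blast
  qed (use martingale_integrable[OF X, of 0] in auto)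
  finally show ?thesis .
qed

text \<open>Every event in the past of \<open>s\<close> contains or misses \<open>{s < \<gamma>}\<close>, so beyond constancy after the
  jump only the total expectation needs to be conserved.\<close>

lemma martingaleI:
  assumes adapted: "adapted \<F> X" and int: "\<And>t. 0 \<le> t \<Longrightarrow> integrable P (X t)"
    and const: "\<And>s t. 0 \<le> s \<Longrightarrow> s \<le> t \<Longrightarrow> AE \<omega> in P. \<gamma> \<omega> \<le> ennreal s \<longrightarrow> X t \<omega> = X s \<omega>"
    and exp: "\<And>t. 0 \<le> t \<Longrightarrow> expectation (X t) = e"
  shows "martingale P \<F> X"
  unfolding martingale_def
proof (intro conjI allI impI adapted int)
  fix s t :: real assume "0 \<le> s \<and> s \<le> t"
  then have st: "0 \<le> s" "s \<le> t" "0 \<le> t" by auto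
  interpret S: sigma_finite_subalgebra P "\<F> (ennreal s)" by (rule sigma_finite_subalgebra_sj)
  have set: "set_integrable P B (X r)" if "B \<in> sets P" "0 \<le> r" for B r
    using int[OF that(2)] that(1) unfolding set_integrable_def by (rule integrable_mult_indicator[rotated])
  have after: "(LINT \<omega>:B|P. X t \<omega>) = (LINT \<omega>:B|P. X s \<omega>)"
    if B: "B \<in> sets P" "B \<subseteq> {\<omega> \<in> space P. \<gamma> \<omega> \<le> ennreal s}" for B
    unfolding set_lebesgue_integral_def
  proof (rule integral_cong_AE)
    show "AE \<omega> in P. indicator B \<omega> *\<^sub>R X t \<omega> = indicator B \<omega> *\<^sub>R X s \<omega>"
      using const[OF st(1,2)] by eventually_elim (use B(2) in \<open>auto split: split_indicator\<close>)
  qed (use int[OF st(1)] int[OF st(3)] B(1) in auto)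
  show "AE \<omega> in P. real_cond_exp P (\<F> (ennreal s)) (X t) \<omega> = X s \<omega>"
  proof (rule S.real_cond_exp_charact)
    fix A assume A: "A \<in> sets (\<F> (ennreal s))"
    then have AP: "A \<in> sets P" by (simp add: sets_sj_filtration)
    let ?B = "{\<omega> \<in> space P. ennreal s < \<gamma> \<omega>}"
    from A consider "A \<inter> ?B = {}" | "A \<inter> ?B = ?B" by (auto simp: sets_sj_filtration)
    then show "(LINT \<omega>:A|P. X t \<omega>) = (LINT \<omega>:A|P. X s \<omega>)"
    proof cases
      case 1
      then show ?thesis
        using sets.sets_into_space[OF AP] by (intro after AP) (auto simp: not_less[symmetric])
    next
      case 2
      \<comment> \<open>If the event contains {s < \<gamma>}, its complement lies in {\<gamma> \<le>
        s}, where both variables agree. Equality on the event is then equality of the total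
        expectations.\<close>
      have split: "expectation (X r) = (LINT \<omega>:A|P. X r \<omega>) + (LINT \<omega>:space P - A|P. X r \<omega>)" if "0 \<le> r" for r
      proof -
        have "(LINT \<omega>:A \<union> (space P - A)|P. X r \<omega>) = (LINT \<omega>:A|P. X r \<omega>) + (LINT \<omega>:space P - A|P. X r \<omega>)"
          using AP that by (intro set_integral_Un set) auto
        moreover have "A \<union> (space P - A) = space P" using sets.sets_into_space[OF AP] by auto
        ultimately show ?thesis by (simp add: set_integral_space int that)
      qed
      have "(LINT \<omega>:space P - A|P. X t \<omega>) = (LINT \<omega>:space P - A|P. X s \<omega>)"
        using 2 AP by (intro after) (auto simp: not_less[symmetric])
      then show ?thesis
        using split[OF st(1)] split[OF st(3)] exp[OF st(1)] exp[OF st(3)] by simp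
    qed
  qed (use int st adapted in \<open>auto simp: adapted_def\<close>)
qed

section \<open>Predictable sets up to the jump\<close>

lemma predictable_generators:
  "{A \<times> {0} | A. A \<in> sets (\<F> 0)} \<union>
    {A \<times> {s<..t} | A s t. 0 \<le> s \<and> s \<le> t \<and> A \<in> sets (\<F> (ennreal s))} \<subseteq> Pow (space P \<times> {0..})"
  by (auto simp: sets_sj_filtration dest: sets.sets_into_space)

lemma sets_predictable_sigma:
  "sets (predictable_sigma P \<F>) = sigma_sets (space P \<times> {0..})
    ({A \<times> {0} | A. A \<in> sets (\<F> 0)} \<union>
      {A \<times> {s<..t} | A s t. 0 \<le> s \<and> s \<le> t \<and> A \<in> sets (\<F> (ennreal s))})"
  unfolding predictable_sigma_def by (rule sets_measure_of[OF predictable_generators])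

lemma predictable_section:
  assumes "S \<in> sets (predictable_sigma P \<F>)" "\<omega> \<in> space P"
  shows "{t. (\<omega>, t) \<in> S} \<in> sets borel"
  using assms(1) unfolding sets_predictable_sigma
proof (induction rule: sigma_sets.induct)
  case (Basic S)
  then consider A where "S = A \<times> {0}" | A s t where "S = A \<times> {s<..t}" by auto
  then show ?case
  proof cases
    case 1
    then have "{t. (\<omega>, t) \<in> S} = (if \<omega> \<in> A then {0} else {})" by auto
    then show ?thesis by simp
  next
    case (2 A s t)
    then have "{t. (\<omega>, t) \<in> S} = (if \<omega> \<in> A then {s<..t} else {})" by auto
    then show ?thesis by simp
  qed
next
  case (Compl S)
  have "{t. (\<omega>, t) \<in> space P \<times> {0..} - S} = {0..} - {t. (\<omega>, t) \<in> S}"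
    using assms(2) by auto
  with Compl.IH show ?case by simp
next
  case (Union S)
  have "{t. (\<omega>, t) \<in> \<Union> (range S)} = (\<Union>i. {t. (\<omega>, t) \<in> S i})" by auto
  with Union.IH show ?case by simp
qed simp

text \<open>For a generator over (s,t] and r in this interval, r \<le> \<gamma>(\<omega>) implies s
  < \<gamma>(\<omega>), and the event of time s contains all such \<omega> or none. The inequality
  is not strict at \<open>\<gamma>\<close>, so the deterministic set also decides whether the jump
  is counted.\<close>

lemma predictable_before_jump:
  assumes "S \<in> sets (predictable_sigma P \<F>)"
  shows "\<exists>B\<in>sets borel. \<forall>\<omega>\<in>space P. \<forall>t>0. ennreal t \<le> \<gamma> \<omega> \<longrightarrow> ((\<omega>, t) \<in> S \<longleftrightarrow> t \<in> B)"
  using assms unfolding sets_predictable_sigma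
proof (induction rule: sigma_sets.induct)
  case (Basic S)
  then consider A where "S = A \<times> {0}"
    | A s t where "S = A \<times> {s<..t}" "0 \<le> s" "A \<in> sets (\<F> (ennreal s))" by auto
  then show ?case
  proof cases
    case 1
    then show ?thesis by (intro bexI[of _ "{}"]) auto
  next
    case (2 A s t)
    have less: "ennreal s < \<gamma> \<omega>" if "s < r" "ennreal r \<le> \<gamma> \<omega>" for r \<omega>
    proof -
      have "ennreal s < ennreal r" using that 2(2) by (simp add: ennreal_less_iff)
      then show ?thesis using that(2) by (rule less_le_trans)
    qed
    from 2(3) consider "A \<inter> {\<omega> \<in> space P. ennreal s < \<gamma> \<omega>} = {}"
      | "A \<inter> {\<omega> \<in> space P. ennreal s < \<gamma> \<omega>} = {\<omega> \<in> space P. ennreal s < \<gamma> \<omega>}"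
      by (auto simp: sets_sj_filtration)
    then show ?thesis
    proof cases
      case 1
      then show ?thesis using less by (intro bexI[of _ "{}"]) (auto simp: 2(1))
    next
      case 2
      then show ?thesis using less \<open>S = _\<close> by (intro bexI[of _ "{s<..t}"]) auto
    qed
  qed
next
  case (Compl S)
  then obtain B where "B \<in> sets borel" "\<forall>\<omega>\<in>space P. \<forall>t>0. ennreal t \<le> \<gamma> \<omega> \<longrightarrow> ((\<omega>, t) \<in> S \<longleftrightarrow> t \<in> B)"
    by blast
  then show ?case
    by (intro bexI[of _ "- B"] ballI allI impI) (auto dest: less_imp_le)
next
  case (Union S)
  have "\<forall>i. \<exists>B. B \<in> sets borel \<and>
      (\<forall>\<omega>\<in>space P. \<forall>t>0. ennreal t \<le> \<gamma> \<omega> \<longrightarrow> ((\<omega>, t) \<in> S i \<longleftrightarrow> t \<in> B))"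
    using Union.IH unfolding Bex_def by (rule allI)
  from choice[OF this] obtain B where B: "\<And>i. B i \<in> sets borel"
    "\<And>i. \<forall>\<omega>\<in>space P. \<forall>t>0. ennreal t \<le> \<gamma> \<omega> \<longrightarrow> ((\<omega>, t) \<in> S i \<longleftrightarrow> t \<in> B i)"
    by blast
  show ?case
  proof (intro bexI[of _ "\<Union>i. B i"] ballI allI impI)
    show "(\<Union>i. B i) \<in> sets borel" using B(1) by blast
    fix \<omega> t assume "\<omega> \<in> space P" "(0::real) < t" "ennreal t \<le> \<gamma> \<omega>"
    then have "(\<omega>, t) \<in> S i \<longleftrightarrow> t \<in> B i" for i using B(2)[of i] by simp
    then show "(\<omega>, t) \<in> \<Union> (range S) \<longleftrightarrow> t \<in> (\<Union>i. B i)" by simp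
  qed
next
  case Empty
  then show ?case by (intro bexI[of _ "{}"]) auto
qed

text \<open>Used to build the exhausting sets of the sufficiency proof. Time 0 is included because
  their union has to contain it.\<close>

lemma predictable_deterministic:
  assumes "B \<in> sets borel"
  shows "space P \<times> ({0} \<union> ({0<..} \<inter> B)) \<in> sets (predictable_sigma P \<F>)"
proof -
  have space: "space (predictable_sigma P \<F>) = space P \<times> {0..}"
    unfolding predictable_sigma_def by (rule space_measure_of[OF predictable_generators])
  have top: "space P \<in> sets (\<F> t)" for t
    by (auto simp: sets_sj_filtration)
  have basic: "space P \<times> {0} \<in> sets (predictable_sigma P \<F>)"
    unfolding sets_predictable_sigma using top[of 0] by (intro sigma_sets.Basic) blast
  have basic': "space P \<times> {0<..t} \<in> sets (predictable_sigma P \<F>)" if "0 \<le> t" for t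
    unfolding sets_predictable_sigma using top[of "ennreal 0"] that
    by (intro sigma_sets.Basic) blast
  have "B \<in> sigma_sets UNIV (range atMost)"
    using assms by (simp add: borel_eq_atMost)
  then have "space P \<times> ({0<..} \<inter> B) \<in> sets (predictable_sigma P \<F>)"
  proof (induction rule: sigma_sets.induct)
    case (Basic S)
    then obtain t where t: "S = {..t}" by auto
    show ?case
    proof (cases "0 \<le> t")
      case True
      have "{0<..} \<inter> S = {0<..t}" unfolding t by auto
      then show ?thesis using basic'[OF True] by simp
    next
      case False
      then have "{0<..} \<inter> S = {}" unfolding t by auto
      then show ?thesis by simp
    qed
  next
    case (Compl S)
    have "space P \<times> ({0<..} \<inter> (UNIV - S)) =
        (space (predictable_sigma P \<F>) - space P \<times> {0}) - space P \<times> ({0<..} \<inter> S)"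
      unfolding space by auto
    also have "\<dots> \<in> sets (predictable_sigma P \<F>)"
      using Compl.IH basic by (intro sets.Diff sets.top)
    finally show ?case .
  next
    case (Union S)
    have "space P \<times> ({0<..} \<inter> \<Union> (range S)) = (\<Union>i. space P \<times> ({0<..} \<inter> S i))" by auto
    with Union.IH show ?case by simp
  qed simp
  moreover have "space P \<times> ({0} \<union> ({0<..} \<inter> B)) = space P \<times> {0} \<union> space P \<times> ({0<..} \<inter> B)"
    by auto
  ultimately show ?thesis using basic by simp
qed

end

section \<open>Paths of semimartingales\<close>

text \<open>Almost sure equalities are available for countably many times only. Right continuity
  extends them to all later times and to \<open>g\<close> itself, although only rationals strictly
  after \<open>g\<close> are assumed.\<close>

lemma right_cont_const_on_rationals:
  assumes rc: "right_cont_path f" and g: "0 \<le> g"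
    and rat: "\<And>q. q \<in> \<rat> \<Longrightarrow> g < q \<Longrightarrow> f q = c" and s: "g \<le> s"
  shows "f s = c"
proof (rule ccontr)
  assume "f s \<noteq> c"
  have "(f \<longlongrightarrow> f s) (at_right s)"
    using rc g s by (auto simp: right_cont_path_def continuous_within)
  from tendsto_imp_eventually_ne[OF this \<open>f s \<noteq> c\<close>]
  obtain b where b: "b > s" "\<And>y. s < y \<Longrightarrow> y < b \<Longrightarrow> f y \<noteq> c"
    by (auto simp: eventually_at_right_field)
  obtain q where "q \<in> \<rat>" "s < q" "q < b" using Rats_dense_in_real[OF b(1)] by auto
  then show False using b(2)[of q] rat[of q] s by auto
qed

context single_jump
begin

text \<open>Before the jump the martingale equals a deterministic \<open>f\<close>, and conservation of expectation
  reads \<open>f(t) P(\<gamma> > t) = E[X\<^sub>0] - E[X\<^sub>u; \<gamma> \<le> t]\<close>.\<close>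

lemma martingale_before_jump_dominated:
  assumes X: "martingale P \<F> X" and u: "u \<in> jump_times P \<gamma>"
  obtains \<phi> C where "\<And>t. 0 \<le> t \<Longrightarrow> t < u \<Longrightarrow> \<phi> t \<le> C"
    "\<And>s t \<omega>. \<omega> \<in> space P \<Longrightarrow> 0 \<le> s \<Longrightarrow> s \<le> t \<Longrightarrow> t < u \<Longrightarrow> ennreal t < \<gamma> \<omega> \<Longrightarrow>
      \<bar>X t \<omega> - X s \<omega>\<bar> \<le> \<phi> t - \<phi> s"
proof -
  have u0: "0 \<le> u" using jump_times_nonneg[OF u] .
  have int: "integrable P (X t)" if "0 \<le> t" for t
    using martingale_integrable[OF X that] .
  have [measurable]: "X u \<in> borel_measurable P" using int[OF u0] by simp
  \<comment> \<open>This is a positive lower bound of \<open>Gbar\<close> on [0,u), even if u is the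
    end in Case B and \<open>Gbar u\<close> is 0. Hence the bounds are claimed strictly before u
    only.\<close>
  define p where "p = prob {\<omega> \<in> space P. ennreal u \<le> \<gamma> \<omega>}"
  have p: "0 < p" using u by (simp add: p_def jump_times_def)
  have Gp: "p \<le> Gbar t" if "0 \<le> t" "t < u" for t
    using Gbar_ge_jump_time[OF that] by (simp add: p_def)
  let ?after = "\<lambda>t. {\<omega> \<in> space P. \<gamma> \<omega> \<le> ennreal t}"
  define a where "a t = expectation (X 0) - (\<integral>\<omega>. X u \<omega> * indicator (?after t) \<omega> \<partial>P)" for t
  define A where "A t = (\<integral>\<omega>. \<bar>X u \<omega>\<bar> * indicator (?after t) \<omega> \<partial>P)" for t
  define E where "E = expectation (\<lambda>\<omega>. \<bar>X u \<omega>\<bar>)"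
  define C0 where "C0 = \<bar>expectation (X 0)\<bar> + E"
  have intX: "integrable P (\<lambda>\<omega>. X u \<omega> * indicator (?after t) \<omega>)" for t
    using int[OF u0] by (intro integrable_real_mult_indicator) auto
  have intA: "integrable P (\<lambda>\<omega>. \<bar>X u \<omega>\<bar> * indicator (?after t) \<omega>)" for t
    using int[OF u0] by (intro integrable_real_mult_indicator integrable_abs) auto
  have A_nonneg: "0 \<le> A t" for t
    unfolding A_def by (intro Bochner_Integration.integral_nonneg) auto
  have A_le: "A t \<le> E" for t
    unfolding A_def E_def using int[OF u0] intA
    by (intro integral_mono) (auto split: split_indicator)
  have E_nonneg: "0 \<le> E" using A_nonneg A_le order_trans by blast
  have a_le: "\<bar>a t\<bar> \<le> C0" for t
  proof -
    have "\<bar>\<integral>\<omega>. X u \<omega> * indicator (?after t) \<omega> \<partial>P\<bar> \<le> (\<integral>\<omega>. \<bar>X u \<omega> * indicator (?after t) \<omega>\<bar> \<partial>P)"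
      by (rule integral_abs_bound)
    also have "\<dots> = A t" unfolding A_def by (simp add: abs_mult)
    finally show ?thesis using A_le[of t] unfolding a_def C0_def by linarith
  qed
  have a_diff: "\<bar>a t - a s\<bar> \<le> A t - A s" if "s \<le> t" for s t
  proof -
    have ind: "indicator (?after t) \<omega> = indicator (?after s) \<omega> + (indicator (?after t - ?after s) \<omega> :: real)" for \<omega>
      using ennreal_leI[OF that] by (auto split: split_indicator intro: order_trans)
    have i1: "integrable P (\<lambda>\<omega>. X u \<omega> * indicator (?after t - ?after s) \<omega>)"
      using int[OF u0] by (intro integrable_real_mult_indicator) auto
    have i2: "integrable P (\<lambda>\<omega>. \<bar>X u \<omega>\<bar> * indicator (?after t - ?after s) \<omega>)"
      using int[OF u0] by (intro integrable_real_mult_indicator integrable_abs) auto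
    have "(\<integral>\<omega>. X u \<omega> * indicator (?after t) \<omega> \<partial>P) = (\<integral>\<omega>. X u \<omega> * indicator (?after s) \<omega> \<partial>P)
        + (\<integral>\<omega>. X u \<omega> * indicator (?after t - ?after s) \<omega> \<partial>P)"
      by (simp only: ind distrib_left Bochner_Integration.integral_add[OF intX i1])
    then have "a t - a s = - (\<integral>\<omega>. X u \<omega> * indicator (?after t - ?after s) \<omega> \<partial>P)"
      by (simp add: a_def)
    moreover have "A t - A s = (\<integral>\<omega>. \<bar>X u \<omega>\<bar> * indicator (?after t - ?after s) \<omega> \<partial>P)"
      unfolding A_def by (simp only: ind distrib_left Bochner_Integration.integral_add[OF intA i2])
    moreover have "\<bar>\<integral>\<omega>. X u \<omega> * indicator (?after t - ?after s) \<omega> \<partial>P\<bar> \<le>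
        (\<integral>\<omega>. \<bar>X u \<omega> * indicator (?after t - ?after s) \<omega>\<bar> \<partial>P)"
      by (rule integral_abs_bound)
    ultimately show ?thesis by (simp add: abs_mult)
  qed
  have key: "X t \<omega> * Gbar t = a t"
    if \<omega>: "\<omega> \<in> space P" "ennreal t < \<gamma> \<omega>" and t: "0 \<le> t" "t < u" for t \<omega>
  proof -
    have "X t \<in> borel_measurable (\<F> (ennreal t))"
      using X t by (auto simp: martingale_def adapted_def)
    then obtain c where c: "\<forall>\<omega>\<in>space P. ennreal t < \<gamma> \<omega> \<longrightarrow> X t \<omega> = c"
      unfolding borel_measurable_sj_iff by blast
    let ?before = "{\<omega> \<in> space P. ennreal t < \<gamma> \<omega>}"
    have "expectation (X 0) = expectation (X t)"
      using martingale_expectation[OF X t(1)] by simp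
    also have "\<dots> = (\<integral>\<omega>. c * indicator ?before \<omega> + X u \<omega> * indicator (?after t) \<omega> \<partial>P)"
    proof (rule integral_cong_AE)
      show "AE \<omega> in P. X t \<omega> = c * indicator ?before \<omega> + X u \<omega> * indicator (?after t) \<omega>"
        using martingale_const_after[OF X, of t u] t AE_space
        by (auto elim!: eventually_elim2 simp: c indicator_def not_less)
    qed (use int t in auto)
    also have "\<dots> = c * Gbar t + (\<integral>\<omega>. X u \<omega> * indicator (?after t) \<omega> \<partial>P)"
    proof -
      have "integrable P (\<lambda>\<omega>. c * indicator ?before \<omega>)"
        by (intro integrable_mult_right integrable_real_indicator) (auto simp: emeasure_eq_measure)
      from Bochner_Integration.integral_add[OF this intX] show ?thesis
        by (simp add: Gbar_def)
    qed
    finally show ?thesis using c \<omega> by (simp add: a_def)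
  qed
  \<comment> \<open>Comes from a(t)/Gbar(t) - a(s)/Gbar(s) = (a(t) - a(s))/Gbar(t) + a(s) (1/Gbar(t)
    - 1/Gbar(s)): the first term is bounded by an increment of A/p, the second by one of
    C0/Gbar.\<close>
  define \<phi> where "\<phi> t = A t / p + C0 / Gbar t" for t
  have C0: "0 \<le> C0" using E_nonneg by (simp add: C0_def)
  show thesis
  proof (rule that[of \<phi> "E / p + C0 / p"])
    fix t assume t: "0 \<le> t" "t < u"
    have "A t / p \<le> E / p" using A_le p by (intro divide_right_mono) auto
    moreover have "C0 / Gbar t \<le> C0 / p" using Gp[OF t] p C0 by (intro divide_left_mono) auto
    ultimately show "\<phi> t \<le> E / p + C0 / p" by (simp add: \<phi>_def)
  next
    fix s t \<omega> assume \<omega>: "\<omega> \<in> space P" and st: "0 \<le> s" "s \<le> t" "t < u" and before: "ennreal t < \<gamma> \<omega>"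
    have before_s: "ennreal s < \<gamma> \<omega>" using before ennreal_leI[OF st(2)] by (rule le_less_trans[rotated])
    have G: "p \<le> Gbar t" "p \<le> Gbar s" "Gbar t \<le> Gbar s"
      using Gp[of s] Gp[of t] st Gbar_antimono by auto
    have "X t \<omega> = a t / Gbar t" "X s \<omega> = a s / Gbar s"
      using key[OF \<omega> before] key[OF \<omega> before_s] st G p by (auto simp: field_simps)
    then have "X t \<omega> - X s \<omega> = (a t - a s) / Gbar t + a s * (1 / Gbar t - 1 / Gbar s)"
      by (simp add: diff_divide_distrib algebra_simps)
    also have "\<bar>\<dots>\<bar> \<le> \<bar>(a t - a s) / Gbar t\<bar> + \<bar>a s * (1 / Gbar t - 1 / Gbar s)\<bar>"
      by (rule abs_triangle_ineq)
    also have "\<bar>(a t - a s) / Gbar t\<bar> \<le> (A t - A s) / p"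
      using a_diff[OF st(2)] G p by (auto simp: abs_divide intro!: frac_le)
    also have "\<bar>a s * (1 / Gbar t - 1 / Gbar s)\<bar> \<le> C0 * (1 / Gbar t - 1 / Gbar s)"
    proof -
      have "0 \<le> 1 / Gbar t - 1 / Gbar s" using G p by (auto intro!: divide_left_mono)
      then show ?thesis using a_le[of s] by (auto simp: abs_mult intro: mult_right_mono)
    qed
    finally show "\<bar>X t \<omega> - X s \<omega>\<bar> \<le> \<phi> t - \<phi> s"
      by (simp add: \<phi>_def diff_divide_distrib algebra_simps)
  qed
qed

lemma AE_rationals_const_after:
  assumes X: "martingale P \<F> X"
  shows "AE \<omega> in P. \<forall>q\<in>\<rat>. \<forall>r\<in>\<rat>. 0 \<le> q \<longrightarrow> q \<le> r \<longrightarrow> \<gamma> \<omega> \<le> ennreal q \<longrightarrow> X r \<omega> = X q \<omega>"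
proof -
  have "AE \<omega> in P. 0 \<le> q \<longrightarrow> q \<le> r \<longrightarrow> \<gamma> \<omega> \<le> ennreal q \<longrightarrow> X r \<omega> = X q \<omega>" for q r
    using martingale_const_after[OF X, of q r] by (cases "0 \<le> q \<and> q \<le> r") auto
  then show ?thesis
    by (simp add: AE_ball_countable countable_rat)
qed

lemma stopped_eq: "0 \<le> t \<Longrightarrow> ennreal t \<le> T \<omega> \<Longrightarrow> stopped X T t \<omega> = X t \<omega>"
  by (simp add: stopped_def min_absorb1)

text \<open>On [0,K] a path agrees with one stopped at some \<open>T n\<close>, whose increments
  before the jump have a deterministic dominating function. After the jump the path is
  constant.\<close>

lemma local_martingale_finite_variation:
  assumes N: "local_martingale P \<F> N"
  shows "AE \<omega> in P. finite_variation_path (\<lambda>t. N t \<omega>)"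
proof -
  from N obtain T :: "nat \<Rightarrow> 'a \<Rightarrow> ennreal" where
    cadlag: "AE \<omega> in P. cadlag_path (\<lambda>t. N t \<omega>)"
    and T: "AE \<omega> in P. incseq (\<lambda>n. T n \<omega>) \<and> (\<lambda>n. T n \<omega>) \<longlonglongrightarrow> \<infinity>"
    and ui: "\<And>n. ui_martingale P \<F> (stopped N (T n))"
    unfolding local_martingale_def by blast
  have mart: "martingale P \<F> (stopped N (T n))" for n
    using ui by (simp add: ui_martingale_def)
  have "AE \<omega> in P. \<forall>n. \<forall>q\<in>\<rat>. \<forall>r\<in>\<rat>. 0 \<le> q \<longrightarrow> q \<le> r \<longrightarrow> \<gamma> \<omega> \<le> ennreal q \<longrightarrow>
      stopped N (T n) r \<omega> = stopped N (T n) q \<omega>"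
    unfolding AE_all_countable using AE_rationals_const_after[OF mart] by blast
  with cadlag T AE_jump_times AE_jump_le_end AE_space show ?thesis
  proof eventually_elim
    case (elim \<omega>)
    let ?f = "\<lambda>t. N t \<omega>"
    have rc: "right_cont_path ?f" using elim(1) by (simp add: cadlag_path_def)
    have ex_n: "\<exists>n. ennreal t < T n \<omega>" for t
    proof -
      have "eventually (\<lambda>n. ennreal t < T n \<omega>) sequentially"
        using elim(2) by (intro order_tendstoD(1)[of _ \<infinity>]) auto
      then show ?thesis by (auto simp: eventually_sequentially)
    qed
    have stop: "stopped N (T n) s \<omega> = ?f s" if "ennreal t < T n \<omega>" "0 \<le> s" "s \<le> t" for n s t
    proof (rule stopped_eq[OF that(2)])
      show "ennreal s \<le> T n \<omega>"
        using ennreal_leI[OF that(3)] less_imp_le[OF that(1)] by (rule order_trans)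
    qed
    have after: "?f s = ?f (jump \<omega>)" if fin: "\<gamma> \<omega> < \<infinity>" and s: "jump \<omega> \<le> s" for s
    proof -
      \<comment> \<open>A rational reference time after the jump: all rationals beyond the jump give
        the same value as \<open>q0\<close>, and right continuity carries it back to the
        jump.\<close>
      obtain q0 where q0: "q0 \<in> \<rat>" "jump \<omega> < q0" using Rats_dense_in_real[of "jump \<omega>" "jump \<omega> + 1"] by auto
      have rat: "?f r = ?f q" if "q \<in> \<rat>" "r \<in> \<rat>" "jump \<omega> < q" "q \<le> r" for q r
      proof -
        obtain n where n: "ennreal r < T n \<omega>" using ex_n by blast
        have "0 \<le> q" using that(3) jump_nonneg[of \<omega>] by linarith
        moreover have "\<gamma> \<omega> \<le> ennreal q" using that(3) fin \<open>0 \<le> q\<close> by (simp add: jump_le_iff)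
        ultimately have "stopped N (T n) r \<omega> = stopped N (T n) q \<omega>"
          using elim(6) that by blast
        then show ?thesis
          using stop[OF n, of q] stop[OF n, of r] that(4) \<open>0 \<le> q\<close> by simp
      qed
      have q: "?f q = ?f q0" if "q \<in> \<rat>" "jump \<omega> < q" for q
        by (rule linorder_le_cases[of q q0]) (use rat[of q q0] rat[of q0 q] that q0 in simp_all)
      have "?f s = ?f q0" "?f (jump \<omega>) = ?f q0"
        using s by (auto intro: right_cont_const_on_rationals[OF rc jump_nonneg[of \<omega>] q])
      then show ?thesis by simp
    qed
    show ?case
    proof (rule finite_variation_pathI)
      fix K :: real assume K: "0 \<le> K"
      obtain n where n: "ennreal K < T n \<omega>" using ex_n by blast
      let ?X = "stopped N (T n)"
      show "\<exists>\<phi>. \<forall>s t. 0 \<le> s \<longrightarrow> s \<le> t \<longrightarrow> t \<le> K \<longrightarrow> \<bar>?f t - ?f s\<bar> \<le> \<phi> t - \<phi> s"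
      proof (cases "\<gamma> \<omega> \<le> ennreal K")
        case True
        then have fin: "\<gamma> \<omega> < \<infinity>" and gK: "jump \<omega> \<le> K" using K by (auto simp: jump_le_iff)
        then have "jump \<omega> \<in> jump_times P \<gamma>" using elim by blast
        from martingale_before_jump_dominated[OF mart[of n] this] obtain \<phi> C where
          bound: "\<And>t. 0 \<le> t \<Longrightarrow> t < jump \<omega> \<Longrightarrow> \<phi> t \<le> C"
          and \<phi>: "\<And>s t \<omega>'. \<omega>' \<in> space P \<Longrightarrow> 0 \<le> s \<Longrightarrow> s \<le> t \<Longrightarrow> t < jump \<omega> \<Longrightarrow> ennreal t < \<gamma> \<omega>' \<Longrightarrow>
            \<bar>?X t \<omega>' - ?X s \<omega>'\<bar> \<le> \<phi> t - \<phi> s"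
          by blast
        have "\<exists>\<psi>. \<forall>s t. 0 \<le> s \<longrightarrow> s \<le> t \<longrightarrow> \<bar>?f t - ?f s\<bar> \<le> \<psi> t - \<psi> s"
        proof (rule dominated_with_jump[OF _ bound])
          fix s t assume st: "0 \<le> s" "s \<le> t" "t < jump \<omega>"
          then have "ennreal t < \<gamma> \<omega>" by (simp add: less_jump_iff)
          then show "\<bar>?f t - ?f s\<bar> \<le> \<phi> t - \<phi> s"
            using \<phi>[OF elim(5) st] stop[OF n, of s] stop[OF n, of t] st gK by simp
        next
          show "?f s = ?f (jump \<omega>)" if "jump \<omega> \<le> s" for s by (rule after[OF fin that])
        qed
        then show ?thesis by blast
      next
        case False
        then have K_less: "ennreal K < \<gamma> \<omega>" by simp
        \<comment> \<open>The domination is strict in its endpoint, so a time beyond K is needed.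
          The jump time of \<omega> itself serves if it is finite; otherwise the end is infinite and
          K + 1 is in the time set.\<close>
        obtain u where u: "u \<in> jump_times P \<gamma>" "K < u"
        proof (cases "\<gamma> \<omega> < \<infinity>")
          case True
          then show ?thesis using that[of "jump \<omega>"] elim(3) K_less K by (auto simp: less_jump_iff)
        next
          case False
          then have "jump_end P \<gamma> = \<infinity>" using elim(4) by (auto simp: top_unique not_less)
          then show ?thesis using that[of "K + 1"] jump_times_below_end[of "K + 1"] K by auto
        qed
        from martingale_before_jump_dominated[OF mart[of n] u(1)] obtain \<phi> C where
          "\<And>t. 0 \<le> t \<Longrightarrow> t < u \<Longrightarrow> \<phi> t \<le> C"
          and \<phi>: "\<And>s t \<omega>'. \<omega>' \<in> space P \<Longrightarrow> 0 \<le> s \<Longrightarrow> s \<le> t \<Longrightarrow> t < u \<Longrightarrow> ennreal t < \<gamma> \<omega>' \<Longrightarrow>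
            \<bar>?X t \<omega>' - ?X s \<omega>'\<bar> \<le> \<phi> t - \<phi> s"
          by blast
        show ?thesis
        proof (intro exI[of _ \<phi>] allI impI)
          fix s t assume st: "0 \<le> s" "s \<le> t" "t \<le> K"
          have "ennreal t < \<gamma> \<omega>" using K_less ennreal_leI[OF st(3)] by (rule le_less_trans[rotated])
          then show "\<bar>?f t - ?f s\<bar> \<le> \<phi> t - \<phi> s"
            using \<phi>[OF elim(5) st(1,2)] stop[OF n, of s] stop[OF n, of t] st u(2) by auto
        qed
      qed
    qed
  qed
qed

lemma semimartingale_finite_variation:
  assumes "semimartingale P \<F> X"
  shows "AE \<omega> in P. finite_variation_path (\<lambda>t. X t \<omega>)"
proof -
  from assms obtain N A where N: "local_martingale P \<F> N"
    and A: "AE \<omega> in P. cadlag_path (\<lambda>t. A t \<omega>) \<and> finite_variation_path (\<lambda>t. A t \<omega>)"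
    and X: "\<forall>t\<ge>0. \<forall>\<omega>\<in>space P. X t \<omega> = N t \<omega> + A t \<omega>"
    unfolding semimartingale_def by blast
  from local_martingale_finite_variation[OF N] A AE_space show ?thesis
  proof eventually_elim
    case (elim \<omega>)
    then have fv: "finite_variation_path (\<lambda>t. N t \<omega>)" "finite_variation_path (\<lambda>t. A t \<omega>)" by auto
    show ?case
    proof (rule finite_variation_pathI, intro exI allI impI)
      fix s t :: real assume st: "0 \<le> s" "s \<le> t"
      show "\<bar>X t \<omega> - X s \<omega>\<bar> \<le>
          (variation_fun (\<lambda>t. N t \<omega>) t + variation_fun (\<lambda>t. A t \<omega>) t) -
          (variation_fun (\<lambda>t. N t \<omega>) s + variation_fun (\<lambda>t. A t \<omega>) s)"
        using variation_fun_increment[OF fv(1) st] variation_fun_increment[OF fv(2) st] X elim(3) st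
        by auto
    qed
  qed
qed

section \<open>Conditioning on the jump time\<close>

abbreviation finite_jump :: "'a set" where
  "finite_jump \<equiv> {\<omega>. \<gamma> \<omega> < \<infinity>}"

text \<open>A version of \<open>E[f | \<gamma> = t]\<close>, as a function of \<open>t < \<infinity>\<close>.\<close>

definition jump_density :: "('a \<Rightarrow> ennreal) \<Rightarrow> real \<Rightarrow> ennreal" where
  "jump_density f = RN_deriv \<nu> (distr (density P (\<lambda>\<omega>. f \<omega> * indicator finite_jump \<omega>)) borel jump)"

text \<open>Positive and negative part get separate densities, since \<open>K\<close> need not be
  integrable. Infinite densities are replaced by 0, so this is the conditional mean only where both
  are finite.\<close>

definition jump_mean :: "('a \<Rightarrow> real) \<Rightarrow> real \<Rightarrow> real" where
  "jump_mean K t = enn2real (jump_density (\<lambda>\<omega>. ennreal (K \<omega>)) t) - enn2real (jump_density (\<lambda>\<omega>. ennreal (- K \<omega>)) t)"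

lemma measurable_jump_density [measurable]: "jump_density f \<in> borel_measurable borel"
proof -
  have "jump_density f \<in> borel_measurable \<nu>"
    unfolding jump_density_def by (rule borel_measurable_RN_deriv)
  then show ?thesis by simp
qed

lemma measurable_jump_mean [measurable]: "jump_mean K \<in> borel_measurable borel"
  unfolding jump_mean_def[abs_def] by measurable

text \<open>A null set of dG is avoided by finite jump times almost surely, which gives absolute
  continuity. No finiteness of the weighted measure is demanded, as dG itself is finite;
  \<open>f\<close> may have infinite expectation.\<close>

lemma nn_integral_jump_density:
  assumes [measurable]: "f \<in> borel_measurable P" "h \<in> borel_measurable borel"
  shows "(\<integral>\<^sup>+t. h t * jump_density f t \<partial>\<nu>) = (\<integral>\<^sup>+\<omega>. h (jump \<omega>) * (f \<omega> * indicator finite_jump \<omega>) \<partial>P)"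
proof -
  let ?N = "distr (density P (\<lambda>\<omega>. f \<omega> * indicator finite_jump \<omega>)) borel jump"
  have N: "(\<integral>\<^sup>+t. g t \<partial>?N) = (\<integral>\<^sup>+\<omega>. g (jump \<omega>) * (f \<omega> * indicator finite_jump \<omega>) \<partial>P)"
    if [measurable]: "g \<in> borel_measurable borel" for g
    by (subst nn_integral_distr, simp, simp, subst nn_integral_density) (auto simp: mult.commute)
  have "absolutely_continuous \<nu> ?N"
    unfolding absolutely_continuous_def
  proof
    fix A assume "A \<in> null_sets \<nu>"
    then have [measurable]: "A \<in> sets borel" and "emeasure \<nu> A = 0" by auto
    then have "(\<integral>\<^sup>+t. indicator A t \<partial>\<nu>) = 0" by simp
    then have "(\<integral>\<^sup>+\<omega>. indicator A (jump \<omega>) * indicator finite_jump \<omega> \<partial>P) = 0"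
      by (subst (asm) nn_integral_jump_law) auto
    then have "AE \<omega> in P. indicator A (jump \<omega>) * indicator finite_jump \<omega> = (0 :: ennreal)"
      by (subst (asm) nn_integral_0_iff_AE) auto
    then have "(\<integral>\<^sup>+\<omega>. indicator A (jump \<omega>) * (f \<omega> * indicator finite_jump \<omega>) \<partial>P) = 0"
      by (subst nn_integral_0_iff_AE) (auto elim!: eventually_mono)
    then have "emeasure ?N A = 0"
      using N[of "indicator A"] by simp
    then show "A \<in> null_sets ?N" by auto
  qed
  then have "(\<integral>\<^sup>+t. h t \<partial>?N) = (\<integral>\<^sup>+t. jump_density f t * h t \<partial>\<nu>)"
    unfolding jump_density_def by (intro law.RN_deriv_nn_integral) auto
  then show ?thesis using N[of h] by (simp add: mult.commute)
qed

lemma sets_jump_sigma: "sets (jump_sigma P \<gamma>) = {\<gamma> -` B \<inter> space P | B. B \<in> sets borel}"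
  unfolding jump_sigma_def by (rule sets_vimage_algebra2) auto

lemma measurable_jump_sigma [measurable]: "\<gamma> \<in> borel_measurable (jump_sigma P \<gamma>)"
  unfolding jump_sigma_def by (rule measurable_vimage_algebra1) auto

lemma measurable_jump_real_sigma [measurable]: "jump \<in> borel_measurable (jump_sigma P \<gamma>)"
  unfolding jump_def[abs_def] by measurable

lemma space_jump_sigma [simp]: "space (jump_sigma P \<gamma>) = space P"
  by (simp add: jump_sigma_def)

lemma subalgebra_jump_sigma: "subalgebra P (jump_sigma P \<gamma>)"
  unfolding subalgebra_def sets_jump_sigma by (auto intro: measurable_sets)

sublocale cond: sigma_finite_subalgebra P "jump_sigma P \<gamma>"
  by (rule finite_measure_subalgebra_is_sigma_finite)
    (simp add: finite_measure_subalgebra_def finite_measure_subalgebra_axioms_def subalgebra_jump_sigma finite_measure_axioms)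

text \<open>An event generated by \<open>\<gamma>\<close> is, within {\<gamma> < \<infinity>}, an
  event about \<open>jump\<close>. So the density evaluated at \<open>jump\<close> satisfies the
  defining equation of the conditional expectation there.\<close>

lemma nn_cond_exp_jump:
  assumes [measurable]: "f \<in> borel_measurable P"
  shows "AE \<omega> in P. \<gamma> \<omega> < \<infinity> \<longrightarrow> nn_cond_exp P (jump_sigma P \<gamma>) f \<omega> = jump_density f (jump \<omega>)"
proof -
  let ?I = "\<lambda>\<omega>. indicator finite_jump \<omega> :: ennreal"
  have I [measurable]: "?I \<in> borel_measurable (jump_sigma P \<gamma>)"
    unfolding indicator_def mem_Collect_eq by measurable
  have "AE \<omega> in P. jump_density f (jump \<omega>) * ?I \<omega> = nn_cond_exp P (jump_sigma P \<gamma>) (\<lambda>\<omega>. ?I \<omega> * f \<omega>) \<omega>"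
  proof (rule cond.nn_cond_exp_charact)
    fix A assume "A \<in> sets (jump_sigma P \<gamma>)"
    then obtain B where B [measurable]: "B \<in> sets borel" and A: "A = \<gamma> -` B \<inter> space P"
      by (auto simp: sets_jump_sigma)
    let ?h = "\<lambda>t. indicator B (ennreal t) :: ennreal"
    have ind: "?I \<omega> * indicator A \<omega> = ?h (jump \<omega>) * ?I \<omega>" if "\<omega> \<in> space P" for \<omega>
      using that by (auto simp: A ennreal_jump split: split_indicator)
    have "(\<integral>\<^sup>+\<omega>\<in>A. (?I \<omega> * f \<omega>) \<partial>P) = (\<integral>\<^sup>+\<omega>. ?h (jump \<omega>) * (f \<omega> * ?I \<omega>) \<partial>P)"
    proof (rule nn_integral_cong)
      fix \<omega> assume "\<omega> \<in> space P"
      from ind[OF this] show "?I \<omega> * f \<omega> * indicator A \<omega> = ?h (jump \<omega>) * (f \<omega> * ?I \<omega>)"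
        by (metis mult.assoc mult.commute)
    qed
    also have "\<dots> = (\<integral>\<^sup>+t. ?h t * jump_density f t \<partial>\<nu>)"
      by (subst nn_integral_jump_density) auto
    also have "\<dots> = (\<integral>\<^sup>+\<omega>. ?h (jump \<omega>) * jump_density f (jump \<omega>) * ?I \<omega> \<partial>P)"
      by (subst nn_integral_jump_law) auto
    also have "\<dots> = (\<integral>\<^sup>+\<omega>\<in>A. (jump_density f (jump \<omega>) * ?I \<omega>) \<partial>P)"
    proof (rule nn_integral_cong)
      fix \<omega> assume "\<omega> \<in> space P"
      from ind[OF this] show "?h (jump \<omega>) * jump_density f (jump \<omega>) * ?I \<omega> =
          jump_density f (jump \<omega>) * ?I \<omega> * indicator A \<omega>"
        by (metis mult.assoc mult.commute)
    qed
    finally show "(\<integral>\<^sup>+\<omega>\<in>A. (?I \<omega> * f \<omega>) \<partial>P) = (\<integral>\<^sup>+\<omega>\<in>A. (jump_density f (jump \<omega>) * ?I \<omega>) \<partial>P)" .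
  qed measurable
  moreover have "AE \<omega> in P. ?I \<omega> * nn_cond_exp P (jump_sigma P \<gamma>) f \<omega> =
      nn_cond_exp P (jump_sigma P \<gamma>) (\<lambda>\<omega>. ?I \<omega> * f \<omega>) \<omega>"
    by (rule cond.nn_cond_exp_prod) measurable
  ultimately show ?thesis
    by eventually_elim (auto simp: indicator_def)
qed

lemma nn_integral_jump_density_indicator:
  assumes [measurable]: "f \<in> borel_measurable P" "B \<in> sets borel"
  shows "(\<integral>\<^sup>+t. indicator B t * jump_density f t \<partial>\<nu>) =
    (\<integral>\<^sup>+\<omega>. f \<omega> * (indicator B (jump \<omega>) * indicator finite_jump \<omega>) \<partial>P)"
  by (subst nn_integral_jump_density) (auto simp: ac_simps)

text \<open>Integrability of \<open>K\<close> over jump times in \<open>B\<close> is enough: it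
  makes both densities almost everywhere finite on \<open>B\<close>, and there the truncation in
  \<open>jump_mean\<close> changes nothing.\<close>

lemma jump_mean_integral:
  assumes [measurable]: "K \<in> borel_measurable P" "B \<in> sets borel"
    and int: "integrable P (\<lambda>\<omega>. K \<omega> * (indicator B (jump \<omega>) * indicator finite_jump \<omega>))"
  shows "integrable \<nu> (\<lambda>t. jump_mean K t * indicator B t)"
    and "(\<integral>\<omega>. K \<omega> * (indicator B (jump \<omega>) * indicator finite_jump \<omega>) \<partial>P) = (\<integral>t. jump_mean K t * indicator B t \<partial>\<nu>)"
    and "AE t in \<nu>. t \<in> B \<longrightarrow> jump_density (\<lambda>\<omega>. ennreal (K \<omega>)) t < \<infinity> \<and> jump_density (\<lambda>\<omega>. ennreal (- K \<omega>)) t < \<infinity>"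
proof -
  let ?I = "\<lambda>\<omega>. indicator B (jump \<omega>) * indicator finite_jump \<omega>"
  \<comment> \<open>The conversion \<open>ennreal\<close> sends negative reals to 0, so \<sigma> = 1
    and \<sigma> = -1 yield the positive and the negative part of \<open>K\<close>.\<close>
  let ?d = "\<lambda>\<sigma>. jump_density (\<lambda>\<omega>. ennreal (\<sigma> * K \<omega>))"
  let ?g = "\<lambda>\<sigma> t. enn2real (?d \<sigma> t) * indicator B t"
  have *: "integrable \<nu> (?g \<sigma>)" "(\<integral>t. ?g \<sigma> t \<partial>\<nu>) = enn2real (\<integral>\<^sup>+\<omega>. ennreal (\<sigma> * (K \<omega> * ?I \<omega>)) \<partial>P)"
    "AE t in \<nu>. t \<in> B \<longrightarrow> ?d \<sigma> t < \<infinity>" for \<sigma>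
  proof -
    have eq: "(\<integral>\<^sup>+t. indicator B t * ?d \<sigma> t \<partial>\<nu>) = (\<integral>\<^sup>+\<omega>. ennreal (\<sigma> * (K \<omega> * ?I \<omega>)) \<partial>P)"
      by (subst nn_integral_jump_density_indicator)
        (auto intro!: nn_integral_cong simp: indicator_def)
    have "integrable P (\<lambda>\<omega>. \<sigma> * (K \<omega> * ?I \<omega>))" using int by (rule integrable_mult_right)
    from iffD1[OF real_integrable_def this] have fin: "(\<integral>\<^sup>+t. indicator B t * ?d \<sigma> t \<partial>\<nu>) < \<infinity>"
      unfolding eq by (simp add: less_top)
    then have "AE t in \<nu>. indicator B t * ?d \<sigma> t \<noteq> \<infinity>"
      by (intro nn_integral_noteq_infinite) auto
    then show AE: "AE t in \<nu>. t \<in> B \<longrightarrow> ?d \<sigma> t < \<infinity>"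
      by eventually_elim (auto simp: less_top)
    have eq2: "(\<integral>\<^sup>+t. ennreal (?g \<sigma> t) \<partial>\<nu>) = (\<integral>\<^sup>+t. indicator B t * ?d \<sigma> t \<partial>\<nu>)"
      by (rule nn_integral_cong_AE, use AE in eventually_elim) (auto split: split_indicator)
    show "integrable \<nu> (?g \<sigma>)"
      using fin eq2 by (intro integrableI_nonneg) auto
    show "(\<integral>t. ?g \<sigma> t \<partial>\<nu>) = enn2real (\<integral>\<^sup>+\<omega>. ennreal (\<sigma> * (K \<omega> * ?I \<omega>)) \<partial>P)"
      by (subst integral_eq_nn_integral) (auto simp: eq2 eq)
  qed
  have split: "jump_mean K t * indicator B t = ?g 1 t - ?g (- 1) t" for t
    by (simp add: jump_mean_def algebra_simps)
  show "integrable \<nu> (\<lambda>t. jump_mean K t * indicator B t)"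
    unfolding split using * by (intro Bochner_Integration.integrable_diff)
  show "(\<integral>\<omega>. K \<omega> * ?I \<omega> \<partial>P) = (\<integral>t. jump_mean K t * indicator B t \<partial>\<nu>)"
    unfolding split using real_lebesgue_integral_def[OF int] *(2)[of 1] *(2)[of "-1"]
    by (subst Bochner_Integration.integral_diff[OF *(1) *(1)]) simp
  show "AE t in \<nu>. t \<in> B \<longrightarrow> jump_density (\<lambda>\<omega>. ennreal (K \<omega>)) t < \<infinity> \<and> jump_density (\<lambda>\<omega>. ennreal (- K \<omega>)) t < \<infinity>"
    using *(3)[of 1] *(3)[of "-1"] by eventually_elim simp
qed

text \<open>Here \<open>l\<close> is a finite version of the conditional mean of \<bar>L\<bar> on
  {\<gamma> > 0}. As dG is finite, a bound on \<open>l\<close> over \<open>B\<close> makes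
  \<open>L\<close> integrable there, and its conditional mean 0 becomes an honest integral 0.
  Nothing is claimed at jump time 0, where \<open>L\<close> may fail to be conditionally
  integrable.\<close>

lemma centred_given_jump:
  assumes [measurable]: "L \<in> borel_measurable P"
    and fin: "AE \<omega> in P. nn_cond_exp P (jump_sigma P \<gamma>) (\<lambda>\<omega>. ennreal \<bar>L \<omega>\<bar> * indicator {\<omega>. \<gamma> \<omega> > 0} \<omega>) \<omega> < \<infinity>"
    and zero: "gen_cond_exp_zero P (jump_sigma P \<gamma>) L"
  obtains l :: "real \<Rightarrow> real" where "l \<in> borel_measurable borel"
    "\<And>B c. B \<in> sets borel \<Longrightarrow> B \<subseteq> {0<..} \<Longrightarrow> (\<And>t. t \<in> B \<Longrightarrow> l t \<le> c) \<Longrightarrow>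
      integrable P (\<lambda>\<omega>. L \<omega> * (indicator B (jump \<omega>) * indicator finite_jump \<omega>))"
    "\<And>B c. B \<in> sets borel \<Longrightarrow> B \<subseteq> {0<..} \<Longrightarrow> (\<And>t. t \<in> B \<Longrightarrow> l t \<le> c) \<Longrightarrow>
      (\<integral>\<omega>. L \<omega> * (indicator B (jump \<omega>) * indicator finite_jump \<omega>) \<partial>P) = 0"
proof -
  let ?f = "\<lambda>\<omega>. ennreal \<bar>L \<omega>\<bar> * indicator {\<omega>. \<gamma> \<omega> > 0} \<omega>"
  let ?I = "\<lambda>B \<omega>. indicator B (jump \<omega>) * indicator finite_jump \<omega>"
  define l where "l t = enn2real (jump_density ?f t)" for t
  have f [measurable]: "?f \<in> borel_measurable P"
    unfolding indicator_def mem_Collect_eq by measurable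
  have l_fin: "AE t in \<nu>. jump_density ?f t < \<infinity>"
    by (subst AE_jump_law_iff, simp) (use fin nn_cond_exp_jump[OF f] in eventually_elim, auto)
  \<comment> \<open>A positive value of \<open>jump\<close> forces \<gamma> > 0, so on
    \<open>B\<close> the indicator in \<open>?f\<close> is 1.\<close>
  have pos: "?f \<omega> * (indicator B (jump \<omega>) * indicator finite_jump \<omega>) = ennreal \<bar>L \<omega> * ?I B \<omega>\<bar>"
    if "B \<subseteq> {0<..}" for B \<omega>
    using that by (auto simp: jump_def abs_mult split: split_indicator intro: ccontr)
  have int: "integrable P (\<lambda>\<omega>. L \<omega> * ?I B \<omega>)"
    if [measurable]: "B \<in> sets borel" and B: "B \<subseteq> {0<..}" "\<And>t. t \<in> B \<Longrightarrow> l t \<le> c" for B c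
  proof (rule integrableI_bounded)
    have "(\<integral>\<^sup>+\<omega>. ennreal \<bar>L \<omega> * ?I B \<omega>\<bar> \<partial>P) = (\<integral>\<^sup>+t. indicator B t * jump_density ?f t \<partial>\<nu>)"
      by (simp only: nn_integral_jump_density_indicator[OF f that(1)] pos[OF B(1)])
    also have "\<dots> \<le> (\<integral>\<^sup>+t. ennreal c \<partial>\<nu>)"
    proof (rule nn_integral_mono_AE, use l_fin in eventually_elim)
      case (elim t)
      show ?case
      proof (cases "t \<in> B")
        case True
        then show ?thesis using B(2)[OF True] elim
          unfolding l_def by (cases "jump_density ?f t") (auto intro: ennreal_leI)
      qed simp
    qed
    also have "\<dots> < \<infinity>"
      by (simp add: ennreal_mult_less_top law.emeasure_eq_measure)
    finally show "(\<integral>\<^sup>+\<omega>. ennreal (norm (L \<omega> * ?I B \<omega>)) \<partial>P) < \<infinity>" by simp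
  qed measurable
  have "(\<integral>\<omega>. L \<omega> * ?I B \<omega> \<partial>P) = 0"
    if [measurable]: "B \<in> sets borel" and B: "B \<subseteq> {0<..}" "\<And>t. t \<in> B \<Longrightarrow> l t \<le> c" for B c
  proof -
    let ?R = "real_cond_exp P (jump_sigma P \<gamma>) L"
    have [measurable]: "(\<lambda>\<omega>. ?I B \<omega> :: real) \<in> borel_measurable (jump_sigma P \<gamma>)"
      unfolding indicator_def mem_Collect_eq by measurable
    have [measurable]: "(\<lambda>\<omega>. indicator {\<omega>. \<gamma> \<omega> > 0} \<omega> :: ennreal) \<in> borel_measurable (jump_sigma P \<gamma>)"
      unfolding indicator_def mem_Collect_eq by measurable
    have "AE \<omega> in P. indicator {\<omega>. \<gamma> \<omega> > 0} \<omega> * nn_cond_exp P (jump_sigma P \<gamma>) (\<lambda>\<omega>. ennreal \<bar>L \<omega>\<bar>) \<omega> =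
        nn_cond_exp P (jump_sigma P \<gamma>) (\<lambda>\<omega>. indicator {\<omega>. \<gamma> \<omega> > 0} \<omega> * ennreal \<bar>L \<omega>\<bar>) \<omega>"
      by (rule cond.nn_cond_exp_prod) measurable
    \<comment> \<open>The vanishing of the generalized conditional expectation speaks only where the
      absolute value has finite conditional mean; this shows that {\<gamma> > 0} is covered.\<close>
    then have "AE \<omega> in P. \<gamma> \<omega> > 0 \<longrightarrow> nn_cond_exp P (jump_sigma P \<gamma>) (\<lambda>\<omega>. ennreal \<bar>L \<omega>\<bar>) \<omega> < \<infinity>"
      using fin by eventually_elim (auto simp: mult.commute split: split_indicator)
    with zero[unfolded gen_cond_exp_zero_def] have R: "AE \<omega> in P. \<gamma> \<omega> > 0 \<longrightarrow> ?R \<omega> = 0"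
      by eventually_elim auto
    have "(\<integral>\<omega>. L \<omega> * ?I B \<omega> \<partial>P) = (\<integral>\<omega>. ?I B \<omega> * L \<omega> \<partial>P)"
      by (simp add: mult.commute)
    also have "\<dots> = (\<integral>\<omega>. ?I B \<omega> * ?R \<omega> \<partial>P)"
      by (rule cond.real_cond_exp_intg(2)[symmetric]) (use int[OF that] in \<open>auto simp: mult.commute\<close>)
    also have "\<dots> = (\<integral>\<omega>. 0 \<partial>P)"
    proof (rule integral_cong_AE)
      show "AE \<omega> in P. ?I B \<omega> * ?R \<omega> = 0"
        using R by eventually_elim (use B(1) in \<open>auto simp: jump_def split: split_indicator intro: ccontr\<close>)
    qed measurable
    finally show ?thesis by simp
  qed
  then show thesis
    using int by (intro that[of l]) (auto simp: l_def[abs_def])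
qed

text \<open>Centring works even where \<open>K\<close> is not conditionally integrable. A finite
  conditional mean of \<bar>L\<bar> forces one of \<bar>K\<bar>, because they differ by a finite
  function of the jump time; and where both densities of \<open>K\<close> are at most n,
  \<open>K\<close> is integrable and can be centred in the usual way.\<close>

lemma centre_given_jump:
  assumes [measurable]: "K \<in> borel_measurable P"
  defines "L \<equiv> \<lambda>\<omega>. (K \<omega> - jump_mean K (jump \<omega>)) * indicator finite_jump \<omega>"
  shows "gen_cond_exp_zero P (jump_sigma P \<gamma>) L"
    and "(AE t in \<nu>. 0 < t \<longrightarrow> jump_density (\<lambda>\<omega>. ennreal (K \<omega>)) t < \<infinity> \<and> jump_density (\<lambda>\<omega>. ennreal (- K \<omega>)) t < \<infinity>) \<Longrightarrow>
      AE \<omega> in P. nn_cond_exp P (jump_sigma P \<gamma>) (\<lambda>\<omega>. ennreal \<bar>L \<omega>\<bar> * indicator {\<omega>. \<gamma> \<omega> > 0} \<omega>) \<omega> < \<infinity>"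
proof -
  let ?J = "jump_sigma P \<gamma>" and ?I = "\<lambda>\<omega>. indicator finite_jump \<omega> :: real"
  let ?p = "jump_density (\<lambda>\<omega>. ennreal (K \<omega>))" and ?m = "jump_density (\<lambda>\<omega>. ennreal (- K \<omega>))"
  let ?k = "\<lambda>\<omega>. jump_mean K (jump \<omega>) * ?I \<omega>"
  have I [measurable]: "?I \<in> borel_measurable ?J"
    unfolding indicator_def mem_Collect_eq by measurable
  have IP [measurable]: "?I \<in> borel_measurable P"
    unfolding indicator_def mem_Collect_eq by measurable
  have k [measurable]: "?k \<in> borel_measurable ?J" by measurable
  have L [measurable]: "L \<in> borel_measurable P" unfolding L_def by measurable
  have abs_sum: "ennreal \<bar>x\<bar> = ennreal x + ennreal (- x)" for x :: real
    by (cases "0 \<le> x") (auto simp: ennreal_neg)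
  have K_abs: "AE \<omega> in P. nn_cond_exp P ?J (\<lambda>\<omega>. ennreal \<bar>K \<omega>\<bar>) \<omega> =
      nn_cond_exp P ?J (\<lambda>\<omega>. ennreal (K \<omega>)) \<omega> + nn_cond_exp P ?J (\<lambda>\<omega>. ennreal (- K \<omega>)) \<omega>"
    unfolding abs_sum by (rule AE_symmetric[OF cond.nn_cond_exp_sum]) measurable
  have K_jump: "AE \<omega> in P. \<gamma> \<omega> < \<infinity> \<longrightarrow> nn_cond_exp P ?J (\<lambda>\<omega>. ennreal \<bar>K \<omega>\<bar>) \<omega> = ?p (jump \<omega>) + ?m (jump \<omega>)"
    using K_abs nn_cond_exp_jump[of "\<lambda>\<omega>. ennreal (K \<omega>)"] nn_cond_exp_jump[of "\<lambda>\<omega>. ennreal (- K \<omega>)"]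
    by (auto elim: eventually_elim2)
  \<comment> \<open>Applied twice: \<open>L\<close> is controlled by \<open>K\<close> for the
    finiteness claim, and \<open>K\<close> by \<open>L\<close> for the vanishing claim.\<close>
  have triangle: "AE \<omega> in P. nn_cond_exp P ?J (\<lambda>\<omega>. ennreal \<bar>U \<omega>\<bar>) \<omega> \<le>
      nn_cond_exp P ?J (\<lambda>\<omega>. ennreal \<bar>V \<omega>\<bar>) \<omega> + ennreal \<bar>?k \<omega>\<bar>"
    if [measurable]: "U \<in> borel_measurable P" "V \<in> borel_measurable P"
      and le: "\<And>\<omega>. \<bar>U \<omega>\<bar> \<le> \<bar>V \<omega>\<bar> + \<bar>?k \<omega>\<bar>" for U V
  proof -
    have "AE \<omega> in P. nn_cond_exp P ?J (\<lambda>\<omega>. ennreal \<bar>U \<omega>\<bar>) \<omega> \<le>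
        nn_cond_exp P ?J (\<lambda>\<omega>. ennreal \<bar>V \<omega>\<bar> + ennreal \<bar>?k \<omega>\<bar>) \<omega>"
      by (rule cond.nn_cond_exp_mono)
        (use le in \<open>auto intro!: AE_I2 ennreal_leI simp flip: ennreal_plus\<close>)
    moreover have "AE \<omega> in P. nn_cond_exp P ?J (\<lambda>\<omega>. ennreal \<bar>V \<omega>\<bar>) \<omega> + nn_cond_exp P ?J (\<lambda>\<omega>. ennreal \<bar>?k \<omega>\<bar>) \<omega>
        = nn_cond_exp P ?J (\<lambda>\<omega>. ennreal \<bar>V \<omega>\<bar> + ennreal \<bar>?k \<omega>\<bar>) \<omega>"
      by (rule cond.nn_cond_exp_sum) measurable
    moreover have "AE \<omega> in P. ennreal \<bar>?k \<omega>\<bar> = nn_cond_exp P ?J (\<lambda>\<omega>. ennreal \<bar>?k \<omega>\<bar>) \<omega>"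
      by (rule cond.nn_cond_exp_F_meas) measurable
    ultimately show ?thesis by eventually_elim simp
  qed
  have IK: "AE \<omega> in P. nn_cond_exp P ?J (\<lambda>\<omega>. ennreal \<bar>K \<omega> * ?I \<omega>\<bar>) \<omega> =
      indicator finite_jump \<omega> * nn_cond_exp P ?J (\<lambda>\<omega>. ennreal \<bar>K \<omega>\<bar>) \<omega>"
  proof -
    have [measurable]: "(\<lambda>\<omega>. indicator finite_jump \<omega> :: ennreal) \<in> borel_measurable ?J"
      unfolding indicator_def mem_Collect_eq by measurable
    have eq: "ennreal \<bar>K \<omega> * ?I \<omega>\<bar> = indicator finite_jump \<omega> * ennreal \<bar>K \<omega>\<bar>" for \<omega>
      by (auto split: split_indicator)
    show ?thesis
      unfolding eq by (rule AE_symmetric[OF cond.nn_cond_exp_prod]) measurable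
  qed
  have IK_jump: "AE \<omega> in P. nn_cond_exp P ?J (\<lambda>\<omega>. ennreal \<bar>K \<omega> * ?I \<omega>\<bar>) \<omega> =
      indicator finite_jump \<omega> * (?p (jump \<omega>) + ?m (jump \<omega>))"
    using IK K_jump by eventually_elim (auto split: split_indicator)
  show "AE \<omega> in P. nn_cond_exp P ?J (\<lambda>\<omega>. ennreal \<bar>L \<omega>\<bar> * indicator {\<omega>. \<gamma> \<omega> > 0} \<omega>) \<omega> < \<infinity>"
    if fin: "AE t in \<nu>. 0 < t \<longrightarrow> ?p t < \<infinity> \<and> ?m t < \<infinity>"
  proof -
    have [measurable]: "(\<lambda>\<omega>. indicator {\<omega>. \<gamma> \<omega> > 0} \<omega> :: ennreal) \<in> borel_measurable ?J"
      unfolding indicator_def mem_Collect_eq by measurable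
    have "AE \<omega> in P. indicator {\<omega>. \<gamma> \<omega> > 0} \<omega> * nn_cond_exp P ?J (\<lambda>\<omega>. ennreal \<bar>L \<omega>\<bar>) \<omega> =
        nn_cond_exp P ?J (\<lambda>\<omega>. indicator {\<omega>. \<gamma> \<omega> > 0} \<omega> * ennreal \<bar>L \<omega>\<bar>) \<omega>"
      by (rule cond.nn_cond_exp_prod) measurable
    moreover have "AE \<omega> in P. nn_cond_exp P ?J (\<lambda>\<omega>. ennreal \<bar>L \<omega>\<bar>) \<omega> \<le>
        nn_cond_exp P ?J (\<lambda>\<omega>. ennreal \<bar>K \<omega> * ?I \<omega>\<bar>) \<omega> + ennreal \<bar>?k \<omega>\<bar>"
      by (rule triangle) (auto simp: L_def split: split_indicator)
    moreover have "AE \<omega> in P. \<gamma> \<omega> < \<infinity> \<longrightarrow> 0 < jump \<omega> \<longrightarrow> ?p (jump \<omega>) < \<infinity> \<and> ?m (jump \<omega>) < \<infinity>"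
      using fin by (subst (asm) AE_jump_law_iff) auto
    ultimately show ?thesis
      using IK_jump
    proof eventually_elim
      case (elim \<omega>)
      show ?case
      proof (cases "0 < \<gamma> \<omega>")
        case True
        have "nn_cond_exp P ?J (\<lambda>\<omega>. ennreal \<bar>K \<omega> * ?I \<omega>\<bar>) \<omega> < \<infinity>"
        proof (cases "\<gamma> \<omega> < \<infinity>")
          case fin: True
          then have "0 < jump \<omega>" using True by (simp add: jump_def enn2real_positive_iff)
          then show ?thesis using elim(3,4) fin by simp
        qed (use elim(4) in simp)
        then have "nn_cond_exp P ?J (\<lambda>\<omega>. ennreal \<bar>L \<omega>\<bar>) \<omega> < \<infinity>"
          using elim(2) by (auto intro: le_less_trans)
        then show ?thesis using elim(1) True by (simp add: mult.commute)
      next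
        case False
        then show ?thesis using elim(1) by (simp add: mult.commute)
      qed
    qed
  qed
  \<comment> \<open>These level sets exhaust the times at which both densities are finite, and
    \<open>K\<close> is integrable over jump times in each of them.\<close>
  define C where "C n = {t. ?p t \<le> of_nat n \<and> ?m t \<le> of_nat n}" for n :: nat
  have C [measurable]: "C n \<in> sets borel" for n unfolding C_def by measurable
  let ?In = "\<lambda>n \<omega>. indicator (C n) (jump \<omega>) * ?I \<omega>"
  have In [measurable]: "?In n \<in> borel_measurable ?J" for n by measurable
  have intK: "integrable P (\<lambda>\<omega>. K \<omega> * ?In n \<omega>)" for n
  proof (rule integrableI_bounded)
    have *: "(\<integral>\<^sup>+\<omega>. ennreal (\<sigma> * K \<omega>) * (indicator (C n) (jump \<omega>) * indicator finite_jump \<omega>) \<partial>P) < \<infinity>"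
      if d: "\<And>t. t \<in> C n \<Longrightarrow> jump_density (\<lambda>\<omega>. ennreal (\<sigma> * K \<omega>)) t \<le> of_nat n" for \<sigma>
    proof -
      have "(\<integral>\<^sup>+\<omega>. ennreal (\<sigma> * K \<omega>) * (indicator (C n) (jump \<omega>) * indicator finite_jump \<omega>) \<partial>P) =
          (\<integral>\<^sup>+t. indicator (C n) t * jump_density (\<lambda>\<omega>. ennreal (\<sigma> * K \<omega>)) t \<partial>\<nu>)"
        by (rule nn_integral_jump_density_indicator[symmetric]) measurable
      also have "\<dots> \<le> (\<integral>\<^sup>+t. of_nat n \<partial>\<nu>)"
        by (rule nn_integral_mono) (use d in \<open>auto split: split_indicator\<close>)
      also have "\<dots> < \<infinity>"
        by (simp add: ennreal_mult_less_top law.emeasure_eq_measure of_nat_less_top)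
      finally show ?thesis .
    qed
    have "(\<integral>\<^sup>+\<omega>. ennreal (norm (K \<omega> * ?In n \<omega>)) \<partial>P) =
        (\<integral>\<^sup>+\<omega>. ennreal (1 * K \<omega>) * (indicator (C n) (jump \<omega>) * indicator finite_jump \<omega>)
          + ennreal (- 1 * K \<omega>) * (indicator (C n) (jump \<omega>) * indicator finite_jump \<omega>) \<partial>P)"
      by (rule nn_integral_cong) (auto simp: abs_mult abs_sum split: split_indicator)
    also have "\<dots> < \<infinity>"
      using *[of 1] *[of "-1"] by (subst nn_integral_add) (auto simp: C_def)
    finally show "(\<integral>\<^sup>+\<omega>. ennreal (norm (K \<omega> * ?In n \<omega>)) \<partial>P) < \<infinity>" .
  qed measurable
  have intk: "integrable P (\<lambda>\<omega>. jump_mean K (jump \<omega>) * ?In n \<omega>)" for n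
  proof -
    have "integrable \<nu> (\<lambda>t. jump_mean K t * indicator (C n) t)"
      by (rule jump_mean_integral(1)[OF assms(1) C intK])
    then show ?thesis
      by (subst (asm) integrable_jump_law_iff) (auto simp: mult.assoc)
  qed
  have LIn: "?In n \<omega> * L \<omega> = K \<omega> * ?In n \<omega> - jump_mean K (jump \<omega>) * ?In n \<omega>" for n \<omega>
    by (auto simp: L_def split: split_indicator)
  have intL: "integrable P (\<lambda>\<omega>. ?In n \<omega> * L \<omega>)" for n
    unfolding LIn using intK intk by (rule Bochner_Integration.integrable_diff)
  have zero_n: "AE \<omega> in P. real_cond_exp P ?J (\<lambda>\<omega>. ?In n \<omega> * L \<omega>) \<omega> = 0" for n
  proof (rule cond.real_cond_exp_charact)
    fix A assume "A \<in> sets ?J"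
    then obtain B where B [measurable]: "B \<in> sets borel" and A: "A = \<gamma> -` B \<inter> space P"
      by (auto simp: sets_jump_sigma)
    let ?D = "C n \<inter> {t. ennreal t \<in> B}"
    have D [measurable]: "?D \<in> sets borel" by measurable
    have int1: "integrable P (\<lambda>\<omega>. K \<omega> * (indicator ?D (jump \<omega>) * ?I \<omega>))"
      by (rule Bochner_Integration.integrable_bound[OF intK[of n]])
        (auto split: split_indicator)
    have int2: "integrable P (\<lambda>\<omega>. jump_mean K (jump \<omega>) * (indicator ?D (jump \<omega>) * ?I \<omega>))"
      by (rule Bochner_Integration.integrable_bound[OF intk[of n]])
        (auto split: split_indicator)
    have "(LINT \<omega>:A|P. ?In n \<omega> * L \<omega>) =
        (\<integral>\<omega>. K \<omega> * (indicator ?D (jump \<omega>) * ?I \<omega>) - jump_mean K (jump \<omega>) * (indicator ?D (jump \<omega>) * ?I \<omega>) \<partial>P)"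
      unfolding set_lebesgue_integral_def
      by (rule Bochner_Integration.integral_cong[OF refl])
        (auto simp: A ennreal_jump L_def split: split_indicator)
    also have "\<dots> = (\<integral>\<omega>. K \<omega> * (indicator ?D (jump \<omega>) * ?I \<omega>) \<partial>P) -
        (\<integral>\<omega>. jump_mean K (jump \<omega>) * (indicator ?D (jump \<omega>) * ?I \<omega>) \<partial>P)"
      by (rule Bochner_Integration.integral_diff[OF int1 int2])
    also have "(\<integral>\<omega>. jump_mean K (jump \<omega>) * (indicator ?D (jump \<omega>) * ?I \<omega>) \<partial>P) = (\<integral>t. jump_mean K t * indicator ?D t \<partial>\<nu>)"
      by (subst integral_jump_law) (auto simp: mult.assoc)
    also have "\<dots> = (\<integral>\<omega>. K \<omega> * (indicator ?D (jump \<omega>) * ?I \<omega>) \<partial>P)"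
      by (rule jump_mean_integral(2)[OF assms(1) D int1, symmetric])
    finally show "(LINT \<omega>:A|P. ?In n \<omega> * L \<omega>) = (LINT \<omega>:A|P. 0)"
      by (simp add: set_lebesgue_integral_def)
  qed (use intL in auto)
  have "AE \<omega> in P. \<forall>n. ?In n \<omega> * real_cond_exp P ?J L \<omega> = 0"
    unfolding AE_all_countable
  proof
    fix n
    have "AE \<omega> in P. real_cond_exp P ?J (\<lambda>\<omega>. ?In n \<omega> * L \<omega>) \<omega> = ?In n \<omega> * real_cond_exp P ?J L \<omega>"
      by (rule cond.real_cond_exp_mult[OF In L intL])
    with zero_n[of n] show "AE \<omega> in P. ?In n \<omega> * real_cond_exp P ?J L \<omega> = 0"
      by eventually_elim simp
  qed
  moreover have "AE \<omega> in P. real_cond_exp P ?J L \<omega> * (1 - ?I \<omega>) = 0"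
  proof -
    have eq: "(\<lambda>\<omega>. (1 - ?I \<omega>) * L \<omega>) = (\<lambda>\<omega>. 0)"
      by (rule ext) (auto simp: L_def indicator_def)
    have "AE \<omega> in P. real_cond_exp P ?J (\<lambda>\<omega>. (1 - ?I \<omega>) * L \<omega>) \<omega> = (1 - ?I \<omega>) * real_cond_exp P ?J L \<omega>"
    proof (rule cond.real_cond_exp_mult)
      show "integrable P (\<lambda>\<omega>. (1 - ?I \<omega>) * L \<omega>)" unfolding eq by simp
    qed measurable
    then have "AE \<omega> in P. real_cond_exp P ?J (\<lambda>\<omega>. 0) \<omega> = (1 - ?I \<omega>) * real_cond_exp P ?J L \<omega>"
      unfolding eq .
    moreover have "AE \<omega> in P. real_cond_exp P ?J (\<lambda>\<omega>. 0) \<omega> = 0"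
      by (rule cond.real_cond_exp_F_meas) auto
    ultimately show ?thesis by eventually_elim (simp add: mult.commute)
  qed
  moreover have "AE \<omega> in P. nn_cond_exp P ?J (\<lambda>\<omega>. ennreal \<bar>K \<omega> * ?I \<omega>\<bar>) \<omega> \<le>
      nn_cond_exp P ?J (\<lambda>\<omega>. ennreal \<bar>L \<omega>\<bar>) \<omega> + ennreal \<bar>?k \<omega>\<bar>"
    by (rule triangle) (auto simp: L_def split: split_indicator)
  ultimately show "gen_cond_exp_zero P ?J L"
    unfolding gen_cond_exp_zero_def using IK_jump
  proof eventually_elim
    case (elim \<omega>)
    show ?case
    proof
      assume fin: "nn_cond_exp P ?J (\<lambda>\<omega>. ennreal \<bar>L \<omega>\<bar>) \<omega> < \<infinity>"
      show "real_cond_exp P ?J L \<omega> = 0"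
      proof (cases "\<gamma> \<omega> < \<infinity>")
        case True
        \<comment> \<open>Finiteness for \<open>L\<close> passes to \<open>K\<close> and so puts the
          jump time into some \<open>C n\<close>, where centring has been proved.\<close>
        have "nn_cond_exp P ?J (\<lambda>\<omega>. ennreal \<bar>K \<omega> * ?I \<omega>\<bar>) \<omega> < \<infinity>"
          using elim(3) fin by (auto intro: le_less_trans)
        then have pm: "?p (jump \<omega>) < \<infinity>" "?m (jump \<omega>) < \<infinity>"
          using elim(4) True by auto
        then have "?p (jump \<omega>) + ?m (jump \<omega>) < top" by simp
        then obtain n where n: "?p (jump \<omega>) + ?m (jump \<omega>) < of_nat n"
          using ennreal_Ex_less_of_nat by blast
        have "?p (jump \<omega>) \<le> of_nat n" "?m (jump \<omega>) \<le> of_nat n"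
          by (rule order_trans[OF _ less_imp_le[OF n]], simp)+
        then have "jump \<omega> \<in> C n" unfolding C_def by simp
        then show ?thesis using elim(1) True by (auto dest: spec[of _ n])
      next
        case False
        then show ?thesis using elim(2) by simp
      qed
    qed
  qed
qed

end

section \<open>Signed densities and integration by parts\<close>

text \<open>Applied to w and to -w it gives a pair of nonnegative measures whose difference is w dN,
  the form in which signed densities enter the path integrals.\<close>

definition positive_part_measure :: "'b measure \<Rightarrow> ('b \<Rightarrow> real) \<Rightarrow> 'b measure" where
  "positive_part_measure N w = density N (\<lambda>t. ennreal (max 0 (w t)))"

lemma sets_positive_part_measure [simp, measurable_cong]: "sets (positive_part_measure N w) = sets N"
  by (simp add: positive_part_measure_def)

lemma finite_positive_part_measure:
  assumes w: "integrable N w"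
  shows "finite_measure (positive_part_measure N w)"
proof (rule finite_measureI)
  have "emeasure (positive_part_measure N w) (space N) = (\<integral>\<^sup>+t. ennreal (max 0 (w t)) \<partial>N)"
    unfolding positive_part_measure_def
    using w by (subst emeasure_density) (auto intro!: nn_integral_cong)
  also have "\<dots> \<le> (\<integral>\<^sup>+t. ennreal (norm (w t)) \<partial>N)"
    by (intro nn_integral_mono ennreal_leI) auto
  also have "\<dots> < \<infinity>" using w by (simp add: integrable_iff_bounded)
  finally show "emeasure (positive_part_measure N w) (space (positive_part_measure N w)) \<noteq> \<infinity>"
    by (simp add: positive_part_measure_def)
qed

lemma integral_positive_part_measure:
  fixes h w :: "'b \<Rightarrow> real"
  assumes w: "integrable N w" and [measurable]: "h \<in> borel_measurable N" and h: "\<And>t. \<bar>h t\<bar> \<le> 1"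
  shows "(\<integral>t. h t \<partial>positive_part_measure N w) - (\<integral>t. h t \<partial>positive_part_measure N (\<lambda>t. - w t)) = (\<integral>t. w t * h t \<partial>N)"
proof -
  have [measurable]: "w \<in> borel_measurable N" using w by simp
  have int: "integrable N (\<lambda>t. max 0 (\<sigma> * w t) * h t)" for \<sigma>
  proof (rule Bochner_Integration.integrable_bound)
    show "integrable N (\<lambda>t. \<sigma> * w t)" using w by simp
    show "AE t in N. norm (max 0 (\<sigma> * w t) * h t) \<le> norm (\<sigma> * w t)"
    proof (rule AE_I2)
      fix t
      have "\<bar>max 0 (\<sigma> * w t)\<bar> * \<bar>h t\<bar> \<le> \<bar>\<sigma> * w t\<bar> * 1"
        by (intro mult_mono h) auto
      then show "norm (max 0 (\<sigma> * w t) * h t) \<le> norm (\<sigma> * w t)" by (simp add: abs_mult)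
    qed
  qed measurable
  have "(\<integral>t. h t \<partial>positive_part_measure N (\<lambda>t. \<sigma> * w t)) = (\<integral>t. max 0 (\<sigma> * w t) * h t \<partial>N)" for \<sigma>
    unfolding positive_part_measure_def by (subst integral_density) auto
  from this[of 1] this[of "-1"] have
    "(\<integral>t. h t \<partial>positive_part_measure N w) - (\<integral>t. h t \<partial>positive_part_measure N (\<lambda>t. - w t)) =
      (\<integral>t. max 0 (1 * w t) * h t \<partial>N) - (\<integral>t. max 0 (- 1 * w t) * h t \<partial>N)"
    by simp
  also have "\<dots> = (\<integral>t. max 0 (1 * w t) * h t - max 0 (- 1 * w t) * h t \<partial>N)"
    by (rule Bochner_Integration.integral_diff[OF int int, symmetric])
  also have "\<dots> = (\<integral>t. w t * h t \<partial>N)"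
    by (rule Bochner_Integration.integral_cong) (auto simp: max_def algebra_simps)
  finally show ?thesis .
qed

lemma measure_positive_part_measure:
  fixes w :: "'b \<Rightarrow> real"
  assumes w: "integrable N w" and [measurable]: "A \<in> sets N"
  shows "measure (positive_part_measure N w) A - measure (positive_part_measure N (\<lambda>t. - w t)) A = (\<integral>t. w t * indicator A t \<partial>N)"
  using integral_positive_part_measure[OF w, of "indicator A"] by (auto split: split_indicator)

lemma measurable_measure_Ioo [measurable]:
  fixes m :: "real measure"
  assumes "finite_measure m" "sets m = sets borel" "B \<in> sets borel"
  shows "(\<lambda>t. measure m ({0<..<t} \<inter> B)) \<in> borel_measurable borel"
  using assms
  by (intro borel_measurable_mono monoI finite_measure.finite_measure_mono) auto

context single_jump
begin

section \<open>Integration by parts against the jump law\<close>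

lemma integral_jump_law_Ioc:
  fixes h :: "real \<Rightarrow> real"
  assumes [measurable]: "h \<in> borel_measurable borel" and t: "0 \<le> t"
  shows "(\<integral>s. h s * indicator {0<..t} s \<partial>\<nu>) =
    (\<integral>\<omega>. h (jump \<omega>) * indicator {\<omega>. 0 < \<gamma> \<omega> \<and> \<gamma> \<omega> \<le> ennreal t} \<omega> \<partial>P)"
proof -
  have "0 < \<gamma> \<omega> \<and> \<gamma> \<omega> \<le> ennreal t \<longleftrightarrow> \<gamma> \<omega> < \<infinity> \<and> jump \<omega> \<in> {0<..t}" for \<omega>
    unfolding jump_le_iff[OF t] by (auto simp: jump_def enn2real_positive_iff)
  then show ?thesis
    by (subst integral_jump_law, measurable, intro Bochner_Integration.integral_cong)
      (auto simp: indicator_def)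
qed

text \<open>Both sides are the expectation of the \<open>m\<close>-mass of (0,s] \<inter>
  \<open>B\<close> before the jump. Fubini's theorem gives the left-hand side; separating \<gamma> >
  s from \<gamma> \<le> s gives the right-hand side.\<close>

lemma integration_by_parts:
  assumes m: "finite_measure m" "sets m = sets borel" and B: "B \<in> sets borel" and s: "0 \<le> s"
  shows "(\<integral>u. Gbar u * indicator ({0<..s} \<inter> B) u \<partial>m) =
    measure m ({0<..s} \<inter> B) * Gbar s + (\<integral>t. measure m ({0<..<t} \<inter> B) * indicator {0<..s} t \<partial>\<nu>)"
proof -
  interpret m: finite_measure m by (rule m)
  note [measurable] = measurable_measure_Ioo[OF m B]
  have A: "{0<..s} \<inter> B \<in> sets borel" using B by auto
  let ?c = "measure m ({0<..s} \<inter> B)" and ?l = "\<lambda>t. measure m ({0<..<t} \<inter> B)"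
  let ?after = "{\<omega>. 0 < \<gamma> \<omega> \<and> \<gamma> \<omega> \<le> ennreal s}" and ?before = "{\<omega> \<in> space P. ennreal s < \<gamma> \<omega>}"
  have "(\<integral>u. Gbar u * indicator ({0<..s} \<inter> B) u \<partial>m) = (\<integral>\<omega>. measure m ({0<..s} \<inter> B \<inter> {u. ennreal u < \<gamma> \<omega>}) \<partial>P)"
    by (rule expectation_before_jump(1)[OF m A, symmetric])
  also have "\<dots> = (\<integral>\<omega>. ?c * indicator ?before \<omega> + ?l (jump \<omega>) * indicator ?after \<omega> \<partial>P)"
  proof (rule Bochner_Integration.integral_cong[OF refl])
    fix \<omega> assume \<omega>: "\<omega> \<in> space P"
    show "measure m ({0<..s} \<inter> B \<inter> {u. ennreal u < \<gamma> \<omega>}) = ?c * indicator ?before \<omega> + ?l (jump \<omega>) * indicator ?after \<omega>"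
    proof (cases "ennreal s < \<gamma> \<omega>")
      case True
      then have "\<not> \<gamma> \<omega> \<le> ennreal s" by simp
      then show ?thesis using before_jump_eq(1)[OF s True, of B] \<omega> True by simp
    next
      case False
      then have "\<gamma> \<omega> \<le> ennreal s" by simp
      \<comment> \<open>A jump at time 0 lies outside \<open>?after\<close>, which matches the
        half-open interval (0,s]; the mass before the jump is then 0 too.\<close>
      moreover have "{0<..<jump \<omega>} = {}" if "\<gamma> \<omega> = 0" using that by (simp add: jump_def)
      ultimately show ?thesis using before_jump_eq(2)[OF s, of \<omega> B] False \<omega>
        by (cases "\<gamma> \<omega> = 0") (auto simp: zero_less_iff_neq_zero)
    qed
  qed
  also have "\<dots> = (\<integral>\<omega>. ?c * indicator ?before \<omega> \<partial>P) + (\<integral>\<omega>. ?l (jump \<omega>) * indicator ?after \<omega> \<partial>P)"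
  proof (rule Bochner_Integration.integral_add)
    show "integrable P (\<lambda>\<omega>. ?c * indicator ?before \<omega>)"
      by (intro integrable_mult_right integrable_real_indicator) (auto simp: emeasure_eq_measure)
    have [measurable]: "Measurable.pred P (\<lambda>\<omega>. \<omega> \<in> ?after)" by simp
    show "integrable P (\<lambda>\<omega>. ?l (jump \<omega>) * indicator ?after \<omega>)"
      by (rule integrable_const_bound[where B = "measure m (space m)"])
        (auto intro!: AE_I2 m.bounded_measure split: split_indicator)
  qed
  also have "(\<integral>\<omega>. ?l (jump \<omega>) * indicator ?after \<omega> \<partial>P) = (\<integral>t. ?l t * indicator {0<..s} t \<partial>\<nu>)"
    using s by (intro integral_jump_law_Ioc[symmetric]) auto
  finally show ?thesis by (simp add: Gbar_def)
qed

lemma integration_by_parts_density: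
  assumes w: "integrable \<nu> w" and s: "0 \<le> s"
  shows "(\<integral>u. w u * (Gbar u * indicator {0<..s} u) \<partial>\<nu>) =
    (\<integral>u. w u * indicator {0<..s} u \<partial>\<nu>) * Gbar s +
    (\<integral>t. (\<integral>u. w u * indicator {0<..<t} u \<partial>\<nu>) * indicator {0<..s} t \<partial>\<nu>)"
    and "integrable \<nu> (\<lambda>t. (\<integral>u. w u * indicator {0<..<t} u \<partial>\<nu>) * indicator {0<..s} t)"
proof -
  let ?p = "positive_part_measure \<nu> w" and ?n = "positive_part_measure \<nu> (\<lambda>t. - w t)"
  have w': "integrable \<nu> (\<lambda>t. - w t)" using w by simp
  note fin = finite_positive_part_measure[OF w] finite_positive_part_measure[OF w']
  have sets: "sets ?p = sets borel" "sets ?n = sets borel" by simp_all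
  have int: "integrable \<nu> (\<lambda>t. measure m ({0<..<t} \<inter> UNIV) * indicator {0<..s} t)"
    if m: "finite_measure m" "sets m = sets borel" for m
  proof (rule law.integrable_const_bound[where B = "measure m (space m)"])
    show "(\<lambda>t. measure m ({0<..<t} \<inter> UNIV) * indicator {0<..s} t) \<in> borel_measurable \<nu>"
      using measurable_measure_Ioo[OF m, of UNIV] by simp
  qed (auto intro!: AE_I2 finite_measure.bounded_measure[OF m(1)] split: split_indicator)
  have diff: "measure ?p A - measure ?n A = (\<integral>t. w t * indicator A t \<partial>\<nu>)" if "A \<in> sets borel" for A
    using measure_positive_part_measure[OF w] that by simp
  have eq: "(\<lambda>t. (\<integral>u. w u * indicator {0<..<t} u \<partial>\<nu>) * indicator {0<..s} t) =
      (\<lambda>t. measure ?p ({0<..<t} \<inter> UNIV) * indicator {0<..s} t - measure ?n ({0<..<t} \<inter> UNIV) * indicator {0<..s} t)"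
    by (simp add: diff[symmetric] algebra_simps)
  show "integrable \<nu> (\<lambda>t. (\<integral>u. w u * indicator {0<..<t} u \<partial>\<nu>) * indicator {0<..s} t)"
    unfolding eq by (intro Bochner_Integration.integrable_diff int fin sets)
  have "(\<integral>u. w u * (Gbar u * indicator {0<..s} u) \<partial>\<nu>) =
      (\<integral>u. Gbar u * indicator ({0<..s} \<inter> UNIV) u \<partial>?p) - (\<integral>u. Gbar u * indicator ({0<..s} \<inter> UNIV) u \<partial>?n)"
    using Gbar_nonneg Gbar_le_1
    by (subst integral_positive_part_measure[OF w]) (auto simp: abs_mult split: split_indicator)
  also have "\<dots> = (measure ?p {0<..s} - measure ?n {0<..s}) * Gbar s +
      ((\<integral>t. measure ?p ({0<..<t} \<inter> UNIV) * indicator {0<..s} t \<partial>\<nu>) -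
       (\<integral>t. measure ?n ({0<..<t} \<inter> UNIV) * indicator {0<..s} t \<partial>\<nu>))"
    using integration_by_parts[OF fin(1) sets(1) _ s, of UNIV] integration_by_parts[OF fin(2) sets(2) _ s, of UNIV]
    by (simp add: algebra_simps)
  also have "(\<integral>t. measure ?p ({0<..<t} \<inter> UNIV) * indicator {0<..s} t \<partial>\<nu>) -
       (\<integral>t. measure ?n ({0<..<t} \<inter> UNIV) * indicator {0<..s} t \<partial>\<nu>) =
      (\<integral>t. (\<integral>u. w u * indicator {0<..<t} u \<partial>\<nu>) * indicator {0<..s} t \<partial>\<nu>)"
    unfolding eq by (rule Bochner_Integration.integral_diff[symmetric]) (intro int fin sets)+
  finally show "(\<integral>u. w u * (Gbar u * indicator {0<..s} u) \<partial>\<nu>) =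
    (\<integral>u. w u * indicator {0<..s} u \<partial>\<nu>) * Gbar s +
    (\<integral>t. (\<integral>u. w u * indicator {0<..<t} u \<partial>\<nu>) * indicator {0<..s} t \<partial>\<nu>)"
    by (simp add: diff)
qed

text \<open>The balance argument with two zero measures extends the vanishing integrals from
  intervals to all Borel subsets of (0,u], in particular to those where w has one sign.\<close>

lemma AE_zero_of_integrals:
  fixes w :: "real \<Rightarrow> real"
  assumes w: "integrable \<nu> w" and zero: "\<And>s. 0 \<le> s \<Longrightarrow> s \<le> u \<Longrightarrow> (\<integral>t. w t * indicator {0<..s} t \<partial>\<nu>) = 0"
  shows "AE t in \<nu>. t \<in> {0<..u} \<longrightarrow> w t = 0"
proof -
  let ?p = "positive_part_measure \<nu> w" and ?n = "positive_part_measure \<nu> (\<lambda>t. - w t)"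
  have [measurable]: "w \<in> borel_measurable borel"
    using borel_measurable_integrable[OF w] by simp
  have w': "integrable \<nu> (\<lambda>t. - w t)" using w by simp
  have diff: "measure ?p A - measure ?n A = (\<integral>t. w t * indicator A t \<partial>\<nu>)" if "A \<in> sets borel" for A
    using measure_positive_part_measure[OF w] that by simp
  have C: "(\<integral>t. w t * indicator ({0<..u} \<inter> C) t \<partial>\<nu>) = 0" if C: "C \<in> sets borel" for C
  proof -
    have "measure ?p ({0<..u} \<inter> C) + measure (null_measure borel) ({0<..u} \<inter> C) =
        measure ?n ({0<..u} \<inter> C) + measure (null_measure borel) ({0<..u} \<inter> C)"
    proof (rule balanced_measures_on)
      fix s
      consider "u < 0 \<or> s < 0" | "0 \<le> s" "s \<le> u" | "0 \<le> u" "u \<le> s" by linarith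
      then have "measure ?p ({0<..u} \<inter> {..s}) = measure ?n ({0<..u} \<inter> {..s})"
      proof cases
        case 1
        then have "{0<..u} \<inter> {..s} = {}" by auto
        then show ?thesis by simp
      next
        case 2
        then have "{0<..u} \<inter> {..s} = {0<..s}" by auto
        then show ?thesis using diff[of "{0<..s}"] zero[OF 2] by simp
      next
        case 3
        then have "{0<..u} \<inter> {..s} = {0<..u}" by auto
        then show ?thesis using diff[of "{0<..u}"] zero[of u] 3 by simp
      qed
      then show "measure ?p ({0<..u} \<inter> {..s}) + measure (null_measure borel) ({0<..u} \<inter> {..s}) =
        measure ?n ({0<..u} \<inter> {..s}) + measure (null_measure borel) ({0<..u} \<inter> {..s})" by simp
    qed (use C finite_positive_part_measure[OF w] finite_positive_part_measure[OF w']
        in \<open>auto simp: finite_measure.emeasure_eq_measure\<close>)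
    then show ?thesis using diff[of "{0<..u} \<inter> C"] C by simp
  qed
  have *: "AE t in \<nu>. \<not> (t \<in> {0<..u} \<and> 0 < \<sigma> * w t)" for \<sigma>
  proof -
    let ?C = "{0<..u} \<inter> {t. 0 < \<sigma> * w t}"
    have "(\<integral>t. \<sigma> * w t * indicator ?C t \<partial>\<nu>) = 0"
      using C[of "{t. 0 < \<sigma> * w t}"] by (simp add: mult.assoc)
    moreover have "integrable \<nu> (\<lambda>t. \<sigma> * w t * indicator ?C t)"
      using w by (intro integrable_real_mult_indicator integrable_mult_right) auto
    ultimately have "AE t in \<nu>. \<sigma> * w t * indicator ?C t = 0"
      by (subst integral_nonneg_eq_0_iff_AE[symmetric]) (auto intro!: AE_I2 split: split_indicator)
    then show ?thesis by eventually_elim (auto simp: indicator_def split: if_splits)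
  qed
  from *[of 1] *[of "-1"] show ?thesis by eventually_elim (auto simp: not_less)
qed

section \<open>Sufficiency\<close>

lemma measurable_L1_loc:
  assumes "z \<in> L1_loc P \<gamma>"
  shows "(\<lambda>t. indicator (jump_times P \<gamma>) t * z t) \<in> borel_measurable borel"
  using assms by (simp add: L1_loc_def set_borel_measurable_def)

lemma integrable_L1_loc:
  assumes z: "z \<in> L1_loc P \<gamma>" and u: "u \<in> jump_times P \<gamma>"
  shows "integrable \<nu> (\<lambda>t. (indicator (jump_times P \<gamma>) t * z t) * indicator {0<..u} t)"
proof -
  have eq: "(indicator {0..u} t *\<^sub>R z t) * indicator {0<..} t =
      (indicator (jump_times P \<gamma>) t * z t) * indicator {0<..u} t" for t
    using jump_times_downward[OF u, of t] by (auto split: split_indicator)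
  have "integrable \<nu> (\<lambda>t. (indicator {0..u} t *\<^sub>R z t) * indicator {0<..} t)"
    using z u by (intro integrable_real_mult_indicator) (auto simp: L1_loc_def set_integrable_def)
  then show ?thesis unfolding eq .
qed

lemma set_integral_L1_loc:
  fixes z :: "real \<Rightarrow> real"
  assumes "0 \<le> u" "ennreal u < jump_end P \<gamma>"
  shows "set_lebesgue_integral \<nu> {0<..u} z = (\<integral>t. (indicator (jump_times P \<gamma>) t * z t) * indicator {0<..u} t \<partial>\<nu>)"
  unfolding set_lebesgue_integral_def
  using jump_times_downward[OF jump_times_below_end[OF assms]]
  by (intro Bochner_Integration.integral_cong) (auto split: split_indicator)

lemma integral_Ioc_tendsto:
  fixes w :: "real \<Rightarrow> real"
  assumes w: "integrable \<nu> w"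
  shows "((\<lambda>s. \<integral>t. w t * indicator {0<..s} t \<partial>\<nu>) \<longlongrightarrow> (\<integral>t. w t * indicator {0<..<u} t \<partial>\<nu>)) (at_left u)"
proof -
  have w': "integrable \<nu> (\<lambda>t. - w t)" using w by simp
  show ?thesis
    using tendsto_diff[OF measure_Ioo_tendsto[of "positive_part_measure \<nu> w" u]
        measure_Ioo_tendsto[of "positive_part_measure \<nu> (\<lambda>t. - w t)" u]]
      finite_positive_part_measure[OF w] finite_positive_part_measure[OF w']
    by (simp add: measure_positive_part_measure[OF w] finite_measure.emeasure_eq_measure)
qed

text \<open>Differentiating the product in Condition M gives \<open>z(t) P(\<gamma> > t) = F(t-) - H(t)\<close> for the
  density \<open>z\<close> of \<open>F\<close>.\<close>

lemma condition_M_density: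
  assumes M: "condition_M P \<gamma> F H"
  obtains z where "z \<in> borel_measurable borel"
    "\<And>u. u \<in> jump_times P \<gamma> \<Longrightarrow> integrable \<nu> (\<lambda>t. z t * indicator {0<..u} t)"
    "\<And>t. 0 \<le> t \<Longrightarrow> ennreal t < jump_end P \<gamma> \<Longrightarrow> F t = F 0 + (\<integral>s. z s * indicator {0<..t} s \<partial>\<nu>)"
    "AE t in \<nu>. t \<in> jump_times P \<gamma> \<longrightarrow> 0 < t \<longrightarrow> z t * Gbar t = F 0 + (\<integral>s. z s * indicator {0<..<t} s \<partial>\<nu>) - H t"
proof -
  from M obtain z0 where z0: "z0 \<in> L1_loc P \<gamma>"
    and F: "\<And>t. 0 \<le> t \<Longrightarrow> ennreal t < jump_end P \<gamma> \<Longrightarrow> F t = F 0 + set_lebesgue_integral \<nu> {0<..t} z0"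
    and H: "H \<in> L1_loc P \<gamma>"
    and eq: "\<And>t. 0 \<le> t \<Longrightarrow> ennreal t < jump_end P \<gamma> \<Longrightarrow>
      F t * (1 - jump_cdf P \<gamma> t) + set_lebesgue_integral \<nu> {0<..t} H = F 0 * (1 - jump_cdf P \<gamma> 0)"
    and B: "case_B P \<gamma> \<Longrightarrow> (F \<longlongrightarrow> H (enn2real (jump_end P \<gamma>))) (at_left (enn2real (jump_end P \<gamma>)))"
    unfolding condition_M_def loc_abs_cont_def by blast
  define z where "z t = indicator (jump_times P \<gamma>) t * z0 t" for t
  define h where "h t = indicator (jump_times P \<gamma>) t * H t" for t
  have z [measurable]: "z \<in> borel_measurable borel"
    unfolding z_def using measurable_L1_loc[OF z0] .
  have h [measurable]: "h \<in> borel_measurable borel"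
    unfolding h_def using measurable_L1_loc[OF H] .
  have z_int: "integrable \<nu> (\<lambda>t. z t * indicator {0<..u} t)"
    and h_int: "integrable \<nu> (\<lambda>t. h t * indicator {0<..u} t)" if "u \<in> jump_times P \<gamma>" for u
    unfolding z_def h_def using integrable_L1_loc[OF z0 that] integrable_L1_loc[OF H that] .
  have F_z: "F t = F 0 + (\<integral>s. z s * indicator {0<..t} s \<partial>\<nu>)"
    and eq_h: "F t * Gbar t + (\<integral>s. h s * indicator {0<..t} s \<partial>\<nu>) = F 0 * Gbar 0"
    if "0 \<le> t" "ennreal t < jump_end P \<gamma>" for t
    using F[OF that] eq[OF that] that unfolding z_def h_def
    by (simp_all add: set_integral_L1_loc jump_cdf_eq)
  define Fl where "Fl t = F 0 + (\<integral>s. z s * indicator {0<..<t} s \<partial>\<nu>)" for t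
  have local: "AE t in \<nu>. t \<in> {0<..u} \<longrightarrow> z t * Gbar t = Fl t - H t"
    if u: "0 \<le> u" "ennreal u < jump_end P \<gamma>" for u
  proof -
    have uT: "u \<in> jump_times P \<gamma>" using jump_times_below_end[OF u] .
    define zu where "zu t = z t * indicator {0<..u} t" for t
    have zu: "integrable \<nu> zu" unfolding zu_def using z_int[OF uT] .
    let ?l = "\<lambda>t. \<integral>s. zu s * indicator {0<..<t} s \<partial>\<nu>"
    have l: "?l t = Fl t - F 0" if "t \<in> {0<..u}" for t
    proof -
      have "?l t = (\<integral>s. z s * indicator {0<..<t} s \<partial>\<nu>)"
        using that unfolding zu_def
        by (intro Bochner_Integration.integral_cong) (auto split: split_indicator)
      then show ?thesis by (simp add: Fl_def)
    qed
    let ?a = "\<lambda>s t. zu t * (Gbar t * indicator {0<..s} t)" and ?b = "\<lambda>s t. ?l t * indicator {0<..s} t"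
      and ?c = "\<lambda>s t. F 0 * indicator {0<..s} t" and ?d = "\<lambda>s t. h t * indicator {0<..s} t"
    \<comment> \<open>By parts, (F(s) - F(0)) Gbar(s) is the integral of \<open>?a s\<close> -
      \<open>?b s\<close>. Hence the equation of Condition M says that w has integral 0 over every
      (0,s] with s \<le> u.\<close>
    define w where "w t = ?a u t - ?b u t - ?c u t + ?d u t" for t
    have int_a: "integrable \<nu> (?a s)" for s
    proof (rule Bochner_Integration.integrable_bound[OF zu])
      show "AE t in \<nu>. norm (?a s t) \<le> norm (zu t)"
        using Gbar_nonneg Gbar_le_1
        by (auto intro!: AE_I2 simp: abs_mult mult_left_le split: split_indicator)
    qed (use borel_measurable_integrable[OF zu] in simp)
    have int_b: "integrable \<nu> (?b s)" if "0 \<le> s" for s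
      using integration_by_parts_density(2)[OF zu that] .
    have int_c: "integrable \<nu> (?c s)" for s
      by (intro integrable_mult_right integrable_real_indicator) (auto simp: law.emeasure_eq_measure)
    have int_d: "integrable \<nu> (?d s)" if "0 \<le> s" "s \<le> u" for s
      using h_int[OF jump_times_downward[OF uT that]] .
    have w_int: "integrable \<nu> w"
      unfolding w_def[abs_def]
      by (intro Bochner_Integration.integrable_add Bochner_Integration.integrable_diff int_a int_b int_c int_d u order_refl)
    have zero: "(\<integral>t. w t * indicator {0<..s} t \<partial>\<nu>) = 0" if s: "0 \<le> s" "s \<le> u" for s
    proof -
      have s_end: "ennreal s < jump_end P \<gamma>"
        using ennreal_leI[OF s(2)] u(2) by (rule le_less_trans)
      have "(\<integral>t. w t * indicator {0<..s} t \<partial>\<nu>) = (\<integral>t. ?a s t - ?b s t - ?c s t + ?d s t \<partial>\<nu>)"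
        using s by (intro Bochner_Integration.integral_cong) (auto simp: w_def split: split_indicator)
      also have "\<dots> = (\<integral>t. ?a s t \<partial>\<nu>) - (\<integral>t. ?b s t \<partial>\<nu>) - (\<integral>t. ?c s t \<partial>\<nu>) + (\<integral>t. ?d s t \<partial>\<nu>)"
        using int_a[of s] int_b[OF s(1)] int_c[of s] int_d[OF s]
        by (simp only: Bochner_Integration.integral_add Bochner_Integration.integral_diff
            Bochner_Integration.integrable_diff)
      also have "(\<integral>t. ?a s t \<partial>\<nu>) - (\<integral>t. ?b s t \<partial>\<nu>) = (F s - F 0) * Gbar s"
      proof -
        have "(\<integral>t. zu t * indicator {0<..s} t \<partial>\<nu>) = (\<integral>t. z t * indicator {0<..s} t \<partial>\<nu>)"
          using s unfolding zu_def
          by (intro Bochner_Integration.integral_cong) (auto split: split_indicator)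
        then show ?thesis
          using integration_by_parts_density(1)[OF zu s(1)] F_z[OF s(1) s_end] by simp
      qed
      also have "(\<integral>t. ?c s t \<partial>\<nu>) = F 0 * (Gbar 0 - Gbar s)"
        using s by (simp add: measure_jump_law_Ioc)
      also have "(\<integral>t. ?d s t \<partial>\<nu>) = F 0 * Gbar 0 - F s * Gbar s"
        using eq_h[OF s(1) s_end] by simp
      finally show ?thesis by (simp add: algebra_simps)
    qed
    have "AE t in \<nu>. t \<in> {0<..u} \<longrightarrow> w t = 0"
      by (rule AE_zero_of_integrals[OF w_int zero])
    then show ?thesis
    proof eventually_elim
      case (elim t)
      show ?case
      proof
        assume t: "t \<in> {0<..u}"
        then have "t \<in> jump_times P \<gamma>" using jump_times_downward[OF uT, of t] by auto
        then show "z t * Gbar t = Fl t - H t"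
          using elim t l[OF t] by (simp add: w_def zu_def h_def)
      qed
    qed
  qed
  \<comment> \<open>Rational endpoints below the end combine the exceptional sets into one null set.
    They cover all times except a possible atom at the end.\<close>
  have "AE t in \<nu>. \<forall>u\<in>\<rat>. 0 \<le> u \<longrightarrow> ennreal u < jump_end P \<gamma> \<longrightarrow> t \<in> {0<..u} \<longrightarrow> z t * Gbar t = Fl t - H t"
    using local by (auto simp: AE_ball_countable countable_rat AE_impI)
  then have "AE t in \<nu>. t \<in> jump_times P \<gamma> \<longrightarrow> 0 < t \<longrightarrow> z t * Gbar t = Fl t - H t"
  proof eventually_elim
    case (elim t)
    show ?case
    proof (intro impI)
      assume t: "t \<in> jump_times P \<gamma>" "0 < t"
      show "z t * Gbar t = Fl t - H t"
      proof (cases "ennreal t < jump_end P \<gamma>")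
        case True
        then have "0 < Gbar t" using less_jump_end_iff[of t] t by simp
        have "\<exists>r>t. ennreal r < jump_end P \<gamma>"
        proof -
          obtain y where y: "ennreal t < y" "y < jump_end P \<gamma>" using dense[OF True] by blast
          then show ?thesis
            by (intro exI[of _ "enn2real y"]) (cases y; auto simp: ennreal_less_iff t less_imp_le)
        qed
        then obtain r where r: "t < r" "ennreal r < jump_end P \<gamma>" by blast
        obtain q where q: "q \<in> \<rat>" "t < q" "q < r" using Rats_dense_in_real[OF r(1)] by blast
        have "ennreal q \<le> ennreal r" using q by (intro ennreal_leI) simp
        then have "ennreal q < jump_end P \<gamma>" using r(2) by (rule le_less_trans)
        then show ?thesis using elim q t by auto
      next
        case False
        \<comment> \<open>At the atom of Case B the claim reads 0 = F(t-) - H(t). It cannot be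
          obtained from earlier times and is supplied by the limit in Condition M.\<close>
        note * = jump_times_end[OF t(1) False]
        have end_t: "enn2real (jump_end P \<gamma>) = t" using *(1) t by simp
        have "Gbar t = 0"
          using False less_jump_end_iff[of t] t Gbar_nonneg[of t] by auto
        moreover have "Fl t = H t"
        proof (rule tendsto_unique[OF trivial_limit_at_left_real])
          show "(F \<longlongrightarrow> H t) (at_left t)" using B[OF *(2)] unfolding end_t .
          let ?zt = "\<lambda>s. z s * indicator {0<..t} s"
          have "((\<lambda>s. F 0 + (\<integral>r. ?zt r * indicator {0<..s} r \<partial>\<nu>)) \<longlongrightarrow>
              F 0 + (\<integral>r. ?zt r * indicator {0<..<t} r \<partial>\<nu>)) (at_left t)"
            by (intro tendsto_add tendsto_const integral_Ioc_tendsto z_int t)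
          moreover have "(\<integral>r. ?zt r * indicator {0<..<t} r \<partial>\<nu>) = (\<integral>r. z r * indicator {0<..<t} r \<partial>\<nu>)"
            by (intro Bochner_Integration.integral_cong) (auto split: split_indicator)
          moreover have "eventually (\<lambda>s. F 0 + (\<integral>r. ?zt r * indicator {0<..s} r \<partial>\<nu>) = F s) (at_left t)"
            using eventually_at_left_real[OF t(2)]
          proof eventually_elim
            case (elim s)
            have "(\<integral>r. ?zt r * indicator {0<..s} r \<partial>\<nu>) = (\<integral>r. z r * indicator {0<..s} r \<partial>\<nu>)"
              using elim by (intro Bochner_Integration.integral_cong) (auto split: split_indicator)
            then show ?case
              using F_z[of s] less_jump_end_of_less_jump_time[OF t(1), of s] elim by simp
          qed
          ultimately show "(F \<longlongrightarrow> Fl t) (at_left t)"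
            unfolding Fl_def by (auto intro: Lim_transform_eventually)
        qed
        ultimately show ?thesis by simp
      qed
    qed
  qed
  then show thesis
    using that[OF z z_int F_z] by (simp add: Fl_def)
qed

lemma uniformly_integrable_dominated:
  assumes Z: "integrable P Z" and le: "\<And>t \<omega>. 0 \<le> t \<Longrightarrow> \<omega> \<in> space P \<Longrightarrow> \<bar>Y t \<omega>\<bar> \<le> Z \<omega>"
  shows "uniformly_integrable P Y"
  unfolding uniformly_integrable_def
proof (intro allI impI)
  fix e :: real assume e: "0 < e"
  have [measurable]: "Z \<in> borel_measurable P" using Z by simp
  let ?T = "\<lambda>n \<omega>. Z \<omega> * indicator {\<omega>. Z \<omega> > real n} \<omega>"
  have int: "integrable P (?T n)" for n
    by (rule Bochner_Integration.integrable_bound[OF Z]) (auto split: split_indicator)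
  have "(\<lambda>n. \<integral>\<omega>. ?T n \<omega> \<partial>P) \<longlonglongrightarrow> (\<integral>\<omega>. 0 \<partial>P)"
  proof (rule integral_dominated_convergence[where w = "\<lambda>\<omega>. \<bar>Z \<omega>\<bar>"])
    show "AE \<omega> in P. (\<lambda>n. ?T n \<omega>) \<longlonglongrightarrow> 0"
    proof (rule AE_I2)
      fix \<omega>
      obtain N where N: "Z \<omega> \<le> real N" using real_arch_simple by blast
      have "eventually (\<lambda>n. ?T n \<omega> = 0) sequentially"
        using eventually_ge_at_top[of N] by eventually_elim (use N in auto)
      then show "(\<lambda>n. ?T n \<omega>) \<longlonglongrightarrow> 0" by (rule tendsto_eventually)
    qed
    show "AE \<omega> in P. norm (?T n \<omega>) \<le> \<bar>Z \<omega>\<bar>" for n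
      by (auto intro!: AE_I2 split: split_indicator)
  qed (use Z in auto)
  then have "eventually (\<lambda>n. (\<integral>\<omega>. ?T n \<omega> \<partial>P) < e) sequentially"
    using e by (intro order_tendstoD(2)) auto
  then obtain n where n: "(\<integral>\<omega>. ?T n \<omega> \<partial>P) < e" by (auto simp: eventually_sequentially)
  show "\<exists>c. \<forall>t\<ge>0. (\<integral>\<^sup>+\<omega>. ennreal \<bar>Y t \<omega>\<bar> * indicator {\<omega>. \<bar>Y t \<omega>\<bar> > c} \<omega> \<partial>P) \<le> ennreal e"
  proof (intro exI[of _ "real n"] allI impI)
    fix t :: real assume t: "0 \<le> t"
    have "(\<integral>\<^sup>+\<omega>. ennreal \<bar>Y t \<omega>\<bar> * indicator {\<omega>. \<bar>Y t \<omega>\<bar> > real n} \<omega> \<partial>P) \<le> (\<integral>\<^sup>+\<omega>. ennreal (?T n \<omega>) \<partial>P)"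
    proof (rule nn_integral_mono)
      fix \<omega> assume "\<omega> \<in> space P"
      from le[OF t this] show "ennreal \<bar>Y t \<omega>\<bar> * indicator {\<omega>. \<bar>Y t \<omega>\<bar> > real n} \<omega> \<le> ennreal (?T n \<omega>)"
        by (auto intro: ennreal_leI split: split_indicator)
    qed
    also have "\<dots> = ennreal (\<integral>\<omega>. ?T n \<omega> \<partial>P)"
      by (rule nn_integral_eq_integral[OF int]) (auto intro!: AE_I2 split: split_indicator)
    also have "\<dots> \<le> ennreal e" using n by (intro ennreal_leI) simp
    finally show "(\<integral>\<^sup>+\<omega>. ennreal \<bar>Y t \<omega>\<bar> * indicator {\<omega>. \<bar>Y t \<omega>\<bar> > real n} \<omega> \<partial>P) \<le> ennreal e" .
  qed
qed

text \<open>Once its paths have finite variation, an adapted process is a semimartingale with 0 as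
  its local martingale part.\<close>

lemma local_martingale_zero: "local_martingale P \<F> (\<lambda>_ _. 0)"
proof -
  have "martingale P \<F> (\<lambda>_ _. 0)"
    by (rule martingaleI[where e = 0]) (auto simp: adapted_def)
  moreover have "uniformly_integrable P (\<lambda>_ _. 0)"
    by (rule uniformly_integrable_dominated[of "\<lambda>_. 0"]) auto
  moreover have "stopped (\<lambda>_ _. 0) T = (\<lambda>_ _. 0)" for T :: "'a \<Rightarrow> ennreal"
    by (auto simp: stopped_def fun_eq_iff)
  moreover have "stopping_time \<F> (\<lambda>_. \<infinity>)"
    by (auto simp: stopping_time_def)
  ultimately show ?thesis
    unfolding local_martingale_def ui_martingale_def
    by (auto simp: adapted_def cadlag_path_def right_cont_path_def incseq_def intro!: exI[of _ "\<lambda>_ _. \<infinity>"])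
qed

lemma integral_Ioc_increment_le:
  fixes w :: "real \<Rightarrow> real"
  assumes w: "integrable \<nu> w" and st: "s \<le> t"
  shows "\<bar>(\<integral>r. w r * indicator {0<..t} r \<partial>\<nu>) - (\<integral>r. w r * indicator {0<..s} r \<partial>\<nu>)\<bar> \<le>
    (\<integral>r. \<bar>w r\<bar> * indicator {0<..t} r \<partial>\<nu>) - (\<integral>r. \<bar>w r\<bar> * indicator {0<..s} r \<partial>\<nu>)"
proof -
  let ?A = "{0<..t} - {0<..s}"
  have int: "integrable \<nu> (\<lambda>r. v r * indicator A r)" if "integrable \<nu> v" "A \<in> sets borel" for v :: "real \<Rightarrow> real" and A
    using that by (intro integrable_real_mult_indicator) auto
  have diff: "(\<integral>r. v r * indicator {0<..t} r \<partial>\<nu>) - (\<integral>r. v r * indicator {0<..s} r \<partial>\<nu>) = (\<integral>r. v r * indicator ?A r \<partial>\<nu>)"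
    if v: "integrable \<nu> v" for v :: "real \<Rightarrow> real"
    by (subst Bochner_Integration.integral_diff[symmetric])
      (use st in \<open>auto intro!: int v Bochner_Integration.integral_cong split: split_indicator\<close>)
  have abs: "integrable \<nu> (\<lambda>r. \<bar>w r\<bar>)" using w by simp
  have "\<bar>\<integral>r. w r * indicator ?A r \<partial>\<nu>\<bar> \<le> (\<integral>r. \<bar>w r * indicator ?A r\<bar> \<partial>\<nu>)"
    by (rule integral_abs_bound)
  also have "\<dots> = (\<integral>r. \<bar>w r\<bar> * indicator ?A r \<partial>\<nu>)" by (simp add: abs_mult)
  finally show ?thesis unfolding diff[OF w] diff[OF abs] .
qed

text \<open>The integrals are written down first: a deterministic density before the jump plus a
  jump term \<open>J n\<close>. In their expectation the two contributions cancel by z(t) Gbar(t) +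
  H(t) - F(t-) = 0, so they are martingales; that they are the pathwise integrals is verified
  afterwards.\<close>

lemma sigma_martingale_if_representation:
  fixes M :: "real \<Rightarrow> 'a \<Rightarrow> real"
  assumes adapted: "adapted \<F> M" and rc: "\<And>\<omega>. \<omega> \<in> space P \<Longrightarrow> right_cont_path (\<lambda>t. M t \<omega>)"
    and FH: "condition_M P \<gamma> F H" and L [measurable]: "L \<in> borel_measurable P"
    and L_fin: "AE \<omega> in P. nn_cond_exp P (jump_sigma P \<gamma>)
      (\<lambda>\<omega>. ennreal \<bar>L \<omega>\<bar> * indicator {\<omega>. \<gamma> \<omega> > 0} \<omega>) \<omega> < \<infinity>"
    and L_zero: "gen_cond_exp_zero P (jump_sigma P \<gamma>) L"
    and repr: "AE \<omega> in P. \<forall>t\<ge>0. M t \<omega> = F t * indicator {\<omega>. ennreal t < \<gamma> \<omega>} \<omega>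
      + (H (enn2real (\<gamma> \<omega>)) + L \<omega>) * indicator {\<omega>. \<gamma> \<omega> \<le> ennreal t} \<omega>"
  shows "sigma_martingale P \<F> M"
proof -
  obtain z where z [measurable]: "z \<in> borel_measurable borel"
    and z_int: "\<And>u. u \<in> jump_times P \<gamma> \<Longrightarrow> integrable \<nu> (\<lambda>t. z t * indicator {0<..u} t)"
    and F_z: "\<And>t. 0 \<le> t \<Longrightarrow> ennreal t < jump_end P \<gamma> \<Longrightarrow> F t = F 0 + (\<integral>s. z s * indicator {0<..t} s \<partial>\<nu>)"
    and z_eq: "AE t in \<nu>. t \<in> jump_times P \<gamma> \<longrightarrow> 0 < t \<longrightarrow>
      z t * Gbar t = F 0 + (\<integral>s. z s * indicator {0<..<t} s \<partial>\<nu>) - H t"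
    using condition_M_density[OF FH] by blast
  obtain l :: "real \<Rightarrow> real" where l [measurable]: "l \<in> borel_measurable borel"
    and L_int: "\<And>B c. B \<in> sets borel \<Longrightarrow> B \<subseteq> {0<..} \<Longrightarrow> (\<And>t. t \<in> B \<Longrightarrow> l t \<le> c) \<Longrightarrow>
      integrable P (\<lambda>\<omega>. L \<omega> * (indicator B (jump \<omega>) * indicator finite_jump \<omega>))"
    and L_exp: "\<And>B c. B \<in> sets borel \<Longrightarrow> B \<subseteq> {0<..} \<Longrightarrow> (\<And>t. t \<in> B \<Longrightarrow> l t \<le> c) \<Longrightarrow>
      (\<integral>\<omega>. L \<omega> * (indicator B (jump \<omega>) * indicator finite_jump \<omega>) \<partial>P) = 0"
    using centred_given_jump[OF L L_fin L_zero] by blast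
  obtain u :: "nat \<Rightarrow> real" where u_inc: "incseq u" and u: "\<And>n. u n \<in> jump_times P \<gamma>"
    and u_cover: "\<And>t. t \<in> jump_times P \<gamma> \<Longrightarrow> \<exists>n. t \<le> u n"
    using jump_times_sequence by blast
  have H_L1: "H \<in> L1_loc P \<gamma>" using FH by (simp add: condition_M_def)
  define h where "h t = indicator (jump_times P \<gamma>) t * H t" for t
  have h [measurable]: "h \<in> borel_measurable borel"
    unfolding h_def using measurable_L1_loc[OF H_L1] .
  have h_int: "integrable \<nu> (\<lambda>t. h t * indicator {0<..u n} t)" for n
    unfolding h_def using integrable_L1_loc[OF H_L1 u] .
  define Fl where "Fl t = F 0 + (\<integral>s. z s * indicator {0<..<t} s \<partial>\<nu>)" for t
  have eq: "AE t in \<nu>. t \<in> jump_times P \<gamma> \<longrightarrow> 0 < t \<longrightarrow> z t * Gbar t = Fl t - h t"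
    using z_eq by eventually_elim (simp add: Fl_def h_def)
  \<comment> \<open>The bound on \<open>l\<close> makes \<open>L\<close> integrable over jump times
    in \<open>D n\<close>, while u n keeps z, h and \<open>Fl\<close> integrable.\<close>
  define D where "D n = {t. 0 < t \<and> t \<le> u n \<and> l t \<le> real n}" for n
  have D [measurable]: "D n \<in> sets borel" for n unfolding D_def by measurable
  have D_sub: "D n \<subseteq> {0<..u n}" "D n \<subseteq> {0<..}" for n by (auto simp: D_def)
  have D_times: "t \<in> jump_times P \<gamma>" if "t \<in> D n" for t n
    using that jump_times_downward[OF u[of n], of t] by (auto simp: D_def)
  define w where "w n t = z t * indicator (D n) t" for n t
  have w_int: "integrable \<nu> (w n)" for n
  proof -
    have "integrable \<nu> (\<lambda>t. (z t * indicator {0<..u n} t) * indicator (D n) t)"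
      by (rule integrable_real_mult_indicator[OF _ z_int[OF u]]) simp
    moreover have "(z t * indicator {0<..u n} t) * indicator (D n) t = w n t" for t
      by (auto simp: w_def D_def split: split_indicator)
    ultimately show ?thesis by simp
  qed
  have Fl_int: "integrable \<nu> (\<lambda>t. Fl t * indicator {0<..u n} t)" for n
  proof -
    have "integrable \<nu> (\<lambda>t. F 0 * indicator {0<..u n} t +
        (\<integral>s. (z s * indicator {0<..u n} s) * indicator {0<..<t} s \<partial>\<nu>) * indicator {0<..u n} t)"
      using integration_by_parts_density(2)[OF z_int[OF u] jump_times_nonneg[OF u]]
      by (intro Bochner_Integration.integrable_add integrable_mult_right integrable_real_indicator)
        (auto simp: law.emeasure_eq_measure)
    moreover have "F 0 * indicator {0<..u n} t +
        (\<integral>s. (z s * indicator {0<..u n} s) * indicator {0<..<t} s \<partial>\<nu>) * indicator {0<..u n} t =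
        Fl t * indicator {0<..u n} t" for t
    proof (cases "t \<in> {0<..u n}")
      case True
      then have "(\<integral>s. (z s * indicator {0<..u n} s) * indicator {0<..<t} s \<partial>\<nu>) = (\<integral>s. z s * indicator {0<..<t} s \<partial>\<nu>)"
        by (intro Bochner_Integration.integral_cong) (auto split: split_indicator)
      then show ?thesis using True by (simp add: Fl_def)
    qed simp
    ultimately show ?thesis by simp
  qed
  \<comment> \<open>H(t) - F(t-) is the jump of the process at a jump time t > 0 apart from its
    centred part \<open>L\<close>.\<close>
  define v where "v n t = (h t - Fl t) * indicator (D n) t" for n t
  have v_int: "integrable \<nu> (v n)" for n
  proof -
    have "integrable \<nu> (\<lambda>t. (h t * indicator {0<..u n} t - Fl t * indicator {0<..u n} t) * indicator (D n) t)"
      by (rule integrable_real_mult_indicator[OF _ Bochner_Integration.integrable_diff[OF h_int Fl_int]]) simp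
    moreover have "(h t * indicator {0<..u n} t - Fl t * indicator {0<..u n} t) * indicator (D n) t = v n t" for t
      by (auto simp: v_def D_def split: split_indicator)
    ultimately show ?thesis by simp
  qed
  have v [measurable]: "v n \<in> borel_measurable borel" for n
    using borel_measurable_integrable[OF v_int[of n]] by simp
  have wv: "AE t in \<nu>. w n t * Gbar t + v n t = 0" for n
    using eq by eventually_elim (use D_times[of _ n] D_sub(2)[of n] in \<open>auto simp: w_def v_def split: split_indicator\<close>)
  define J where "J n \<omega> = v n (jump \<omega>) * indicator finite_jump \<omega>
      + L \<omega> * (indicator (D n) (jump \<omega>) * indicator finite_jump \<omega>)" for n \<omega>
  let ?after = "\<lambda>t. {\<omega> \<in> space P. \<gamma> \<omega> \<le> ennreal t}"
  let ?past = "\<lambda>t \<omega>. {0<..t} \<inter> {r. ennreal r < \<gamma> \<omega>}"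
  \<comment> \<open>The set \<open>?past\<close> stops at the jump, and \<open>J n\<close> enters at
    and after it. So constancy after the jump and a deterministic value before it are built
    in.\<close>
  define Y where "Y n t \<omega> = (\<integral>s. w n s * indicator (?past t \<omega>) s \<partial>\<nu>) + J n \<omega> * indicator (?after t) \<omega>" for n t \<omega>
  let ?p = "\<lambda>n. positive_part_measure \<nu> (w n)" and ?q = "\<lambda>n. positive_part_measure \<nu> (\<lambda>t. - w n t)"
  have w_int': "integrable \<nu> (\<lambda>t. - w n t)" for n using w_int by simp
  have fin: "finite_measure (?p n)" "finite_measure (?q n)" for n
    using finite_positive_part_measure[OF w_int] finite_positive_part_measure[OF w_int'] .
  have w_meas: "(\<integral>s. w n s * indicator A s \<partial>\<nu>) = measure (?p n) A - measure (?q n) A" if "A \<in> sets borel" for n A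
    using measure_positive_part_measure[OF w_int[of n], of A] that by simp
  have past_sets: "?past t \<omega> \<in> sets borel" for t \<omega> by measurable
  have past_before: "?past t \<omega> = {0<..t}" if "0 \<le> t" "ennreal t < \<gamma> \<omega>" for t \<omega>
    using before_jump_eq(1)[OF that, of UNIV] by simp
  have past_after: "?past t \<omega> = {0<..<jump \<omega>}" if "0 \<le> t" "\<gamma> \<omega> \<le> ennreal t" for t \<omega>
    using before_jump_eq(2)[OF that, of UNIV] by simp
  have J_int: "integrable P (J n)" for n
  proof -
    have "integrable P (\<lambda>\<omega>. v n (jump \<omega>) * indicator finite_jump \<omega>)"
      using v_int[of n] integrable_jump_law_iff[OF v] by simp
    moreover have "integrable P (\<lambda>\<omega>. L \<omega> * (indicator (D n) (jump \<omega>) * indicator finite_jump \<omega>))"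
      by (rule L_int[OF D D_sub(2), of n "real n"]) (simp add: D_def)
    ultimately show ?thesis
      unfolding J_def[abs_def] by (rule Bochner_Integration.integrable_add)
  qed
  have J_meas [measurable]: "J n \<in> borel_measurable P" for n using J_int by simp
  have Y_int1: "integrable P (\<lambda>\<omega>. \<integral>s. w n s * indicator (?past t \<omega>) s \<partial>\<nu>)" for n t
    unfolding w_meas[OF past_sets]
    using expectation_before_jump(2)[OF fin(1)[of n], of "{0<..t}"] expectation_before_jump(2)[OF fin(2)[of n], of "{0<..t}"]
    by (intro Bochner_Integration.integrable_diff) auto
  have Y_int2: "integrable P (\<lambda>\<omega>. J n \<omega> * indicator (?after t) \<omega>)" for n t
    by (intro integrable_real_mult_indicator J_int) measurable
  have Y_int: "integrable P (Y n t)" for n t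
    unfolding Y_def[abs_def] by (intro Bochner_Integration.integrable_add Y_int1 Y_int2)
  have Y_exp: "expectation (Y n t) = 0" if t: "0 \<le> t" for n t
  proof -
    have "expectation (Y n t) = (\<integral>\<omega>. (\<integral>s. w n s * indicator (?past t \<omega>) s \<partial>\<nu>) \<partial>P) + (\<integral>\<omega>. J n \<omega> * indicator (?after t) \<omega> \<partial>P)"
      unfolding Y_def by (rule Bochner_Integration.integral_add[OF Y_int1 Y_int2])
    also have "(\<integral>\<omega>. (\<integral>s. w n s * indicator (?past t \<omega>) s \<partial>\<nu>) \<partial>P) = (\<integral>r. w n r * (Gbar r * indicator {0<..t} r) \<partial>\<nu>)"
    proof -
      have "(\<integral>\<omega>. (\<integral>s. w n s * indicator (?past t \<omega>) s \<partial>\<nu>) \<partial>P) =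
          (\<integral>\<omega>. measure (?p n) (?past t \<omega>) \<partial>P) - (\<integral>\<omega>. measure (?q n) (?past t \<omega>) \<partial>P)"
        unfolding w_meas[OF past_sets]
        using expectation_before_jump(2)[OF fin(1)[of n], of "{0<..t}"] expectation_before_jump(2)[OF fin(2)[of n], of "{0<..t}"]
        by (intro Bochner_Integration.integral_diff) auto
      also have "\<dots> = (\<integral>r. Gbar r * indicator {0<..t} r \<partial>?p n) - (\<integral>r. Gbar r * indicator {0<..t} r \<partial>?q n)"
        using expectation_before_jump(1)[OF fin(1)[of n], of "{0<..t}"] expectation_before_jump(1)[OF fin(2)[of n], of "{0<..t}"]
        by simp
      also have "\<dots> = (\<integral>r. w n r * (Gbar r * indicator {0<..t} r) \<partial>\<nu>)"
        using Gbar_nonneg Gbar_le_1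
        by (intro integral_positive_part_measure[OF w_int]) (auto simp: abs_mult split: split_indicator)
      finally show ?thesis .
    qed
    also have "(\<integral>\<omega>. J n \<omega> * indicator (?after t) \<omega> \<partial>P) = (\<integral>r. v n r * indicator {0<..t} r \<partial>\<nu>)"
    proof -
      \<comment> \<open>The centred part \<open>L\<close> also has mean 0 over jump times up to t,
        since the bound on \<open>l\<close> is inherited by the smaller set.\<close>
      let ?B = "D n \<inter> {..t}"
      have LB: "integrable P (\<lambda>\<omega>. L \<omega> * (indicator ?B (jump \<omega>) * indicator finite_jump \<omega>))"
        "(\<integral>\<omega>. L \<omega> * (indicator ?B (jump \<omega>) * indicator finite_jump \<omega>) \<partial>P) = 0"
      proof -
        have B: "?B \<in> sets borel" "?B \<subseteq> {0<..}" using D_sub(2)[of n] by auto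
        have le: "l r \<le> real n" if "r \<in> ?B" for r using that by (simp add: D_def)
        show "integrable P (\<lambda>\<omega>. L \<omega> * (indicator ?B (jump \<omega>) * indicator finite_jump \<omega>))"
          by (rule L_int[OF B le])
        show "(\<integral>\<omega>. L \<omega> * (indicator ?B (jump \<omega>) * indicator finite_jump \<omega>) \<partial>P) = 0"
          by (rule L_exp[OF B le])
      qed
      have vt: "integrable \<nu> (\<lambda>r. v n r * indicator {0<..t} r)"
        by (rule integrable_real_mult_indicator[OF _ v_int]) simp
      have vtP: "integrable P (\<lambda>\<omega>. (v n (jump \<omega>) * indicator {0<..t} (jump \<omega>)) * indicator finite_jump \<omega>)"
        using vt by (subst (asm) integrable_jump_law_iff) measurable
      have "(\<integral>\<omega>. J n \<omega> * indicator (?after t) \<omega> \<partial>P) =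
          (\<integral>\<omega>. (v n (jump \<omega>) * indicator {0<..t} (jump \<omega>)) * indicator finite_jump \<omega>
            + L \<omega> * (indicator ?B (jump \<omega>) * indicator finite_jump \<omega>) \<partial>P)"
        using D_sub(2)[of n] t
        by (intro Bochner_Integration.integral_cong[OF refl])
          (auto simp: J_def v_def jump_le_iff indicator_def)
      also have "\<dots> = (\<integral>\<omega>. (v n (jump \<omega>) * indicator {0<..t} (jump \<omega>)) * indicator finite_jump \<omega> \<partial>P)
          + (\<integral>\<omega>. L \<omega> * (indicator ?B (jump \<omega>) * indicator finite_jump \<omega>) \<partial>P)"
        by (rule Bochner_Integration.integral_add[OF vtP LB(1)])
      also have "\<dots> = (\<integral>r. v n r * indicator {0<..t} r \<partial>\<nu>)"
        unfolding LB(2) by (subst integral_jump_law) auto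
      finally show ?thesis .
    qed
    also have "(\<integral>r. w n r * (Gbar r * indicator {0<..t} r) \<partial>\<nu>) = - (\<integral>r. v n r * indicator {0<..t} r \<partial>\<nu>)"
    proof -
      have "(\<integral>r. w n r * (Gbar r * indicator {0<..t} r) \<partial>\<nu>) = (\<integral>r. - (v n r * indicator {0<..t} r) \<partial>\<nu>)"
      proof (rule integral_cong_AE)
        show "AE r in \<nu>. w n r * (Gbar r * indicator {0<..t} r) = - (v n r * indicator {0<..t} r)"
          using wv[of n] by eventually_elim (auto split: split_indicator)
      qed (use borel_measurable_integrable[OF w_int[of n]] in auto)
      then show ?thesis by simp
    qed
    finally show ?thesis by simp
  qed
  have Y_mart: "martingale P \<F> (Y n)" for n
  proof (rule martingaleI[where e = 0])
    show "adapted \<F> (Y n)"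
      unfolding adapted_def borel_measurable_sj_iff
    proof (intro allI impI conjI exI ballI)
      fix t :: real assume t: "0 \<le> t"
      show "Y n t \<in> borel_measurable P" using Y_int by simp
      show "Y n t \<omega> = (\<integral>s. w n s * indicator {0<..t} s \<partial>\<nu>)" if "ennreal t < \<gamma> \<omega>" for \<omega>
        using past_before[OF t that] not_le[THEN iffD2, OF that] by (simp add: Y_def)
    qed
    show "AE \<omega> in P. \<gamma> \<omega> \<le> ennreal s \<longrightarrow> Y n t \<omega> = Y n s \<omega>" if st: "0 \<le> s" "s \<le> t" for s t
    proof (rule AE_I2, rule impI)
      fix \<omega> assume \<omega>: "\<omega> \<in> space P" "\<gamma> \<omega> \<le> ennreal s"
      then have t: "\<gamma> \<omega> \<le> ennreal t" using ennreal_leI[OF st(2)] by (blast intro: order_trans)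
      show "Y n t \<omega> = Y n s \<omega>"
        using past_after[OF st(1) \<omega>(2)] past_after[OF _ t] st \<omega> t by (simp add: Y_def)
    qed
  qed (use Y_int Y_exp in auto)
  have Y_ui: "uniformly_integrable P (Y n)" for n
  proof (rule uniformly_integrable_dominated)
    let ?Z = "\<lambda>\<omega>. measure (?p n) UNIV + measure (?q n) UNIV + \<bar>J n \<omega>\<bar>"
    show "integrable P ?Z" using J_int by simp
    fix t \<omega>
    have "measure (?p n) (?past t \<omega>) \<le> measure (?p n) UNIV" "measure (?q n) (?past t \<omega>) \<le> measure (?q n) UNIV"
      using fin by (auto intro!: finite_measure.finite_measure_mono)
    moreover have "\<bar>J n \<omega> * indicator (?after t) \<omega>\<bar> \<le> \<bar>J n \<omega>\<bar>" by (auto split: split_indicator)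
    moreover have "0 \<le> measure (?p n) (?past t \<omega>)" "0 \<le> measure (?q n) (?past t \<omega>)" by simp_all
    ultimately show "\<bar>Y n t \<omega>\<bar> \<le> ?Z \<omega>"
      unfolding Y_def w_meas[OF past_sets] by linarith
  qed
  \<comment> \<open>Time 0 and the times outside the time set are added to make the sets exhaust
    [0,\<infinity>). The integrals do not notice: almost surely the jump time, if finite, is in the
    time set and the path is constant after it.\<close>
  define B where "B n = {0} \<union> ({0<..} \<inter> (D n \<union> - jump_times P \<gamma>))" for n
  have B_sets: "B n \<in> sets borel" for n unfolding B_def by measurable
  define S where "S n = space P \<times> B n" for n
  have S_pred: "S n \<in> sets (predictable_sigma P \<F>)" for n
    unfolding S_def B_def by (rule predictable_deterministic) measurable
  have D_inc: "D m \<subseteq> D n" if "m \<le> n" for m n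
    using incseqD[OF u_inc that] that by (auto simp: D_def intro: order_trans)
  have S_inc: "incseq S"
    using D_inc by (fastforce simp: incseq_def S_def B_def)
  have S_UN: "(\<Union>n. S n) = space P \<times> {0..}"
  proof -
    have "\<exists>n. t \<in> B n" if "0 \<le> t" for t
    proof (cases "t \<in> jump_times P \<gamma> \<and> 0 < t")
      case True
      obtain n where n: "t \<le> u n" using u_cover True by blast
      obtain m where m: "l t \<le> real m" using real_arch_simple by blast
      have "t \<le> u (max n m)" using n incseqD[OF u_inc, of n "max n m"] by simp
      then have "t \<in> D (max n m)" using True m by (simp add: D_def)
      then show ?thesis using True by (auto simp: B_def)
    next
      case False
      then show ?thesis using that by (auto simp: B_def)
    qed
    moreover have "B n \<subseteq> {0..}" for n by (auto simp: B_def)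
    ultimately show ?thesis by (fastforce simp: S_def)
  qed
  have paths: "AE \<omega> in P. finite_variation_path (\<lambda>t. M t \<omega>) \<and>
      (\<forall>n. \<forall>t\<ge>0. Y n t \<omega> = stieltjes_integral (\<lambda>s. M s \<omega>) (\<lambda>s. indicator (S n) (\<omega>, s)) t)"
    using repr AE_jump_times AE_jump_le_end AE_space
  proof eventually_elim
    case (elim \<omega>)
    let ?f = "\<lambda>t. M t \<omega>"
    have before: "?f t = F 0 + (\<integral>s. z s * indicator {0<..t} s \<partial>\<nu>)" "ennreal t < jump_end P \<gamma>"
      if "0 \<le> t" "ennreal t < \<gamma> \<omega>" for t
    proof -
      show *: "ennreal t < jump_end P \<gamma>" using that elim(3) by (auto intro: less_le_trans)
      show "?f t = F 0 + (\<integral>s. z s * indicator {0<..t} s \<partial>\<nu>)"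
        using elim(1) that F_z[OF that(1) *] by simp
    qed
    have before': "?f t = F 0 + (\<integral>s. z s * indicator {0<..t} s \<partial>\<nu>)"
      if "0 \<le> t" "t < jump \<omega>" for t
      using before(1)[OF that(1)] that by (simp add: less_jump_iff)
    have after: "?f t = H (jump \<omega>) + L \<omega>" if "0 \<le> t" "\<gamma> \<omega> \<le> ennreal t" for t
      using elim(1) that by (simp add: jump_def not_less)
    have after': "?f t = ?f (jump \<omega>)" if "\<gamma> \<omega> < \<infinity>" "jump \<omega> \<le> t" for t
      using after[of t] after[of "jump \<omega>"] that jump_nonneg[of \<omega>] by (simp add: jump_le_iff)
    have restrict: "(\<integral>s. (z s * indicator {0<..r} s) * indicator {0<..t} s \<partial>\<nu>) = (\<integral>s. z s * indicator {0<..t} s \<partial>\<nu>)"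
      if "t \<le> r" for r t
      using that by (intro Bochner_Integration.integral_cong) (auto split: split_indicator)
    have restrict': "(\<integral>s. (z s * indicator {0<..r} s) * indicator {0<..<r} s \<partial>\<nu>) = (\<integral>s. z s * indicator {0<..<r} s \<partial>\<nu>)" for r
      by (intro Bochner_Integration.integral_cong) (auto split: split_indicator)
    have fv: "finite_variation_path ?f"
    proof (rule finite_variation_pathI)
      fix K :: real assume K: "0 \<le> K"
      show "\<exists>\<phi>. \<forall>s t. 0 \<le> s \<longrightarrow> s \<le> t \<longrightarrow> t \<le> K \<longrightarrow> \<bar>?f t - ?f s\<bar> \<le> \<phi> t - \<phi> s"
      proof (cases "ennreal K < \<gamma> \<omega>")
        case True
        let ?z = "\<lambda>s. z s * indicator {0<..K} s"
        have zK: "integrable \<nu> ?z" using z_int[OF jump_times_below_end[OF K before(2)[OF K True]]] .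
        show ?thesis
        proof (intro exI allI impI)
          fix s t assume st: "0 \<le> s" "s \<le> t" "t \<le> K"
          have "ennreal s \<le> ennreal K" "ennreal t \<le> ennreal K" using st by (auto intro: ennreal_leI)
          then have "ennreal s < \<gamma> \<omega>" "ennreal t < \<gamma> \<omega>" using True by (auto intro: le_less_trans)
          then show "\<bar>?f t - ?f s\<bar> \<le> (\<integral>r. \<bar>?z r\<bar> * indicator {0<..t} r \<partial>\<nu>) - (\<integral>r. \<bar>?z r\<bar> * indicator {0<..s} r \<partial>\<nu>)"
            using integral_Ioc_increment_le[OF zK st(2)] before(1)[of s] before(1)[of t] st
            by (simp add: restrict)
        qed
      next
        case False
        then have fin: "\<gamma> \<omega> < \<infinity>" using K by (auto simp: jump_le_iff not_less)
        \<comment> \<open>Cutting off at the jump time, almost surely a point of the time set, makes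
          z integrable even though it need not be so up to K.\<close>
        let ?z = "\<lambda>s. z s * indicator {0<..jump \<omega>} s"
        let ?\<phi> = "\<lambda>t. \<integral>r. \<bar>?z r\<bar> * indicator {0<..t} r \<partial>\<nu>"
        have zg: "integrable \<nu> ?z" using z_int elim(2) fin by blast
        have "\<exists>\<psi>. \<forall>s t. 0 \<le> s \<longrightarrow> s \<le> t \<longrightarrow> \<bar>?f t - ?f s\<bar> \<le> \<psi> t - \<psi> s"
        proof (rule dominated_with_jump)
          show "\<bar>?f t - ?f s\<bar> \<le> ?\<phi> t - ?\<phi> s" if "0 \<le> s" "s \<le> t" "t < jump \<omega>" for s t
            using integral_Ioc_increment_le[OF zg that(2)] before'[of s] before'[of t] that
            by (simp add: restrict)
          show "?\<phi> t \<le> (\<integral>r. \<bar>?z r\<bar> \<partial>\<nu>)" for t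
          proof (rule integral_mono)
            show "integrable \<nu> (\<lambda>r. \<bar>?z r\<bar> * indicator {0<..t} r)"
              by (rule integrable_real_mult_indicator[OF _ integrable_abs[OF zg]]) simp
          qed (use zg in \<open>auto split: split_indicator\<close>)
          show "?f s = ?f (jump \<omega>)" if "jump \<omega> \<le> s" for s using after'[OF fin that] .
        qed
        then show ?thesis by blast
      qed
    qed
    note rc_\<omega> = rc[OF elim(4)]
    have "Y n t \<omega> = stieltjes_integral ?f (\<lambda>s. indicator (S n) (\<omega>, s)) t" if t: "0 \<le> t" for n t
    proof -
      have C: "(\<lambda>s. indicator (S n) (\<omega>, s)) = (indicator (B n) :: real \<Rightarrow> real)"
        using elim(4) by (auto simp: S_def indicator_def fun_eq_iff)
      have B_D: "s \<in> B n \<longleftrightarrow> s \<in> D n" if "0 < s" "s \<le> r" "r \<in> jump_times P \<gamma>" for r s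
        using that jump_times_downward[OF that(3), of s] by (auto simp: B_def)
      show ?thesis
      proof (cases "ennreal t < \<gamma> \<omega>")
        case True
        have tT: "t \<in> jump_times P \<gamma>" using jump_times_below_end[OF t before(2)[OF t True]] .
        let ?z = "\<lambda>s. z s * indicator {0<..t} s"
        have zt: "integrable \<nu> ?z" "integrable \<nu> (\<lambda>s. - ?z s)" using z_int[OF tT] by simp_all
        have zt_meas: "measure (positive_part_measure \<nu> ?z) A - measure (positive_part_measure \<nu> (\<lambda>s. - ?z s)) A =
            (\<integral>s. ?z s * indicator A s \<partial>\<nu>)" if "A \<in> sets borel" for A
          using measure_positive_part_measure[OF zt(1)] that by simp
        have "stieltjes_integral ?f (indicator (B n)) t =
            measure (positive_part_measure \<nu> ?z) ({0<..t} \<inter> B n) - measure (positive_part_measure \<nu> (\<lambda>s. - ?z s)) ({0<..t} \<inter> B n)"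
        proof (rule stieltjes_integral_eq_measures[OF rc_\<omega> fv finite_positive_part_measure[OF zt(1)]
              finite_positive_part_measure[OF zt(2)] _ _ _ B_sets t])
          fix s assume s: "0 \<le> s" "s \<le> t"
          have s_less: "ennreal s < \<gamma> \<omega>" using ennreal_leI[OF s(2)] True by (rule le_less_trans)
          have "ennreal 0 < \<gamma> \<omega>" using ennreal_leI[OF t] True by (rule le_less_trans)
          then have f0: "?f 0 = F 0" using before(1)[of 0] by simp
          show "?f s = ?f 0 + measure (positive_part_measure \<nu> ?z) {0<..s} - measure (positive_part_measure \<nu> (\<lambda>s. - ?z s)) {0<..s}"
            using zt_meas[of "{0<..s}"] before(1)[OF s(1) s_less] restrict[OF s(2)] f0 by simp
        qed simp_all
        also have "\<dots> = (\<integral>s. ?z s * indicator ({0<..t} \<inter> B n) s \<partial>\<nu>)"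
          by (rule zt_meas) (use B_sets in auto)
        also have "\<dots> = (\<integral>s. w n s * indicator {0<..t} s \<partial>\<nu>)"
          using B_D[OF _ _ tT] by (intro Bochner_Integration.integral_cong[OF refl]) (auto simp: w_def indicator_def)
        also have "\<dots> = Y n t \<omega>"
          using past_before[OF t True] not_le[THEN iffD2, OF True] by (simp add: Y_def)
        finally show ?thesis unfolding C by simp
      next
        case False
        then have le: "\<gamma> \<omega> \<le> ennreal t" by simp
        then have fin: "\<gamma> \<omega> < \<infinity>" and gt: "jump \<omega> \<le> t" using t by (auto simp: jump_le_iff)
        have gT: "jump \<omega> \<in> jump_times P \<gamma>" using elim(2) fin by blast
        let ?z = "\<lambda>s. z s * indicator {0<..jump \<omega>} s"
        have zg: "integrable \<nu> ?z" "integrable \<nu> (\<lambda>s. - ?z s)" using z_int[OF gT] by simp_all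
        have zg_meas: "measure (positive_part_measure \<nu> ?z) A - measure (positive_part_measure \<nu> (\<lambda>s. - ?z s)) A =
            (\<integral>s. ?z s * indicator A s \<partial>\<nu>)" if "A \<in> sets borel" for A
          using measure_positive_part_measure[OF zg(1)] that by simp
        have f0: "?f 0 = F 0" if "0 < jump \<omega>" using before'[of 0] that by simp
        have "stieltjes_integral ?f (indicator (B n)) t =
            measure (positive_part_measure \<nu> ?z) ({0<..<jump \<omega>} \<inter> B n) - measure (positive_part_measure \<nu> (\<lambda>s. - ?z s)) ({0<..<jump \<omega>} \<inter> B n)
            + indicator (B n) (jump \<omega>) * (?f (jump \<omega>) - ?f 0 - measure (positive_part_measure \<nu> ?z) {0<..<jump \<omega>}
              + measure (positive_part_measure \<nu> (\<lambda>s. - ?z s)) {0<..<jump \<omega>})"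
        proof (rule stieltjes_integral_eq_measures_jump[OF rc_\<omega> fv finite_positive_part_measure[OF zg(1)]
              finite_positive_part_measure[OF zg(2)] _ _ _ _ B_sets jump_nonneg gt])
          fix s assume s: "0 \<le> s" "s < jump \<omega>"
          then have "0 < jump \<omega>" by simp
          from f0[OF this] show "?f s = ?f 0 + measure (positive_part_measure \<nu> ?z) {0<..s} - measure (positive_part_measure \<nu> (\<lambda>s. - ?z s)) {0<..s}"
            using zg_meas[of "{0<..s}"] before'[OF s] restrict[of s "jump \<omega>"] s by simp
        next
          fix s assume "jump \<omega> \<le> s"
          then show "?f s = ?f (jump \<omega>)" using after'[OF fin] by blast
        qed simp_all
        also have "\<dots> = (\<integral>s. ?z s * indicator ({0<..<jump \<omega>} \<inter> B n) s \<partial>\<nu>)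
            + indicator (B n) (jump \<omega>) * (?f (jump \<omega>) - ?f 0 - (\<integral>s. z s * indicator {0<..<jump \<omega>} s \<partial>\<nu>))"
        proof -
          have 1: "measure (positive_part_measure \<nu> ?z) ({0<..<jump \<omega>} \<inter> B n) - measure (positive_part_measure \<nu> (\<lambda>s. - ?z s)) ({0<..<jump \<omega>} \<inter> B n) =
              (\<integral>s. ?z s * indicator ({0<..<jump \<omega>} \<inter> B n) s \<partial>\<nu>)"
            by (rule zg_meas) (use B_sets in auto)
          have 2: "measure (positive_part_measure \<nu> ?z) {0<..<jump \<omega>} =
              measure (positive_part_measure \<nu> (\<lambda>s. - ?z s)) {0<..<jump \<omega>} + (\<integral>s. z s * indicator {0<..<jump \<omega>} s \<partial>\<nu>)"
            using zg_meas[of "{0<..<jump \<omega>}"] unfolding restrict' by simp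
          show ?thesis unfolding 1 2 by simp
        qed
        also have "(\<integral>s. ?z s * indicator ({0<..<jump \<omega>} \<inter> B n) s \<partial>\<nu>) = (\<integral>s. w n s * indicator {0<..<jump \<omega>} s \<partial>\<nu>)"
          using B_D[OF _ _ gT] by (intro Bochner_Integration.integral_cong[OF refl]) (auto simp: w_def indicator_def)
        also have "indicator (B n) (jump \<omega>) * (?f (jump \<omega>) - ?f 0 - (\<integral>s. z s * indicator {0<..<jump \<omega>} s \<partial>\<nu>)) = J n \<omega>"
        proof (cases "jump \<omega> = 0")
          case True
          \<comment> \<open>With a jump at time 0 there is no increment on (0,\<infinity>), and
            \<open>J n\<close> vanishes because 0 is not in \<open>D n\<close>.\<close>
          then show ?thesis by (simp add: J_def v_def D_def)
        next
          case False
          then have pos: "0 < jump \<omega>" using jump_nonneg[of \<omega>] by simp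
          have "?f (jump \<omega>) = H (jump \<omega>) + L \<omega>"
            using after[OF jump_nonneg] fin by (simp add: ennreal_jump)
          then show ?thesis
            using f0[OF pos] B_D[OF pos order_refl gT] gT fin
            by (auto simp: J_def v_def h_def Fl_def indicator_def)
        qed
        also have "(\<integral>s. w n s * indicator {0<..<jump \<omega>} s \<partial>\<nu>) + J n \<omega> = Y n t \<omega>"
          using past_after[OF t le] le elim(4) by (simp add: Y_def)
        finally show ?thesis unfolding C by simp
      qed
    qed
    with fv show ?case by blast
  qed
  have "semimartingale P \<F> M"
    unfolding semimartingale_def
  proof (intro exI conjI)
    show "AE \<omega> in P. cadlag_path (\<lambda>t. M t \<omega>) \<and> finite_variation_path (\<lambda>t. M t \<omega>)"
      using paths AE_space by eventually_elim (use rc finite_variation_cadlag in blast)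
    show "\<forall>t\<ge>0. \<forall>\<omega>\<in>space P. M t \<omega> = (\<lambda>_ _. 0) t \<omega> + M t \<omega>" by simp
  qed (use local_martingale_zero adapted in auto)
  moreover have "\<exists>Y. ui_martingale P \<F> Y \<and>
      (AE \<omega> in P. \<forall>t\<ge>0. Y t \<omega> = stieltjes_integral (\<lambda>s. M s \<omega>) (\<lambda>s. indicator (S n) (\<omega>, s)) t)" for n
    by (rule exI[of _ "Y n"]) (use paths Y_mart Y_ui in \<open>auto simp: ui_martingale_def elim: eventually_mono\<close>)
  ultimately show ?thesis
    unfolding sigma_martingale_def using S_inc S_pred S_UN by blast
qed

section \<open>Necessity\<close>

lemma emeasure_density_tendsto:
  fixes B :: "nat \<Rightarrow> real set"
  assumes [measurable_cong]: "sets m = sets borel" and [measurable]: "g \<in> borel_measurable borel"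
    and B [measurable]: "\<And>n. B n \<in> sets borel" "X \<in> sets borel"
    and inc: "incseq (\<lambda>n. X \<inter> B n)" and cover: "X \<subseteq> (\<Union>n. B n)"
  shows "(\<lambda>n. emeasure (density m g) (X \<inter> B n)) \<longlonglongrightarrow> emeasure (density m g) X"
proof -
  have "(\<lambda>n. emeasure (density m g) (X \<inter> B n)) \<longlonglongrightarrow> emeasure (density m g) (\<Union>n. X \<inter> B n)"
    using inc by (intro Lim_emeasure_incseq) (auto simp: assms(1))
  moreover have "(\<Union>n. X \<inter> B n) = X" using cover by auto
  ultimately show ?thesis by simp
qed

text \<open>Here w is integrable on \<open>I\<close> only; globally the two density measures may be
  infinite. This is the situation on each set of the exhausting sequence.\<close>

lemma density_signed_integral:
  fixes w :: "real \<Rightarrow> real"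
  assumes [measurable_cong]: "sets m = sets borel" and w [measurable]: "w \<in> borel_measurable borel"
    and I [measurable]: "I \<in> sets borel" and int: "integrable m (\<lambda>s. w s * indicator I s)"
  shows "emeasure (density m (\<lambda>s. ennreal (w s))) I \<noteq> \<infinity>"
    and "emeasure (density m (\<lambda>s. ennreal (- w s))) I \<noteq> \<infinity>"
    and "\<And>A. A \<in> sets borel \<Longrightarrow> A \<subseteq> I \<Longrightarrow>
      measure (density m (\<lambda>s. ennreal (w s))) A - measure (density m (\<lambda>s. ennreal (- w s))) A = (\<integral>s. w s * indicator A s \<partial>m)"
proof -
  let ?p = "\<lambda>\<sigma>. density m (\<lambda>s. ennreal (\<sigma> * w s))"
  let ?q = "\<lambda>\<sigma>. positive_part_measure m (\<lambda>s. \<sigma> * (w s * indicator I s))"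
  have eq: "emeasure (?p \<sigma>) A = emeasure (?q \<sigma>) A" if [measurable]: "A \<in> sets borel" and sub: "A \<subseteq> I" for A \<sigma>
    unfolding positive_part_measure_def
    by (subst (1 2) emeasure_density)
      (use sub in \<open>auto intro!: nn_integral_cong simp: assms(1) max_def ennreal_neg split: split_indicator\<close>)
  have fin: "finite_measure (?q \<sigma>)" for \<sigma>
    using int by (intro finite_positive_part_measure integrable_mult_right)
  have finI: "emeasure (?p \<sigma>) I \<noteq> \<infinity>" for \<sigma>
    unfolding eq[OF I order_refl] using fin by (simp add: finite_measure.emeasure_eq_measure)
  from finI[of 1] finI[of "-1"]
  show "emeasure (density m (\<lambda>s. ennreal (w s))) I \<noteq> \<infinity>" "emeasure (density m (\<lambda>s. ennreal (- w s))) I \<noteq> \<infinity>"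
    by simp_all
  fix A assume A: "A \<in> sets borel" "A \<subseteq> I"
  have "measure (?p \<sigma>) A = measure (?q \<sigma>) A" for \<sigma>
    using eq[OF A] by (simp add: measure_def)
  from this[of 1] this[of "-1"]
  have "measure (density m (\<lambda>s. ennreal (w s))) A - measure (density m (\<lambda>s. ennreal (- w s))) A =
      (\<integral>s. (w s * indicator I s) * indicator A s \<partial>m)"
    using measure_positive_part_measure[OF int, of A] A(1) by (simp add: assms(1))
  also have "\<dots> = (\<integral>s. w s * indicator A s \<partial>m)"
    using A(2) by (intro Bochner_Integration.integral_cong) (auto split: split_indicator)
  finally show "measure (density m (\<lambda>s. ennreal (w s))) A - measure (density m (\<lambda>s. ennreal (- w s))) A = (\<integral>s. w s * indicator A s \<partial>m)" .
qed

lemma measure_density_Gbar: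
  assumes m: "finite_measure m" and [measurable_cong]: "sets m = sets borel"
  shows "finite_measure (density m (\<lambda>s. ennreal (Gbar s)))"
    and "\<And>A. A \<in> sets borel \<Longrightarrow> measure (density m (\<lambda>s. ennreal (Gbar s))) A = (\<integral>s. Gbar s * indicator A s \<partial>m)"
proof -
  interpret m: finite_measure m by fact
  have eq: "emeasure (density m (\<lambda>s. ennreal (Gbar s))) A = (\<integral>\<^sup>+s. ennreal (Gbar s * indicator A s) \<partial>m)"
    if [measurable]: "A \<in> sets borel" for A
    by (subst emeasure_density)
      (auto simp: assms(2) ennreal_mult' Gbar_nonneg ennreal_indicator)
  have int: "integrable m (\<lambda>s. Gbar s * indicator A s)" if [measurable]: "A \<in> sets borel" for A
    by (rule m.integrable_const_bound[where B = 1])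
      (auto intro!: AE_I2 simp: Gbar_nonneg Gbar_le_1 split: split_indicator)
  have space: "space m = UNIV" using sets_eq_imp_space_eq[OF assms(2)] by simp
  show "finite_measure (density m (\<lambda>s. ennreal (Gbar s)))"
  proof (rule finite_measureI)
    have "(\<integral>\<^sup>+s. ennreal (Gbar s * indicator UNIV s) \<partial>m) < \<infinity>"
      using int[of UNIV] nn_integral_eq_integral[OF int[of UNIV]] by (simp add: Gbar_nonneg)
    then show "emeasure (density m (\<lambda>s. ennreal (Gbar s))) (space (density m (\<lambda>s. ennreal (Gbar s)))) \<noteq> \<infinity>"
      using eq[of UNIV] by (simp add: space)
  qed
  fix A :: "real set" assume A: "A \<in> sets borel"
  show "measure (density m (\<lambda>s. ennreal (Gbar s))) A = (\<integral>s. Gbar s * indicator A s \<partial>m)"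
    unfolding measure_def eq[OF A] using nn_integral_eq_integral[OF int[OF A]]
    by (simp add: Gbar_nonneg)
qed

text \<open>Taking expectations of \<open>Y\<^sub>n\<close> shows that \<open>P(\<gamma> > s) dF(s) = - (k(s) - F(s-)) dG(s)\<close> on \<open>B\<^sub>n\<close>, where
  \<open>k = E[K | \<gamma> = \<cdot>]\<close>. Since the left-hand side is a finite measure on \<open>(0,t]\<close>, letting \<open>n\<close> tend to
  infinity yields the integrability of \<open>k\<close>.\<close>

lemma sigma_martingale_local:
  fixes K :: "'a \<Rightarrow> real" and F Fl :: "real \<Rightarrow> real" and B :: "nat \<Rightarrow> real set" and Y :: "nat \<Rightarrow> real \<Rightarrow> 'a \<Rightarrow> real"
  assumes K [measurable]: "K \<in> borel_measurable P"
    and t: "t \<in> jump_times P \<gamma>" "0 < t"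
    and B [measurable]: "\<And>n. B n \<in> sets borel"
    and B_inc: "incseq (\<lambda>n. {0<..t} \<inter> B n)" and B_cover: "{0<..t} \<subseteq> (\<Union>n. B n)"
    and Y: "\<And>n. martingale P \<F> (Y n)"
    and m: "finite_measure m1" "finite_measure m2" "sets m1 = sets borel" "sets m2 = sets borel"
      "AE s in m1. s \<in> {0<..t}" "AE s in m2. s \<in> {0<..t}"
    and F_eq: "\<And>s. 0 \<le> s \<Longrightarrow> s \<le> t \<Longrightarrow> ennreal s < jump_end P \<gamma> \<Longrightarrow> F s = F 0 + measure m1 {0<..s} - measure m2 {0<..s}"
    and Fl_eq: "\<And>s. 0 < s \<Longrightarrow> s \<le> t \<Longrightarrow> Fl s = F 0 + measure m1 {0<..<s} - measure m2 {0<..<s}"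
    and Y_eq: "\<And>n s. 0 \<le> s \<Longrightarrow> s \<le> t \<Longrightarrow> AE \<omega> in P. Y n s \<omega> =
      measure m1 ({0<..s} \<inter> B n \<inter> {r. ennreal r < \<gamma> \<omega>}) - measure m2 ({0<..s} \<inter> B n \<inter> {r. ennreal r < \<gamma> \<omega>})
      + (K \<omega> - Fl (jump \<omega>)) * (indicator ({0<..s} \<inter> B n) (jump \<omega>) * indicator finite_jump \<omega>)"
  defines "k \<equiv> jump_mean K"
  shows "integrable \<nu> (\<lambda>s. k s * indicator {0<..t} s)"
    and "(\<lambda>s. Fl s * indicator {0<..t} s) \<in> borel_measurable borel"
    and "integrable \<nu> (\<lambda>s. - (k s - Fl s) / Gbar s * indicator {0<..t} s)"
    and "\<And>s. 0 \<le> s \<Longrightarrow> s \<le> t \<Longrightarrow> ennreal s < jump_end P \<gamma> \<Longrightarrow>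
      F s * Gbar s + (\<integral>r. k r * indicator {0<..s} r \<partial>\<nu>) = F 0 * Gbar 0"
    and "\<And>s. 0 \<le> s \<Longrightarrow> s \<le> t \<Longrightarrow> ennreal s < jump_end P \<gamma> \<Longrightarrow>
      F s = F 0 + (\<integral>r. - (k r - Fl r) / Gbar r * indicator {0<..s} r \<partial>\<nu>)"
    and "\<not> ennreal t < jump_end P \<gamma> \<Longrightarrow> k t = Fl t"
    and "AE s in \<nu>. s \<in> {0<..t} \<longrightarrow> jump_density (\<lambda>\<omega>. ennreal (K \<omega>)) s < \<infinity> \<and> jump_density (\<lambda>\<omega>. ennreal (- K \<omega>)) s < \<infinity>"
proof -
  note [measurable_cong] = m(3,4)
  interpret m1: finite_measure m1 by fact
  interpret m2: finite_measure m2 by fact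
  have k [measurable]: "k \<in> borel_measurable borel" unfolding k_def by measurable
  define fl where "fl s = Fl s * indicator {0<..t} s" for s
  have fl_alt: "fl s = (F 0 + measure m1 ({0<..<s} \<inter> UNIV) - measure m2 ({0<..<s} \<inter> UNIV)) * indicator {0<..t} s" for s
    using Fl_eq[of s] by (auto simp: fl_def split: split_indicator)
  have fl [measurable]: "fl \<in> borel_measurable borel"
    unfolding fl_alt[abs_def]
    using measurable_measure_Ioo[OF m(1,3), of UNIV] measurable_measure_Ioo[OF m(2,4), of UNIV] by measurable
  then show "(\<lambda>s. Fl s * indicator {0<..t} s) \<in> borel_measurable borel" by (simp add: fl_def[abs_def])
  let ?C = "\<bar>F 0\<bar> + measure m1 (space m1) + measure m2 (space m2)"
  \<comment> \<open>Up to time t the left limits of \<open>F\<close> are bounded by the masses of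
    \<open>m1\<close> and \<open>m2\<close>. Integrability is therefore in doubt for
    \<open>K\<close> alone.\<close>
  have fl_bound: "\<bar>fl s\<bar> \<le> ?C" for s
  proof (cases "s \<in> {0<..t}")
    case True
    have "0 \<le> measure m1 {0<..<s}" "0 \<le> measure m2 {0<..<s}" by simp_all
    moreover have "measure m1 {0<..<s} \<le> measure m1 (space m1)" "measure m2 {0<..<s} \<le> measure m2 (space m2)"
      by (rule m1.bounded_measure, rule m2.bounded_measure)
    moreover have "fl s = F 0 + measure m1 {0<..<s} - measure m2 {0<..<s}" using True by (simp add: fl_alt)
    ultimately show ?thesis by linarith
  qed (simp add: fl_def)
  have fl_int: "integrable \<nu> (\<lambda>s. fl s * indicator A s)" if [measurable]: "A \<in> sets borel" for A
    using fl_bound by (intro law.integrable_const_bound[where B = ?C])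
      (auto intro!: AE_I2 order_trans[OF _ fl_bound] split: split_indicator)
  have fl_intP: "integrable P (\<lambda>\<omega>. fl (jump \<omega>) * (indicator A (jump \<omega>) * indicator finite_jump \<omega>))"
    if [measurable]: "A \<in> sets borel" for A
    using integrable_jump_law_iff[of "\<lambda>s. fl s * indicator A s"] fl_int[OF that] by (simp add: mult.assoc)
  let ?X = "\<lambda>s n. {0<..s} \<inter> B n"
  let ?I = "\<lambda>s n \<omega>. indicator (?X s n) (jump \<omega>) * indicator finite_jump \<omega> :: real"
  let ?past = "\<lambda>s n \<omega>. ?X s n \<inter> {r. ennreal r < \<gamma> \<omega>}"
  have X [measurable]: "?X s n \<in> sets borel" for s n by measurable
  have past1: "integrable P (\<lambda>\<omega>. measure m1 (?past s n \<omega>))"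
    "(\<integral>\<omega>. measure m1 (?past s n \<omega>) \<partial>P) = (\<integral>r. Gbar r * indicator (?X s n) r \<partial>m1)" for s n
    by (rule expectation_before_jump[OF m(1,3) X])+
  have past2: "integrable P (\<lambda>\<omega>. measure m2 (?past s n \<omega>))"
    "(\<integral>\<omega>. measure m2 (?past s n \<omega>) \<partial>P) = (\<integral>r. Gbar r * indicator (?X s n) r \<partial>m2)" for s n
    by (rule expectation_before_jump[OF m(2,4) X])+
  have Y_eq': "AE \<omega> in P. Y n s \<omega> = measure m1 (?past s n \<omega>) - measure m2 (?past s n \<omega>) +
      (K \<omega> - fl (jump \<omega>)) * ?I s n \<omega>" if "0 \<le> s" "s \<le> t" for n s
    using Y_eq[OF that, of n] by eventually_elim (use that in \<open>auto simp: fl_def split: split_indicator\<close>)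
  have Y_int: "integrable P (Y n s)" if "0 \<le> s" for n s
    using martingale_integrable[OF Y that] .
  \<comment> \<open>The martingale property supplies what \<open>K\<close> lacks:
    \<open>Y n s\<close> is integrable and the terms before the jump are bounded, so the jump term
    is integrable as well.\<close>
  have J_int: "integrable P (\<lambda>\<omega>. (K \<omega> - fl (jump \<omega>)) * ?I s n \<omega>)" if s: "0 \<le> s" "s \<le> t" for s n
  proof (rule integrable_cong_AE_imp)
    show "integrable P (\<lambda>\<omega>. Y n s \<omega> - (measure m1 (?past s n \<omega>) - measure m2 (?past s n \<omega>)))"
      by (intro Bochner_Integration.integrable_diff Y_int past1 past2 s)
    show "AE \<omega> in P. Y n s \<omega> - (measure m1 (?past s n \<omega>) - measure m2 (?past s n \<omega>)) = (K \<omega> - fl (jump \<omega>)) * ?I s n \<omega>"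
      using Y_eq'[OF s, of n] by eventually_elim simp
  qed measurable
  have K_int: "integrable P (\<lambda>\<omega>. K \<omega> * ?I s n \<omega>)" if s: "0 \<le> s" "s \<le> t" for s n
    using Bochner_Integration.integrable_add[OF J_int[OF s, of n] fl_intP[OF X, of s n]]
    by (simp add: left_diff_distrib)
  have k_int: "integrable \<nu> (\<lambda>r. k r * indicator (?X s n) r)"
    "(\<integral>\<omega>. K \<omega> * ?I s n \<omega> \<partial>P) = (\<integral>r. k r * indicator (?X s n) r \<partial>\<nu>)" if s: "0 \<le> s" "s \<le> t" for s n
    unfolding k_def using jump_mean_integral(1,2)[OF K X K_int[OF s]] .
  have Y_exp: "expectation (Y n s) = 0" if s: "0 \<le> s" for n s
  proof -
    have "expectation (Y n s) = expectation (Y n 0)" by (rule martingale_expectation[OF Y s])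
    also have "\<dots> = (\<integral>\<omega>. 0 \<partial>P)"
    proof (rule integral_cong_AE)
      show "AE \<omega> in P. Y n 0 \<omega> = 0"
        using Y_eq'[of 0 n] t(2) by (auto elim!: eventually_mono)
    qed (use Y_int[of 0 n] in auto)
    finally show ?thesis by simp
  qed
  define w where "w s = (k s - Fl s) * indicator {0<..t} s" for s
  have w_alt: "w s = k s * indicator {0<..t} s - fl s" for s by (simp add: w_def fl_def left_diff_distrib)
  have w [measurable]: "w \<in> borel_measurable borel" unfolding w_alt[abs_def] by measurable
  have w_X: "w r * indicator (?X s n) r = k r * indicator (?X s n) r - fl r * indicator (?X s n) r"
    if "s \<le> t" for r s n
    using that by (auto simp: w_alt split: split_indicator)
  have w_int: "integrable \<nu> (\<lambda>r. w r * indicator (?X s n) r)" if s: "0 \<le> s" "s \<le> t" for s n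
    unfolding w_X[OF s(2)] by (intro Bochner_Integration.integrable_diff k_int s fl_int X)
  \<comment> \<open>The martingale starts at 0, so its expectation vanishes at every s. Fubini's
    theorem evaluates the part before the jump and conditioning on \<open>jump\<close> the part
    after it.\<close>
  have balance: "(\<integral>r. Gbar r * indicator (?X s n) r \<partial>m1) - (\<integral>r. Gbar r * indicator (?X s n) r \<partial>m2)
      + (\<integral>r. w r * indicator (?X s n) r \<partial>\<nu>) = 0" if s: "0 \<le> s" "s \<le> t" for s n
  proof -
    have "(\<integral>\<omega>. (K \<omega> - fl (jump \<omega>)) * ?I s n \<omega> \<partial>P) = (\<integral>\<omega>. K \<omega> * ?I s n \<omega> \<partial>P) - (\<integral>\<omega>. fl (jump \<omega>) * ?I s n \<omega> \<partial>P)"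
      unfolding left_diff_distrib by (rule Bochner_Integration.integral_diff[OF K_int[OF s] fl_intP[OF X]])
    also have "(\<integral>\<omega>. fl (jump \<omega>) * ?I s n \<omega> \<partial>P) = (\<integral>r. fl r * indicator (?X s n) r \<partial>\<nu>)"
      by (subst integral_jump_law) (auto simp: mult.assoc)
    also have "(\<integral>\<omega>. K \<omega> * ?I s n \<omega> \<partial>P) - (\<integral>r. fl r * indicator (?X s n) r \<partial>\<nu>) = (\<integral>r. w r * indicator (?X s n) r \<partial>\<nu>)"
      unfolding k_int(2)[OF s] w_X[OF s(2)]
      by (rule Bochner_Integration.integral_diff[symmetric, OF k_int(1)[OF s] fl_int[OF X]])
    finally have J: "(\<integral>\<omega>. (K \<omega> - fl (jump \<omega>)) * ?I s n \<omega> \<partial>P) = (\<integral>r. w r * indicator (?X s n) r \<partial>\<nu>)" .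
    have "0 = expectation (Y n s)" using Y_exp[OF s(1)] by simp
    also have "\<dots> = (\<integral>\<omega>. measure m1 (?past s n \<omega>) - measure m2 (?past s n \<omega>) + (K \<omega> - fl (jump \<omega>)) * ?I s n \<omega> \<partial>P)"
      by (rule integral_cong_AE)
        (use Y_int[OF s(1)] past1(1) past2(1) J_int[OF s] Y_eq'[OF s] in \<open>auto intro!: borel_measurable_add borel_measurable_diff\<close>)
    also have "\<dots> = (\<integral>\<omega>. measure m1 (?past s n \<omega>) \<partial>P) - (\<integral>\<omega>. measure m2 (?past s n \<omega>) \<partial>P)
        + (\<integral>\<omega>. (K \<omega> - fl (jump \<omega>)) * ?I s n \<omega> \<partial>P)"
      by (simp only: Bochner_Integration.integral_add[OF Bochner_Integration.integrable_diff[OF past1(1) past2(1)] J_int[OF s]]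
          Bochner_Integration.integral_diff[OF past1(1) past2(1)])
    finally show ?thesis unfolding J past1(2) past2(2) by simp
  qed
  let ?a = "density m1 (\<lambda>s. ennreal (Gbar s))" and ?c = "density m2 (\<lambda>s. ennreal (Gbar s))"
  let ?b = "density \<nu> (\<lambda>s. ennreal (w s))" and ?d = "density \<nu> (\<lambda>s. ennreal (- w s))"
  interpret a: finite_measure ?a by (rule measure_density_Gbar(1)[OF m(1,3)])
  interpret c: finite_measure ?c by (rule measure_density_Gbar(1)[OF m(2,4)])
  have t0: "0 \<le> t" using t by simp
  \<comment> \<open>The balance is restated in [0,\<infinity>] because it has to survive the limit
    in n, where \<open>?b\<close> and \<open>?d\<close> are not yet known to be finite.\<close>
  have on_B: "emeasure ?a (?X t n \<inter> C) + emeasure ?b (?X t n \<inter> C) = emeasure ?c (?X t n \<inter> C) + emeasure ?d (?X t n \<inter> C)"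
    if C: "C \<in> sets borel" for C n
  proof -
    note signed = density_signed_integral[OF sets_jump_law w X w_int[OF t0 order_refl]]
    have "measure ?a (?X t n \<inter> C) + measure ?b (?X t n \<inter> C) = measure ?c (?X t n \<inter> C) + measure ?d (?X t n \<inter> C)"
    proof (rule balanced_measures_on)
      fix s :: real
      have set: "?X t n \<inter> {..s} = ?X (min s t) n" by auto
      have "measure ?b (?X t n \<inter> {..s}) - measure ?d (?X t n \<inter> {..s}) = (\<integral>r. w r * indicator (?X (min s t) n) r \<partial>\<nu>)"
        unfolding set[symmetric] by (rule signed(3)) auto
      moreover have "(\<integral>r. Gbar r * indicator (?X (min s t) n) r \<partial>m1) - (\<integral>r. Gbar r * indicator (?X (min s t) n) r \<partial>m2)
        + (\<integral>r. w r * indicator (?X (min s t) n) r \<partial>\<nu>) = 0"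
      proof (cases "0 \<le> s")
        case True
        then show ?thesis using balance[of "min s t" n] t0 by simp
      next
        case False
        then have "?X (min s t) n = {}" by auto
        then show ?thesis by simp
      qed
      ultimately show "measure ?a (?X t n \<inter> {..s}) + measure ?b (?X t n \<inter> {..s}) =
          measure ?c (?X t n \<inter> {..s}) + measure ?d (?X t n \<inter> {..s})"
        unfolding set measure_density_Gbar(2)[OF m(1,3) X] measure_density_Gbar(2)[OF m(2,4) X] by linarith
    qed (use signed C in \<open>auto simp: a.emeasure_eq_measure c.emeasure_eq_measure m\<close>)
    moreover have "emeasure ?b (?X t n \<inter> C) \<noteq> \<infinity>" "emeasure ?d (?X t n \<inter> C) \<noteq> \<infinity>"
      using signed(1,2)[of n] emeasure_mono[OF Int_lower1, of "?X t n" ?b C] emeasure_mono[OF Int_lower1, of "?X t n" ?d C]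
      by (auto simp: top_unique)
    ultimately show ?thesis
      by (simp add: a.emeasure_eq_measure c.emeasure_eq_measure emeasure_eq_ennreal_measure flip: ennreal_plus)
  qed
  have on_t: "emeasure ?a ({0<..t} \<inter> C) + emeasure ?b ({0<..t} \<inter> C) = emeasure ?c ({0<..t} \<inter> C) + emeasure ?d ({0<..t} \<inter> C)"
    if C: "C \<in> sets borel" for C
  proof -
    have inc: "incseq (\<lambda>n. ({0<..t} \<inter> C) \<inter> B n)"
      using B_inc unfolding incseq_def by blast
    have cover: "{0<..t} \<inter> C \<subseteq> (\<Union>n. B n)" using B_cover by blast
    have S: "{0<..t} \<inter> C \<in> sets borel" using C by simp
    have comm: "?X t n \<inter> C = ({0<..t} \<inter> C) \<inter> B n" for n by auto
    have "(\<lambda>n. emeasure ?a (({0<..t} \<inter> C) \<inter> B n) + emeasure ?b (({0<..t} \<inter> C) \<inter> B n)) \<longlonglongrightarrow>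
        emeasure ?a ({0<..t} \<inter> C) + emeasure ?b ({0<..t} \<inter> C)"
      by (intro tendsto_add emeasure_density_tendsto[OF _ _ B S inc cover]) (auto simp: m)
    moreover have "(\<lambda>n. emeasure ?c (({0<..t} \<inter> C) \<inter> B n) + emeasure ?d (({0<..t} \<inter> C) \<inter> B n)) \<longlonglongrightarrow>
        emeasure ?c ({0<..t} \<inter> C) + emeasure ?d ({0<..t} \<inter> C)"
      by (intro tendsto_add emeasure_density_tendsto[OF _ _ B S inc cover]) (auto simp: m)
    moreover have "emeasure ?a (({0<..t} \<inter> C) \<inter> B n) + emeasure ?b (({0<..t} \<inter> C) \<inter> B n) =
        emeasure ?c (({0<..t} \<inter> C) \<inter> B n) + emeasure ?d (({0<..t} \<inter> C) \<inter> B n)" for n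
      using on_B[OF C, of n] unfolding comm .
    ultimately show ?thesis using LIMSEQ_unique by simp
  qed
  \<comment> \<open>All four measures are carried by (0,t], so the balance there holds on every
    Borel set.\<close>
  have restr: "emeasure (density m g) C = emeasure (density m g) ({0<..t} \<inter> C)"
    if [measurable_cong]: "sets m = sets borel" and [measurable]: "g \<in> borel_measurable borel" "C \<in> sets borel"
      and AE: "AE s in m. s \<notin> {0<..t} \<longrightarrow> g s = 0" for m g C
  proof -
    have "emeasure (density m g) C = (\<integral>\<^sup>+s. g s * indicator C s \<partial>m)"
      by (rule emeasure_density) (simp_all add: that)
    also have "\<dots> = (\<integral>\<^sup>+s. g s * indicator ({0<..t} \<inter> C) s \<partial>m)"
      by (rule nn_integral_cong_AE, use AE in eventually_elim) (auto split: split_indicator)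
    also have "\<dots> = emeasure (density m g) ({0<..t} \<inter> C)"
      by (rule emeasure_density[symmetric]) (simp_all add: that)
    finally show ?thesis .
  qed
  have restr_b: "emeasure ?b C = emeasure ?b ({0<..t} \<inter> C)" if "C \<in> sets borel" for C
    by (rule restr[OF sets_jump_law _ that], measurable) (simp add: w_def)
  have restr_d: "emeasure ?d C = emeasure ?d ({0<..t} \<inter> C)" if "C \<in> sets borel" for C
    by (rule restr[OF sets_jump_law _ that], measurable) (simp add: w_def)
  have restr_a: "emeasure ?a C = emeasure ?a ({0<..t} \<inter> C)" if "C \<in> sets borel" for C
    by (rule restr[OF m(3) _ that], measurable, use m(5) in eventually_elim) simp
  have restr_c: "emeasure ?c C = emeasure ?c ({0<..t} \<inter> C)" if "C \<in> sets borel" for C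
    by (rule restr[OF m(4) _ that], measurable, use m(6) in eventually_elim) simp
  have all: "emeasure ?a C + emeasure ?b C = emeasure ?c C + emeasure ?d C" if C: "C \<in> sets borel" for C
    unfolding restr_a[OF C] restr_b[OF C] restr_c[OF C] restr_d[OF C] by (rule on_t[OF C])
  have null: "emeasure (density \<nu> g) A = 0"
    if [measurable]: "g \<in> borel_measurable borel" "A \<in> sets borel" and zero: "\<And>s. s \<in> A \<Longrightarrow> g s = 0" for g A
  proof -
    have "emeasure (density \<nu> g) A = (\<integral>\<^sup>+s. g s * indicator A s \<partial>\<nu>)"
      by (rule emeasure_density) simp_all
    also have "\<dots> = (\<integral>\<^sup>+s. 0 \<partial>\<nu>)"
      by (rule nn_integral_cong) (simp add: zero split: split_indicator)
    finally show ?thesis by simp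
  qed
  \<comment> \<open>On {w \<ge> 0} the measure \<open>?d\<close> is null, so the balance bounds the
    positive part of w by the finite measure \<open>?c\<close>. The negative part is treated
    symmetrically with \<open>?a\<close>.\<close>
  have b_fin: "(\<integral>\<^sup>+s. ennreal (w s) \<partial>\<nu>) < \<infinity>"
  proof -
    have "(\<integral>\<^sup>+s. ennreal (w s) \<partial>\<nu>) = emeasure ?b {s. 0 \<le> w s}"
      by (subst emeasure_density) (auto intro!: nn_integral_cong simp: ennreal_neg split: split_indicator)
    also have "\<dots> \<le> emeasure ?a {s. 0 \<le> w s} + emeasure ?b {s. 0 \<le> w s}" by simp
    also have "\<dots> = emeasure ?c {s. 0 \<le> w s} + emeasure ?d {s. 0 \<le> w s}" by (rule all) measurable
    also have "emeasure ?d {s. 0 \<le> w s} = 0"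
      by (rule null) (auto simp: ennreal_neg)
    finally show ?thesis by (simp add: c.emeasure_eq_measure le_less_trans)
  qed
  have d_fin: "(\<integral>\<^sup>+s. ennreal (- w s) \<partial>\<nu>) < \<infinity>"
  proof -
    have "(\<integral>\<^sup>+s. ennreal (- w s) \<partial>\<nu>) = emeasure ?d {s. w s \<le> 0}"
      by (subst emeasure_density) (auto intro!: nn_integral_cong simp: ennreal_neg split: split_indicator)
    also have "\<dots> \<le> emeasure ?c {s. w s \<le> 0} + emeasure ?d {s. w s \<le> 0}" by simp
    also have "\<dots> = emeasure ?a {s. w s \<le> 0} + emeasure ?b {s. w s \<le> 0}" by (rule all[symmetric]) measurable
    also have "emeasure ?b {s. w s \<le> 0} = 0"
      by (rule null) (auto simp: ennreal_neg)
    finally show ?thesis by (simp add: a.emeasure_eq_measure le_less_trans)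
  qed
  have w_integrable: "integrable \<nu> w"
    using b_fin d_fin by (simp add: real_integrable_def less_top)
  have k_eq: "k s * indicator {0<..t} s = w s + fl s" for s by (simp add: w_alt)
  show k_integrable: "integrable \<nu> (\<lambda>s. k s * indicator {0<..t} s)"
    unfolding k_eq using fl_int[of UNIV] w_integrable by simp
  \<comment> \<open>A positive lower bound of \<open>Gbar\<close> on (0,t], or on (0,t) if
    \<open>Gbar t\<close> is 0. In the latter case division by zero makes
    \<open>w t / Gbar t\<close> equal to 0, so dividing by \<open>Gbar\<close> preserves
    integrability.\<close>
  define q where "q = (if 0 < Gbar t then Gbar t else prob {\<omega> \<in> space P. ennreal t \<le> \<gamma> \<omega>})"
  have q: "0 < q" using t by (auto simp: q_def jump_times_def)
  have Gq: "q \<le> Gbar s" if "0 < s" "s \<le> t" "s < t \<or> 0 < Gbar t" for s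
    using that Gbar_antimono[of s t] Gbar_ge_jump_time[of s t] by (auto simp: q_def)
  have zw: "- (k s - Fl s) / Gbar s * indicator {0<..t} s = - (w s / Gbar s)" for s
    by (simp add: w_def diff_divide_distrib split: split_indicator)
  have wG_le: "\<bar>w s / Gbar s\<bar> \<le> \<bar>w s / q\<bar>" for s
  proof (cases "s \<in> {0<..t} \<and> (s < t \<or> 0 < Gbar t)")
    case True
    then have "q \<le> Gbar s" using Gq by auto
    then show ?thesis using q by (auto simp: abs_divide intro!: divide_left_mono mult_pos_pos)
  next
    case False
    then have "w s = 0 \<or> Gbar s = 0" using Gbar_nonneg[of t] by (cases "s = t") (auto simp: w_def)
    then show ?thesis by auto
  qed
  have wG_int: "integrable \<nu> (\<lambda>s. w s / Gbar s)"
    by (rule Bochner_Integration.integrable_bound[of _ "\<lambda>s. w s / q"])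
      (use w_integrable wG_le in \<open>auto intro!: AE_I2\<close>)
  show "integrable \<nu> (\<lambda>s. - (k s - Fl s) / Gbar s * indicator {0<..t} s)"
    unfolding zw using wG_int by simp
  show "F s * Gbar s + (\<integral>r. k r * indicator {0<..s} r \<partial>\<nu>) = F 0 * Gbar 0"
    if s: "0 \<le> s" "s \<le> t" and s_end: "ennreal s < jump_end P \<gamma>" for s
  proof -
    have S: "{0<..s} \<in> sets borel" by simp
    let ?w = "\<lambda>r. w r * indicator {0<..s} r" and ?fl = "\<lambda>r. fl r * indicator {0<..s} r"
    have ws: "integrable \<nu> ?w"
      by (rule integrable_real_mult_indicator[OF _ w_integrable]) simp
    have w1: "integrable \<nu> (\<lambda>r. w r * indicator UNIV r)" using w_integrable by simp
    have "measure ?b {0<..s} - measure ?d {0<..s} = (\<integral>r. ?w r \<partial>\<nu>)"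
      by (rule density_signed_integral(3)[OF sets_jump_law w _ w1]) auto
    moreover have "measure ?a {0<..s} + measure ?b {0<..s} = measure ?c {0<..s} + measure ?d {0<..s}"
    proof -
      have "emeasure ?b {0<..s} \<noteq> \<infinity>" "emeasure ?d {0<..s} \<noteq> \<infinity>"
        using density_signed_integral(1,2)[OF sets_jump_law w S ws] .
      then show ?thesis
        using all[OF S]
        by (simp add: a.emeasure_eq_measure c.emeasure_eq_measure emeasure_eq_ennreal_measure flip: ennreal_plus)
    qed
    ultimately have w_eq: "(\<integral>r. ?w r \<partial>\<nu>) =
        (\<integral>r. Gbar r * indicator ({0<..s} \<inter> UNIV) r \<partial>m2) - (\<integral>r. Gbar r * indicator ({0<..s} \<inter> UNIV) r \<partial>m1)"
      using measure_density_Gbar(2)[OF m(1,3) S] measure_density_Gbar(2)[OF m(2,4) S] by simp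
    let ?l = "\<lambda>m r. measure m ({0<..<r} \<inter> UNIV) * indicator {0<..s} r"
    have l_int: "integrable \<nu> (?l m)" if mm: "finite_measure m" "sets m = sets borel" for m
    proof (rule law.integrable_const_bound[where B = "measure m (space m)"])
      show "?l m \<in> borel_measurable \<nu>" using measurable_measure_Ioo[OF mm, of UNIV] by simp
    qed (auto intro!: AE_I2 finite_measure.bounded_measure[OF mm(1)] split: split_indicator)
    have fl_eq: "?fl r = F 0 * indicator {0<..s} r + ?l m1 r - ?l m2 r" for r
      using s by (auto simp: fl_alt split: split_indicator)
    have "(\<integral>r. ?fl r \<partial>\<nu>) = (\<integral>r. F 0 * indicator {0<..s} r \<partial>\<nu>) + (\<integral>r. ?l m1 r \<partial>\<nu>) - (\<integral>r. ?l m2 r \<partial>\<nu>)"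
    proof -
      have c: "integrable \<nu> (\<lambda>r. F 0 * indicator {0<..s} r)"
        by (intro integrable_mult_right integrable_real_indicator) (auto simp: law.emeasure_eq_measure)
      show ?thesis
        unfolding fl_eq
        by (simp only: Bochner_Integration.integral_diff[OF Bochner_Integration.integrable_add[OF c l_int[OF m(1,3)]] l_int[OF m(2,4)]]
            Bochner_Integration.integral_add[OF c l_int[OF m(1,3)]])
    qed
    also have "(\<integral>r. F 0 * indicator {0<..s} r \<partial>\<nu>) = F 0 * (Gbar 0 - Gbar s)"
      using s by (simp add: measure_jump_law_Ioc)
    finally have fl_integral: "(\<integral>r. ?fl r \<partial>\<nu>) = F 0 * (Gbar 0 - Gbar s) + (\<integral>r. ?l m1 r \<partial>\<nu>) - (\<integral>r. ?l m2 r \<partial>\<nu>)" .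
    \<comment> \<open>On (0,s], k is w + F(-). The balance gives the integral of w as one of
      \<open>Gbar\<close> against \<open>m2\<close> minus \<open>m1\<close>; integrating by parts,
      the inner integrals cancel those coming from F(-), and the boundary terms give F(s)
      Gbar(s).\<close>
    have "(\<integral>r. k r * indicator {0<..s} r \<partial>\<nu>) = (\<integral>r. ?w r + ?fl r \<partial>\<nu>)"
      using s by (intro Bochner_Integration.integral_cong) (auto simp: w_alt split: split_indicator)
    also have "\<dots> = (\<integral>r. ?w r \<partial>\<nu>) + (\<integral>r. ?fl r \<partial>\<nu>)"
      by (rule Bochner_Integration.integral_add[OF ws fl_int[OF S]])
    finally show ?thesis
      unfolding F_eq[OF s s_end] using w_eq fl_integral integration_by_parts[OF m(1,3) _ s(1), of UNIV]
        integration_by_parts[OF m(2,4) _ s(1), of UNIV]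
      by (simp add: algebra_simps)
  qed
  show "F s = F 0 + (\<integral>r. - (k r - Fl r) / Gbar r * indicator {0<..s} r \<partial>\<nu>)"
    if s: "0 \<le> s" "s \<le> t" and s_end: "ennreal s < jump_end P \<gamma>" for s
  proof -
    have Gs: "0 < Gbar s" using less_jump_end_iff[OF s(1)] s_end by simp
    have G_pos: "0 < Gbar r" if "r \<le> s" for r using Gs Gbar_antimono[OF that] by simp
    \<comment> \<open>Integrating the reciprocal of \<open>Gbar\<close>, positive up to s since s is
      before the end, leaves the plain masses of \<open>m1\<close> and \<open>m2\<close> and thereby
      the increment of \<open>F\<close>.\<close>
    let ?h = "\<lambda>r. ennreal (indicator {0<..s} r / Gbar r)"
    have "(\<integral>\<^sup>+r. ?h r \<partial>?a) + (\<integral>\<^sup>+r. ?h r \<partial>?b) = (\<integral>\<^sup>+r. ?h r \<partial>?c) + (\<integral>\<^sup>+r. ?h r \<partial>?d)"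
      by (rule balanced_nn_integrals[OF _ _ _ _ all]) (auto simp: m)
    moreover have Gm: "(\<integral>\<^sup>+r. ?h r \<partial>density m (\<lambda>s. ennreal (Gbar s))) = ennreal (measure m {0<..s})"
      if "finite_measure m" and [measurable_cong]: "sets m = sets borel" for m
    proof -
      have "(\<integral>\<^sup>+r. ?h r \<partial>density m (\<lambda>s. ennreal (Gbar s))) = (\<integral>\<^sup>+r. ennreal (Gbar r) * ?h r \<partial>m)"
        by (rule nn_integral_density) measurable
      also have "\<dots> = (\<integral>\<^sup>+r. indicator {0<..s} r \<partial>m)"
      proof (rule nn_integral_cong)
        fix r
        show "ennreal (Gbar r) * ?h r = indicator {0<..s} r"
        proof (cases "r \<in> {0<..s}")
          case True
          then have "0 < Gbar r" using G_pos by simp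
          then have "ennreal (Gbar r) * ennreal (1 / Gbar r) = 1"
            by (subst ennreal_mult'[symmetric]) auto
          then show ?thesis using True by simp
        qed simp
      qed
      finally show ?thesis using that by (simp add: finite_measure.emeasure_eq_measure)
    qed
    let ?v = "\<lambda>r. w r / Gbar r * indicator {0<..s} r"
    have v_int: "integrable \<nu> ?v"
      by (rule integrable_real_mult_indicator[OF _ wG_int]) simp
    have wv: "(\<integral>\<^sup>+r. ?h r \<partial>density \<nu> (\<lambda>s. ennreal (\<sigma> * w s))) = (\<integral>\<^sup>+r. ennreal (\<sigma> * ?v r) \<partial>\<nu>)" for \<sigma>
    proof -
      have "(\<integral>\<^sup>+r. ?h r \<partial>density \<nu> (\<lambda>s. ennreal (\<sigma> * w s))) = (\<integral>\<^sup>+r. ennreal (\<sigma> * w r) * ?h r \<partial>\<nu>)"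
        by (rule nn_integral_density) measurable
      also have "\<dots> = (\<integral>\<^sup>+r. ennreal (\<sigma> * ?v r) \<partial>\<nu>)"
        using Gbar_nonneg by (intro nn_integral_cong) (auto split: split_indicator simp flip: ennreal_mult'')
      finally show ?thesis .
    qed
    ultimately have bal: "ennreal (measure m1 {0<..s}) + (\<integral>\<^sup>+r. ennreal (?v r) \<partial>\<nu>) =
        ennreal (measure m2 {0<..s}) + (\<integral>\<^sup>+r. ennreal (- ?v r) \<partial>\<nu>)"
      using wv[of 1] wv[of "-1"] Gm[OF m(1,3)] Gm[OF m(2,4)] by simp
    have fin: "(\<integral>\<^sup>+r. ennreal (?v r) \<partial>\<nu>) < \<infinity>" "(\<integral>\<^sup>+r. ennreal (- ?v r) \<partial>\<nu>) < \<infinity>"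
      using iffD1[OF real_integrable_def v_int] by (auto simp: less_top)
    have "measure m1 {0<..s} + enn2real (\<integral>\<^sup>+r. ennreal (?v r) \<partial>\<nu>) =
        measure m2 {0<..s} + enn2real (\<integral>\<^sup>+r. ennreal (- ?v r) \<partial>\<nu>)"
      using arg_cong[OF bal, of enn2real] fin by (simp add: enn2real_plus)
    then have "measure m1 {0<..s} - measure m2 {0<..s} = - (\<integral>r. ?v r \<partial>\<nu>)"
      unfolding real_lebesgue_integral_def[OF v_int] by linarith
    moreover have "(\<integral>r. - (k r - Fl r) / Gbar r * indicator {0<..s} r \<partial>\<nu>) = (\<integral>r. - ?v r \<partial>\<nu>)"
      using s by (intro Bochner_Integration.integral_cong) (auto simp: w_def diff_divide_distrib split: split_indicator)
    ultimately show ?thesis using F_eq[OF s s_end] by simp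
  qed
  show "k t = Fl t" if not_less: "\<not> ennreal t < jump_end P \<gamma>"
  proof -
    have "Gbar t = 0"
      using not_less less_jump_end_iff[OF t0] Gbar_nonneg[of t] by auto
    have point: "emeasure (density m g) {t} = g t * emeasure m {t}"
      if [measurable_cong]: "sets m = sets borel" and [measurable]: "g \<in> borel_measurable borel" for m g
    proof -
      have "emeasure (density m g) {t} = (\<integral>\<^sup>+s. g t * indicator {t} s \<partial>m)"
        by (subst emeasure_density) (auto intro!: nn_integral_cong simp: that split: split_indicator)
      then show ?thesis using that by (simp add: nn_integral_cmult_indicator)
    qed
    have "0 < measure P {\<omega> \<in> space P. \<gamma> \<omega> = ennreal t}" using jump_times_end(4)[OF t(1) not_less] .
    moreover have "emeasure \<nu> {t} = emeasure P {\<omega> \<in> space P. \<gamma> \<omega> = ennreal t}"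
    proof -
      have "emeasure \<nu> {t} = (\<integral>\<^sup>+s. indicator {t} s \<partial>\<nu>)" by simp
      also have "\<dots> = (\<integral>\<^sup>+\<omega>. indicator {\<omega> \<in> space P. \<gamma> \<omega> = ennreal t} \<omega> \<partial>P)"
        by (subst nn_integral_jump_law, simp, rule nn_integral_cong)
          (use t0 in \<open>auto simp: jump_def split: split_indicator\<close>)
      finally show ?thesis by simp
    qed
    ultimately have atom: "0 < measure \<nu> {t}" by (simp add: measure_def)
    \<comment> \<open>The weighted measures \<open>?a\<close> and \<open>?c\<close> do not charge t,
      as \<open>Gbar t\<close> = 0. The positive and the negative part of w thus have equal mass at
      an atom of dG, so w vanishes there.\<close>
    have "emeasure ?b {t} = emeasure ?d {t}"
      using all[of "{t}"] point[OF m(3), of "\<lambda>s. ennreal (Gbar s)"] point[OF m(4), of "\<lambda>s. ennreal (Gbar s)"] \<open>Gbar t = 0\<close>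
      by simp
    then have "ennreal (w t) * emeasure \<nu> {t} = ennreal (- w t) * emeasure \<nu> {t}"
      by (subst (asm) (1 2) point) auto
    moreover have "emeasure \<nu> {t} \<noteq> 0" using atom by (simp add: law.emeasure_eq_measure)
    ultimately have "w t = 0"
      by (cases "w t" "0 :: real" rule: linorder_cases) (auto simp: ennreal_neg)
    then show ?thesis using t by (simp add: w_def)
  qed
  have "AE s in \<nu>. \<forall>n. s \<in> ?X t n \<longrightarrow> jump_density (\<lambda>\<omega>. ennreal (K \<omega>)) s < \<infinity> \<and> jump_density (\<lambda>\<omega>. ennreal (- K \<omega>)) s < \<infinity>"
    unfolding AE_all_countable using jump_mean_integral(3)[OF K X K_int[OF t0 order_refl]] by blast
  then show "AE s in \<nu>. s \<in> {0<..t} \<longrightarrow> jump_density (\<lambda>\<omega>. ennreal (K \<omega>)) s < \<infinity> \<and> jump_density (\<lambda>\<omega>. ennreal (- K \<omega>)) s < \<infinity>"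
    by eventually_elim (use B_cover in blast)
qed

text \<open>Before the jump all paths coincide. So for each t the variation measures of one typical
  path on (0,t] can serve as \<open>m1\<close> and \<open>m2\<close> for almost every sample
  point.\<close>

lemma representation_if_sigma_martingale:
  fixes M :: "real \<Rightarrow> 'a \<Rightarrow> real"
  assumes adapted: "adapted \<F> M" and rc: "\<And>\<omega>. \<omega> \<in> space P \<Longrightarrow> right_cont_path (\<lambda>t. M t \<omega>)"
    and sigma: "sigma_martingale P \<F> M"
  shows "\<exists>F H L.
       condition_M P \<gamma> F H \<and>
       (\<forall>t\<ge>0. jump_end P \<gamma> \<le> ennreal t \<longrightarrow> continuous (at_right t) F) \<and>
       (\<forall>t. t \<notin> jump_times P \<gamma> \<longrightarrow> H t = 0) \<and>
       L \<in> borel_measurable P \<and>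
       (AE \<omega> in P. nn_cond_exp P (jump_sigma P \<gamma>)
          (\<lambda>\<omega>. ennreal \<bar>L \<omega>\<bar> * indicator {\<omega>. \<gamma> \<omega> > 0} \<omega>) \<omega> < \<infinity>) \<and>
       gen_cond_exp_zero P (jump_sigma P \<gamma>) L \<and>
       (AE \<omega> in P. \<forall>t\<ge>0.
          M t \<omega> = F t * indicator {\<omega>. ennreal t < \<gamma> \<omega>} \<omega>
                 + (H (enn2real (\<gamma> \<omega>)) + L \<omega>) * indicator {\<omega>. \<gamma> \<omega> \<le> ennreal t} \<omega>)"
proof -
  let ?T = "jump_times P \<gamma>"
  from sigma obtain S :: "nat \<Rightarrow> ('a \<times> real) set" where S_inc: "incseq S"
    and S_pred: "\<And>n. S n \<in> sets (predictable_sigma P \<F>)" and S_UN: "(\<Union>n. S n) = space P \<times> {0..}"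
    and "\<forall>n. \<exists>Y. ui_martingale P \<F> Y \<and> (AE \<omega> in P. \<forall>t\<ge>0.
      Y t \<omega> = stieltjes_integral (\<lambda>s. M s \<omega>) (\<lambda>s. indicator (S n) (\<omega>, s)) t)"
    unfolding sigma_martingale_def by blast
  from choice[OF this(4)] obtain Y where Y_mart: "\<And>n. martingale P \<F> (Y n)"
    and Y_AE: "\<And>n. AE \<omega> in P. \<forall>t\<ge>0. Y n t \<omega> = stieltjes_integral (\<lambda>s. M s \<omega>) (\<lambda>s. indicator (S n) (\<omega>, s)) t"
    unfolding ui_martingale_def by blast
  have semi: "semimartingale P \<F> M" using sigma by (simp add: sigma_martingale_def)
  define C where "C n \<omega> = {s. (\<omega>, s) \<in> S n}" for n \<omega>
  have C_sets: "C n \<omega> \<in> sets borel" if "\<omega> \<in> space P" for n \<omega>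
    unfolding C_def by (rule predictable_section[OF S_pred that])
  have C_ind: "(\<lambda>s. indicator (S n) (\<omega>, s)) = (indicator (C n \<omega>) :: real \<Rightarrow> real)" for n \<omega>
    by (auto simp: C_def indicator_def fun_eq_iff)
  have C_inc: "incseq (\<lambda>n. C n \<omega>)" for \<omega>
    using S_inc by (auto simp: C_def incseq_def)
  have C_UN: "{0<..} \<subseteq> (\<Union>n. C n \<omega>)" if \<omega>: "\<omega> \<in> space P" for \<omega>
  proof
    fix s :: real assume "s \<in> {0<..}"
    then have "(\<omega>, s) \<in> (\<Union>n. S n)" unfolding S_UN using \<omega> by auto
    then show "s \<in> (\<Union>n. C n \<omega>)" by (auto simp: C_def)
  qed
  have "\<forall>n. \<exists>B. B \<in> sets borel \<and> (\<forall>\<omega>\<in>space P. \<forall>t>0. ennreal t \<le> \<gamma> \<omega> \<longrightarrow> ((\<omega>, t) \<in> S n \<longleftrightarrow> t \<in> B))"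
    using predictable_before_jump[OF S_pred] unfolding Bex_def by (rule allI)
  from choice[OF this] obtain B where B_sets: "\<And>n. B n \<in> sets borel"
    and B: "\<And>n. \<forall>\<omega>\<in>space P. \<forall>t>0. ennreal t \<le> \<gamma> \<omega> \<longrightarrow> ((\<omega>, t) \<in> S n \<longleftrightarrow> t \<in> B n)"
    by blast
  have B_C: "s \<in> C n \<omega> \<longleftrightarrow> s \<in> B n" if "\<omega> \<in> space P" "0 < s" "ennreal s \<le> \<gamma> \<omega>" for n \<omega> s
    using B[of n] that by (simp add: C_def)
  \<comment> \<open>The sets \<open>B n\<close> are determined only at times that some \<omega>
    reaches no later than its jump. The time set consists of such times, and there monotonicity and
    covering are inherited from the sections \<open>C n\<close>.\<close>
  have witness: "\<exists>\<omega>\<in>space P. ennreal s \<le> \<gamma> \<omega>" if "s \<in> ?T" for s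
  proof (rule ccontr)
    assume "\<not> (\<exists>\<omega>\<in>space P. ennreal s \<le> \<gamma> \<omega>)"
    then have empty: "{\<omega> \<in> space P. ennreal s \<le> \<gamma> \<omega>} = {}" by auto
    have "0 < prob {\<omega> \<in> space P. ennreal s \<le> \<gamma> \<omega>}" using that by (simp add: jump_times_def)
    then show False unfolding empty by simp
  qed
  have B_inc: "incseq (\<lambda>n. {0<..t} \<inter> B n)" and B_cover: "{0<..t} \<subseteq> (\<Union>n. B n)" if t: "t \<in> ?T" for t
  proof -
    have mem: "\<exists>\<omega>\<in>space P. \<forall>n. s \<in> C n \<omega> \<longleftrightarrow> s \<in> B n" if "s \<in> {0<..t}" for s
    proof -
      have "s \<in> ?T" using that by (intro jump_times_downward[OF t]) auto
      from witness[OF this] obtain \<omega> where "\<omega> \<in> space P" "ennreal s \<le> \<gamma> \<omega>" by blast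
      then show ?thesis using B_C[of \<omega> s] that by auto
    qed
    show "incseq (\<lambda>n. {0<..t} \<inter> B n)"
      unfolding incseq_def
    proof (intro allI impI subsetI)
      fix i j s assume "i \<le> (j :: nat)" "s \<in> {0<..t} \<inter> B i"
      then show "s \<in> {0<..t} \<inter> B j"
        using mem[of s] incseqD[OF C_inc \<open>i \<le> j\<close>] by blast
    qed
    show "{0<..t} \<subseteq> (\<Union>n. B n)"
    proof
      fix s assume s: "s \<in> {0<..t}"
      then obtain \<omega> where \<omega>: "\<omega> \<in> space P" "\<forall>n. s \<in> C n \<omega> \<longleftrightarrow> s \<in> B n" using mem by blast
      have "s \<in> (\<Union>n. C n \<omega>)" by (rule subsetD[OF C_UN[OF \<omega>(1)]]) (use s in simp)
      then show "s \<in> (\<Union>n. B n)" using \<omega>(2) by blast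
    qed
  qed
  define good where "good \<omega> \<longleftrightarrow> \<omega> \<in> space P \<and> finite_variation_path (\<lambda>t. M t \<omega>) \<and>
    (\<forall>n. \<forall>t\<ge>0. Y n t \<omega> = stieltjes_integral (\<lambda>s. M s \<omega>) (indicator (C n \<omega>)) t) \<and>
    (\<gamma> \<omega> < \<infinity> \<longrightarrow> jump \<omega> \<in> ?T \<and> (\<forall>s\<ge>jump \<omega>. M s \<omega> = M (jump \<omega>) \<omega>)) \<and> \<gamma> \<omega> \<le> jump_end P \<gamma>" for \<omega>
  have goodD: "\<omega> \<in> space P" "finite_variation_path (\<lambda>t. M t \<omega>)" "\<gamma> \<omega> \<le> jump_end P \<gamma>"
      "0 \<le> s \<Longrightarrow> Y n s \<omega> = stieltjes_integral (\<lambda>s. M s \<omega>) (indicator (C n \<omega>)) s"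
      "\<gamma> \<omega> < \<infinity> \<Longrightarrow> jump \<omega> \<in> ?T" "\<gamma> \<omega> < \<infinity> \<Longrightarrow> jump \<omega> \<le> s \<Longrightarrow> M s \<omega> = M (jump \<omega>) \<omega>"
    if "good \<omega>" for \<omega> n s
    using that unfolding good_def by blast+
  have AE_good: "AE \<omega> in P. good \<omega>"
  proof -
    have "AE \<omega> in P. \<forall>n. \<forall>t\<ge>0. Y n t \<omega> = stieltjes_integral (\<lambda>s. M s \<omega>) (\<lambda>s. indicator (S n) (\<omega>, s)) t"
      unfolding AE_all_countable using Y_AE by blast
    moreover have "AE \<omega> in P. \<forall>n. \<forall>q\<in>\<rat>. \<forall>r\<in>\<rat>. 0 \<le> q \<longrightarrow> q \<le> r \<longrightarrow> \<gamma> \<omega> \<le> ennreal q \<longrightarrow> Y n r \<omega> = Y n q \<omega>"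
      unfolding AE_all_countable using AE_rationals_const_after[OF Y_mart] by blast
    ultimately show ?thesis
      using semimartingale_finite_variation[OF semi] AE_jump_times AE_jump_le_end AE_space
    proof eventually_elim
      case (elim \<omega>)
      let ?f = "\<lambda>t. M t \<omega>"
      note rc_\<omega> = rc[OF elim(6)]
      \<comment> \<open>Each \<open>Y n\<close> is constant after the jump at rational times, and
        this limit passes the property on to the process.\<close>
      have lim: "(\<lambda>n. Y n t \<omega>) \<longlonglongrightarrow> ?f t - ?f 0" if "0 \<le> t" for t
        using stieltjes_integral_tendsto[OF rc_\<omega> elim(3) C_sets[OF elim(6)] C_inc C_UN[OF elim(6)] that]
          elim(1) that by (simp add: C_ind)
      have after: "?f s = ?f (jump \<omega>)" if fin: "\<gamma> \<omega> < \<infinity>" and s: "jump \<omega> \<le> s" for s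
      proof -
        obtain q0 where q0: "q0 \<in> \<rat>" "jump \<omega> < q0" using Rats_dense_in_real[of "jump \<omega>" "jump \<omega> + 1"] by auto
        have rat: "?f r = ?f q" if "q \<in> \<rat>" "r \<in> \<rat>" "jump \<omega> < q" "q \<le> r" for q r
        proof -
          have "0 \<le> q" "0 \<le> r" using that jump_nonneg[of \<omega>] by linarith+
          moreover have "\<gamma> \<omega> \<le> ennreal q" using that(3) fin \<open>0 \<le> q\<close> by (simp add: jump_le_iff)
          ultimately have eq: "Y n r \<omega> = Y n q \<omega>" for n using elim(2) that by blast
          have "?f r - ?f 0 = ?f q - ?f 0"
            using lim[OF \<open>0 \<le> r\<close>] lim[OF \<open>0 \<le> q\<close>] unfolding eq by (rule LIMSEQ_unique)
          then show ?thesis by simp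
        qed
        have q: "?f q = ?f q0" if "q \<in> \<rat>" "jump \<omega> < q" for q
          by (rule linorder_le_cases[of q q0]) (use rat[of q q0] rat[of q0 q] that q0 in simp_all)
        have "?f s = ?f q0" "?f (jump \<omega>) = ?f q0"
          using s by (auto intro: right_cont_const_on_rationals[OF rc_\<omega> jump_nonneg[of \<omega>] q])
        then show ?thesis by simp
      qed
      then show ?case unfolding good_def using elim unfolding C_ind by blast
    qed
  qed
  have ex_good: "\<exists>\<omega>. good \<omega> \<and> Q \<omega>" if "0 < prob {\<omega> \<in> space P. Q \<omega>}" for Q
  proof (rule ccontr)
    assume "\<not> (\<exists>\<omega>. good \<omega> \<and> Q \<omega>)"
    then have AE: "AE \<omega> in P. \<omega> \<notin> {\<omega> \<in> space P. Q \<omega>}"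
      using AE_good by (auto elim: eventually_mono)
    have "{\<omega> \<in> space P. Q \<omega>} \<in> events"
      using that by (metis less_irrefl measure_notin_sets)
    with AE have "prob {\<omega> \<in> space P. Q \<omega>} = 0" by (subst prob_eq_0)
    with that show False by simp
  qed
  \<comment> \<open>Adaptedness makes the chosen \<omega> irrelevant. The value 0 from the end
    onwards provides the right-continuous extension.\<close>
  define F where "F t = (if 0 \<le> t \<and> ennreal t < jump_end P \<gamma>
    then M t (SOME \<omega>. \<omega> \<in> space P \<and> ennreal t < \<gamma> \<omega>) else 0)" for t
  have M_F: "M t \<omega> = F t" if t: "0 \<le> t" "ennreal t < jump_end P \<gamma>" and \<omega>: "\<omega> \<in> space P" "ennreal t < \<gamma> \<omega>" for t \<omega>
  proof -
    have "M t \<in> borel_measurable (\<F> (ennreal t))" using adapted t by (simp add: adapted_def)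
    then obtain c where c: "\<forall>\<omega>\<in>space P. ennreal t < \<gamma> \<omega> \<longrightarrow> M t \<omega> = c"
      unfolding borel_measurable_sj_iff by blast
    have "(SOME \<omega>. \<omega> \<in> space P \<and> ennreal t < \<gamma> \<omega>) \<in> space P \<and> ennreal t < \<gamma> (SOME \<omega>. \<omega> \<in> space P \<and> ennreal t < \<gamma> \<omega>)"
      by (rule someI[of "\<lambda>\<omega>. \<omega> \<in> space P \<and> ennreal t < \<gamma> \<omega>"]) (use \<omega> in simp)
    then show ?thesis using c \<omega> t by (simp add: F_def)
  qed
  have good_F: "M t \<omega> = F t" "ennreal t < jump_end P \<gamma>" if "good \<omega>" "0 \<le> t" "ennreal t < \<gamma> \<omega>" for t \<omega>
  proof -
    show *: "ennreal t < jump_end P \<gamma>" using that(3) goodD(3)[OF that(1)] by (rule less_le_trans)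
    show "M t \<omega> = F t" by (rule M_F[OF that(2) * goodD(1)[OF that(1)] that(3)])
  qed
  have M_meas [measurable]: "M t \<in> borel_measurable P" if "0 \<le> t" for t
    using adapted that by (auto simp: adapted_def borel_measurable_sj_iff)
  \<comment> \<open>A limit along integer times gives the value after the jump as a measurable
    function, without evaluating the process at a random time.\<close>
  define K where "K \<omega> = lim (\<lambda>n. M (real n) \<omega>)" for \<omega>
  have K [measurable]: "K \<in> borel_measurable P"
    unfolding K_def by (rule borel_measurable_lim_metric) (rule M_meas, simp)
  have K_eq: "M s \<omega> = K \<omega>" if "good \<omega>" "0 \<le> s" "\<gamma> \<omega> \<le> ennreal s" for s \<omega>
  proof -
    have fin: "\<gamma> \<omega> < \<infinity>" and s: "jump \<omega> \<le> s" using that by (auto simp: jump_le_iff)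
    have const: "M r \<omega> = M (jump \<omega>) \<omega>" if "jump \<omega> \<le> r" for r
      by (rule goodD(6)[OF \<open>good \<omega>\<close> fin that])
    obtain N where "jump \<omega> \<le> real N" using real_arch_simple by blast
    then have "M (real n) \<omega> = M (jump \<omega>) \<omega>" if "N \<le> n" for n
      using that by (intro const) simp
    then have "eventually (\<lambda>n. M (real n) \<omega> = M (jump \<omega>) \<omega>) sequentially"
      unfolding eventually_sequentially by blast
    then have "(\<lambda>n. M (real n) \<omega>) \<longlonglongrightarrow> M (jump \<omega>) \<omega>" by (rule tendsto_eventually)
    then show ?thesis unfolding K_def using const[OF s] by (simp add: limI)
  qed
  define Fl where "Fl s = Lim (at_left s) F" for s
  define k where "k = jump_mean K"
  define z where "z s = - (k s - Fl s) / Gbar s" for s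
  have local: "integrable \<nu> (\<lambda>s. k s * indicator {0<..t} s)"
      "(\<lambda>s. Fl s * indicator {0<..t} s) \<in> borel_measurable borel"
      "integrable \<nu> (\<lambda>s. z s * indicator {0<..t} s)"
      "\<And>s. 0 \<le> s \<Longrightarrow> s \<le> t \<Longrightarrow> ennreal s < jump_end P \<gamma> \<Longrightarrow>
        F s * Gbar s + (\<integral>r. k r * indicator {0<..s} r \<partial>\<nu>) = F 0 * Gbar 0"
      "\<And>s. 0 \<le> s \<Longrightarrow> s \<le> t \<Longrightarrow> ennreal s < jump_end P \<gamma> \<Longrightarrow>
        F s = F 0 + (\<integral>r. z r * indicator {0<..s} r \<partial>\<nu>)"
      "\<not> ennreal t < jump_end P \<gamma> \<Longrightarrow> k t = Fl t"
      "AE s in \<nu>. s \<in> {0<..t} \<longrightarrow> jump_density (\<lambda>\<omega>. ennreal (K \<omega>)) s < \<infinity> \<and> jump_density (\<lambda>\<omega>. ennreal (- K \<omega>)) s < \<infinity>"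
      "(F \<longlongrightarrow> Fl t) (at_left t)"
    if t: "t \<in> ?T" "0 < t" for t
  proof -
    \<comment> \<open>The reference path must follow \<open>F\<close> on [0,t] as far as
      \<open>F\<close> is meaningful. A strict inequality at t is therefore required if t is before
      the end; at the end itself it suffices to jump no earlier than t.\<close>
    obtain \<omega>1 where g1: "good \<omega>1" and t_le: "ennreal t \<le> \<gamma> \<omega>1" and t_less: "ennreal t < jump_end P \<gamma> \<Longrightarrow> ennreal t < \<gamma> \<omega>1"
    proof (cases "ennreal t < jump_end P \<gamma>")
      case True
      then have "0 < prob {\<omega> \<in> space P. ennreal t < \<gamma> \<omega>}"
        using less_jump_end_iff[of t] t by (simp add: Gbar_def)
      from ex_good[OF this] show ?thesis using that by (auto intro: less_imp_le)
    next
      case False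
      have "0 < prob {\<omega> \<in> space P. ennreal t \<le> \<gamma> \<omega>}" using t by (simp add: jump_times_def)
      from ex_good[OF this] show ?thesis using that False by auto
    qed
    let ?f = "\<lambda>t. M t \<omega>1"
    have \<omega>1: "\<omega>1 \<in> space P" and fv1: "finite_variation_path ?f" using goodD(1,2)[OF g1] by auto
    note rc1 = rc[OF \<omega>1]
    have F1: "?f s = F s" if "0 \<le> s" "s \<le> t" "ennreal s < jump_end P \<gamma>" for s
    proof (rule M_F[OF that(1,3) \<omega>1])
      show "ennreal s < \<gamma> \<omega>1"
      proof (cases "s = t")
        case True
        then show ?thesis using t_less that by simp
      next
        case False
        then have "ennreal s < ennreal t" using that by (simp add: ennreal_less_iff)
        then show ?thesis using t_le by (rule less_le_trans)
      qed
    qed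
    \<comment> \<open>Restriction to (0,t] turns the measures of the reference path into finite ones
      without changing masses inside (0,t].\<close>
    define m where "m \<mu> = density \<mu> (indicator {0<..t})" for \<mu> :: "real measure"
    have m_fin: "finite_measure (m \<mu>)" and m_AE: "AE s in m \<mu>. s \<in> {0<..t}"
      and m_eq: "\<And>A. A \<in> sets borel \<Longrightarrow> A \<subseteq> {0<..t} \<Longrightarrow> measure (m \<mu>) A = measure \<mu> A"
      if sets: "sets \<mu> = sets borel" and fin: "emeasure \<mu> {0<..t} \<noteq> \<infinity>" for \<mu>
    proof -
      note [measurable_cong] = sets
      have space: "space \<mu> = UNIV" using sets_eq_imp_space_eq[OF sets] by simp
      show "finite_measure (m \<mu>)"
        unfolding m_def by (rule finite_measureI) (use fin in \<open>simp add: emeasure_restricted sets space\<close>)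
      show "AE s in m \<mu>. s \<in> {0<..t}"
        unfolding m_def by (subst AE_density) (auto intro!: AE_I2 split: split_indicator)
      fix A assume "A \<in> sets borel" "A \<subseteq> {0<..t}"
      then show "measure (m \<mu>) A = measure \<mu> A"
        unfolding m_def by (subst measure_restricted) (auto simp: sets Int_absorb1)
    qed
    let ?V = "variation_measure ?f" and ?E = "excess_measure ?f"
    have fin1: "emeasure ?V {0<..t} \<noteq> \<infinity>" "emeasure ?E {0<..t} \<noteq> \<infinity>"
      using emeasure_path_finite[OF rc1 fv1, of t "{0<..t}"] t by auto
    have sets_m: "sets (m ?V) = sets borel" "sets (m ?E) = sets borel" by (simp_all add: m_def)
    note fin_m = m_fin[OF sets_variation_measure fin1(1)] m_fin[OF sets_excess_measure fin1(2)]
    note m_eqs = m_eq[OF sets_variation_measure fin1(1)] m_eq[OF sets_excess_measure fin1(2)]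
    have F_m: "F s = F 0 + measure (m ?V) {0<..s} - measure (m ?E) {0<..s}"
      if s: "0 \<le> s" "s \<le> t" "ennreal s < jump_end P \<gamma>" for s
    proof -
      have "{0<..s} \<subseteq> {0<..t}" using s by auto
      then show ?thesis
        using path_eq_measures[OF rc1 fv1 s(1)] F1[OF s] F1[of 0] jump_end_pos t m_eqs[of "{0<..s}"] by simp
    qed
    have F_lim: "(F \<longlongrightarrow> F 0 + measure (m ?V) {0<..<s} - measure (m ?E) {0<..<s}) (at_left s)"
      if s: "0 < s" "s \<le> t" for s
    proof (rule Lim_transform_eventually)
      show "((\<lambda>r. F 0 + measure (m ?V) {0<..r} - measure (m ?E) {0<..r}) \<longlongrightarrow>
          F 0 + measure (m ?V) {0<..<s} - measure (m ?E) {0<..<s}) (at_left s)"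
        using fin_m by (intro tendsto_add tendsto_diff tendsto_const measure_Ioo_tendsto sets_m)
          (auto simp: finite_measure.emeasure_eq_measure)
      show "eventually (\<lambda>r. F 0 + measure (m ?V) {0<..r} - measure (m ?E) {0<..r} = F r) (at_left s)"
        using eventually_at_left_real[OF s(1)]
      proof eventually_elim
        case (elim r)
        then show ?case
          using F_m[of r] less_jump_end_of_less_jump_time[OF t(1), of r] s by simp
      qed
    qed
    have Fl_m: "Fl s = F 0 + measure (m ?V) {0<..<s} - measure (m ?E) {0<..<s}" if "0 < s" "s \<le> t" for s
      unfolding Fl_def by (rule tendsto_Lim[OF trivial_limit_at_left_real F_lim[OF that]])
    have Y_eq: "AE \<omega> in P. Y n s \<omega> =
        measure (m ?V) ({0<..s} \<inter> B n \<inter> {r. ennreal r < \<gamma> \<omega>}) - measure (m ?E) ({0<..s} \<inter> B n \<inter> {r. ennreal r < \<gamma> \<omega>})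
        + (K \<omega> - Fl (jump \<omega>)) * (indicator ({0<..s} \<inter> B n) (jump \<omega>) * indicator finite_jump \<omega>)"
      if s: "0 \<le> s" "s \<le> t" for n s
      using AE_good
    proof eventually_elim
      case (elim \<omega>)
      then have \<omega>: "\<omega> \<in> space P" and fv: "finite_variation_path (\<lambda>t. M t \<omega>)"
        and Y\<omega>: "Y n s \<omega> = stieltjes_integral (\<lambda>s. M s \<omega>) (indicator (C n \<omega>)) s"
        using goodD(1,2,4)[OF elim] s by auto
      note rc\<omega> = rc[OF \<omega>]
      have before: "M r \<omega> = M 0 \<omega> + measure (m ?V) {0<..r} - measure (m ?E) {0<..r}"
        if r: "0 \<le> r" "r \<le> t" "ennreal r < \<gamma> \<omega>" for r
      proof -
        have "ennreal 0 < \<gamma> \<omega>" using ennreal_leI[OF r(1)] r(3) by (rule le_less_trans)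
        then show ?thesis
          using good_F[OF elim r(1,3)] good_F(1)[OF elim order_refl] F_m[OF r(1,2)] by simp
      qed
      show ?case
      proof (cases "ennreal s < \<gamma> \<omega>")
        case True
        have less: "ennreal r < \<gamma> \<omega>" if "r \<le> s" for r using ennreal_leI[OF that] True by (rule le_less_trans)
        have "Y n s \<omega> = measure (m ?V) ({0<..s} \<inter> C n \<omega>) - measure (m ?E) ({0<..s} \<inter> C n \<omega>)"
          unfolding Y\<omega>
          by (rule stieltjes_integral_eq_measures[OF rc\<omega> fv fin_m sets_m _ C_sets[OF \<omega>] s(1)])
            (use before less s in auto)
        moreover have "{0<..s} \<inter> C n \<omega> = {0<..s} \<inter> B n"
        proof -
          have "r \<in> C n \<omega> \<longleftrightarrow> r \<in> B n" if "0 < r" "r \<le> s" for r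
            by (rule B_C[OF \<omega> that(1) less_imp_le[OF less[OF that(2)]]])
          then show ?thesis by auto
        qed
        moreover have "\<not> (jump \<omega> \<in> {0<..s} \<and> \<omega> \<in> finite_jump)"
          using True s by (auto simp: less_jump_iff)
        ultimately show ?thesis
          using before_jump_eq(1)[OF s(1) True, of "B n"] by (auto simp: indicator_def)
      next
        case False
        then have le: "\<gamma> \<omega> \<le> ennreal s" by simp
        then have fin: "\<gamma> \<omega> < \<infinity>" and gs: "jump \<omega> \<le> s" using s by (auto simp: jump_le_iff)
        have less: "ennreal r < \<gamma> \<omega>" if "0 \<le> r" "r < jump \<omega>" for r using that by (simp add: less_jump_iff)
        let ?g = "{0<..<jump \<omega>}"
        have "Y n s \<omega> = measure (m ?V) (?g \<inter> C n \<omega>) - measure (m ?E) (?g \<inter> C n \<omega>)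
            + indicator (C n \<omega>) (jump \<omega>) * (M (jump \<omega>) \<omega> - M 0 \<omega> - measure (m ?V) ?g + measure (m ?E) ?g)"
          unfolding Y\<omega>
        proof (rule stieltjes_integral_eq_measures_jump[OF rc\<omega> fv fin_m sets_m _ _ C_sets[OF \<omega>] jump_nonneg gs])
          show "M r \<omega> = M 0 \<omega> + measure (m ?V) {0<..r} - measure (m ?E) {0<..r}" if "0 \<le> r" "r < jump \<omega>" for r
            using before[of r] less[of r] that gs s by simp
          show "M r \<omega> = M (jump \<omega>) \<omega>" if "jump \<omega> \<le> r" for r
            by (rule goodD(6)[OF elim fin that])
        qed
        moreover have "?g \<inter> C n \<omega> = ?g \<inter> B n"
        proof -
          have "r \<in> C n \<omega> \<longleftrightarrow> r \<in> B n" if "0 < r" "r < jump \<omega>" for r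
            by (rule B_C[OF \<omega> that(1) less_imp_le[OF less]]) (use that in auto)
          then show ?thesis by auto
        qed
        moreover have "indicator (C n \<omega>) (jump \<omega>) * (M (jump \<omega>) \<omega> - M 0 \<omega> - measure (m ?V) ?g + measure (m ?E) ?g) =
            (K \<omega> - Fl (jump \<omega>)) * (indicator ({0<..s} \<inter> B n) (jump \<omega>) * indicator finite_jump \<omega>)"
        proof (cases "jump \<omega> = 0")
          case True
          \<comment> \<open>At jump time 0 the bracket is 0 on the left, and 0 is outside (0,s] on
            the right.\<close>
          then show ?thesis by simp
        next
          case False
          then have pos: "0 < jump \<omega>" using jump_nonneg[of \<omega>] by simp
          have "M 0 \<omega> = F 0" using good_F(1)[OF elim order_refl] less[OF order_refl pos] by simp
          moreover have "M (jump \<omega>) \<omega> = K \<omega>"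
            using K_eq[OF elim jump_nonneg] fin by (simp add: ennreal_jump)
          moreover have "jump \<omega> \<in> C n \<omega> \<longleftrightarrow> jump \<omega> \<in> B n"
            using B_C[OF \<omega> pos] fin by (simp add: ennreal_jump)
          ultimately show ?thesis
            using Fl_m[OF pos] gs s pos fin by (simp add: indicator_def)
        qed
        ultimately show ?thesis
          using before_jump_eq(2)[OF s(1) le, of "B n"] by simp
      qed
    qed
    note L = sigma_martingale_local[OF K t B_sets B_inc[OF t(1)] B_cover[OF t(1)] Y_mart fin_m sets_m
        m_AE[OF sets_variation_measure fin1(1)] m_AE[OF sets_excess_measure fin1(2)] F_m Fl_m Y_eq]
    show "integrable \<nu> (\<lambda>s. k s * indicator {0<..t} s)" unfolding k_def by (rule L(1))
    show "(\<lambda>s. Fl s * indicator {0<..t} s) \<in> borel_measurable borel" by (rule L(2))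
    show "integrable \<nu> (\<lambda>s. z s * indicator {0<..t} s)" unfolding z_def k_def by (rule L(3))
    show "F s * Gbar s + (\<integral>r. k r * indicator {0<..s} r \<partial>\<nu>) = F 0 * Gbar 0"
      if "0 \<le> s" "s \<le> t" "ennreal s < jump_end P \<gamma>" for s unfolding k_def by (rule L(4)) (simp_all add: that)
    show "F s = F 0 + (\<integral>r. z r * indicator {0<..s} r \<partial>\<nu>)"
      if "0 \<le> s" "s \<le> t" "ennreal s < jump_end P \<gamma>" for s unfolding z_def k_def by (rule L(5)) (simp_all add: that)
    show "k t = Fl t" if "\<not> ennreal t < jump_end P \<gamma>" unfolding k_def by (rule L(6)) (simp_all add: that)
    show "AE s in \<nu>. s \<in> {0<..t} \<longrightarrow> jump_density (\<lambda>\<omega>. ennreal (K \<omega>)) s < \<infinity> \<and> jump_density (\<lambda>\<omega>. ennreal (- K \<omega>)) s < \<infinity>"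
      by (rule L(7))
    show "(F \<longlongrightarrow> Fl t) (at_left t)" using F_lim[of t] Fl_m[of t] t by simp
  qed
  obtain u :: "nat \<Rightarrow> real" where u_inc: "incseq u" and u: "\<And>n. u n \<in> ?T" and u_cover: "\<And>t. t \<in> ?T \<Longrightarrow> \<exists>n. t \<le> u n"
    using jump_times_sequence by blast
  have k [measurable]: "k \<in> borel_measurable borel" unfolding k_def by measurable
  have Fl_meas: "(\<lambda>s. indicator ?T s * Fl s) \<in> borel_measurable borel"
  proof -
    have n: "(\<lambda>s. Fl s * indicator {0<..u n} s) \<in> borel_measurable borel" for n
    proof (cases "0 < u n")
      case True
      then show ?thesis by (rule local(2)[OF u])
    next
      case False
      then have "{0<..u n} = {}" by auto
      then show ?thesis by simp
    qed
    have "(\<lambda>s. indicator (?T \<inter> {0<..}) s * Fl s) \<in> borel_measurable borel"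
    proof (rule borel_measurable_LIMSEQ_real[OF _ n])
      fix s :: real
      show "(\<lambda>n. Fl s * indicator {0<..u n} s) \<longlonglongrightarrow> indicator (?T \<inter> {0<..}) s * Fl s"
      proof (cases "s \<in> ?T \<and> 0 < s")
        case True
        then obtain N where N: "s \<le> u N" using u_cover by blast
        have "eventually (\<lambda>n. Fl s * indicator {0<..u n} s = indicator (?T \<inter> {0<..}) s * Fl s) sequentially"
          using eventually_ge_at_top[of N]
        proof eventually_elim
          case (elim n)
          then have "s \<le> u n" using N incseqD[OF u_inc] order_trans by blast
          then show ?case using True by simp
        qed
        then show ?thesis by (rule tendsto_eventually)
      next
        case False
        then have eq: "Fl s * indicator {0<..u n} s = indicator (?T \<inter> {0<..}) s * Fl s" for n
          using jump_times_downward[OF u[of n], of s] by (auto split: split_indicator)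
        show ?thesis unfolding eq by (rule tendsto_const)
      qed
    qed
    \<comment> \<open>The pieces on (0,u n] say nothing at time 0, where \<open>Fl\<close> takes
      some single value that is added by hand.\<close>
    then have "(\<lambda>s. indicator (?T \<inter> {0<..}) s * Fl s + indicator {0} s * Fl 0) \<in> borel_measurable borel"
      by measurable
    moreover have "indicator (?T \<inter> {0<..}) s * Fl s + indicator {0} s * Fl 0 = indicator ?T s * Fl s" for s
      using jump_times_nonneg[of s] zero_jump_times by (cases "s = 0") (auto split: split_indicator)
    ultimately show ?thesis by simp
  qed
  have L1: "v \<in> L1_loc P \<gamma>"
    if meas: "(\<lambda>s. indicator ?T s * v s) \<in> borel_measurable borel"
      and int: "\<And>t. t \<in> ?T \<Longrightarrow> 0 < t \<Longrightarrow> integrable \<nu> (\<lambda>s. v s * indicator {0<..t} s)" for v :: "real \<Rightarrow> real"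
    unfolding L1_loc_def
  proof (intro CollectI conjI ballI)
    show "set_borel_measurable borel ?T v" using meas by (simp add: set_borel_measurable_def)
    fix t assume t: "t \<in> ?T"
    have "integrable \<nu> (\<lambda>s. v s * indicator {0<..t} s)"
    proof (cases "0 < t")
      case False
      then have "{0<..t} = {}" by auto
      then show ?thesis by simp
    qed (rule int[OF t])
    moreover have "integrable \<nu> (\<lambda>s. v 0 * indicator {0} s)"
      by (intro integrable_mult_right integrable_real_indicator) (auto simp: law.emeasure_eq_measure)
    ultimately have "integrable \<nu> (\<lambda>s. v s * indicator {0<..t} s + v 0 * indicator {0} s)"
      by (rule Bochner_Integration.integrable_add)
    moreover have "v s * indicator {0<..t} s + v 0 * indicator {0} s = indicator {0..t} s *\<^sub>R v s" for s
      using jump_times_nonneg[OF t] by (cases "s = 0") (auto split: split_indicator)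
    ultimately show "set_integrable \<nu> {0..t} v" by (simp add: set_integrable_def)
  qed
  define H where "H s = (if s \<in> ?T then k s else 0)" for s
  \<comment> \<open>The centred part is set to 0 where there is no finite jump; the representation
    never evaluates it there.\<close>
  define L where "L \<omega> = (K \<omega> - jump_mean K (jump \<omega>)) * indicator finite_jump \<omega>" for \<omega>
  have H_ind: "H s * indicator {0<..t} s = k s * indicator {0<..t} s" if "t \<in> ?T" for s t
    using jump_times_downward[OF that, of s] by (auto simp: H_def split: split_indicator)
  have H_L1: "H \<in> L1_loc P \<gamma>"
  proof (rule L1)
    have "(\<lambda>s. indicator ?T s * k s) \<in> borel_measurable borel" by measurable
    moreover have "indicator ?T s * k s = indicator ?T s * H s" for s by (simp add: H_def)
    ultimately show "(\<lambda>s. indicator ?T s * H s) \<in> borel_measurable borel" by simp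
    show "integrable \<nu> (\<lambda>s. H s * indicator {0<..t} s)" if "t \<in> ?T" "0 < t" for t
      unfolding H_ind[OF that(1)] by (rule local(1)[OF that])
  qed
  have z_L1: "z \<in> L1_loc P \<gamma>"
  proof (rule L1[OF _ local(3)])
    have "(\<lambda>s. - (indicator ?T s * k s - indicator ?T s * Fl s) / Gbar s) \<in> borel_measurable borel"
      using Fl_meas by measurable
    moreover have "- (indicator ?T s * k s - indicator ?T s * Fl s) / Gbar s = indicator ?T s * z s" for s
      by (auto simp: z_def split: split_indicator)
    ultimately show "(\<lambda>s. indicator ?T s * z s) \<in> borel_measurable borel" by simp
  qed
  have cond: "condition_M P \<gamma> F H"
    unfolding condition_M_def
  proof (intro conjI allI impI H_L1)
    have scaleR_comm: "set_lebesgue_integral \<nu> {0<..t} v = (\<integral>s. v s * indicator {0<..t} s \<partial>\<nu>)" for v :: "real \<Rightarrow> real" and t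
      by (simp add: set_lebesgue_integral_def mult.commute)
    show "loc_abs_cont P \<gamma> F"
      unfolding loc_abs_cont_def scaleR_comm
    proof (intro bexI[OF _ z_L1] allI impI)
      fix t assume "0 \<le> t \<and> ennreal t < jump_end P \<gamma>"
      then show "F t = F 0 + (\<integral>s. z s * indicator {0<..t} s \<partial>\<nu>)"
        using local(5)[OF jump_times_below_end, of t t] by (cases "t = 0") auto
    qed
    fix t assume "0 \<le> t \<and> ennreal t < jump_end P \<gamma>"
    then have t: "0 \<le> t" "ennreal t < jump_end P \<gamma>" "t \<in> ?T" using jump_times_below_end by auto
    show "F t * (1 - jump_cdf P \<gamma> t) + set_lebesgue_integral \<nu> {0<..t} H = F 0 * (1 - jump_cdf P \<gamma> 0)"
      unfolding scaleR_comm H_ind[OF t(3)]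
      using local(4)[OF t(3) _ t(1) order_refl t(2)] t(1) by (cases "t = 0") (auto simp: jump_cdf_eq)
  next
    assume "case_B P \<gamma>"
    note B' = case_B_jump_times[OF this]
    let ?t = "enn2real (jump_end P \<gamma>)"
    have pos: "0 < ?t" using jump_end_pos B'(1) by (simp add: enn2real_positive_iff)
    \<comment> \<open>In Case B the end belongs to the time set, so the local result at this time
      gives both k = F(-) at the atom and the existence of the left limit.\<close>
    have "\<not> ennreal ?t < jump_end P \<gamma>" using B'(1) by simp
    then have "H ?t = Fl ?t" using local(6)[OF B'(2) pos] B'(2) by (simp add: H_def)
    then show "(F \<longlongrightarrow> H ?t) (at_left ?t)" using local(8)[OF B'(2) pos] by simp
  qed
  have dens_fin: "AE s in \<nu>. 0 < s \<longrightarrow> jump_density (\<lambda>\<omega>. ennreal (K \<omega>)) s < \<infinity> \<and> jump_density (\<lambda>\<omega>. ennreal (- K \<omega>)) s < \<infinity>"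
  proof -
    have "AE s in \<nu>. s \<in> {0<..u n} \<longrightarrow> jump_density (\<lambda>\<omega>. ennreal (K \<omega>)) s < \<infinity> \<and> jump_density (\<lambda>\<omega>. ennreal (- K \<omega>)) s < \<infinity>" for n
      using local(7)[OF u[of n]] by (cases "0 < u n") auto
    then have "AE s in \<nu>. \<forall>n. s \<in> {0<..u n} \<longrightarrow> jump_density (\<lambda>\<omega>. ennreal (K \<omega>)) s < \<infinity> \<and> jump_density (\<lambda>\<omega>. ennreal (- K \<omega>)) s < \<infinity>"
      unfolding AE_all_countable by (rule allI)
    moreover have "AE s in \<nu>. s \<in> ?T"
      using AE_jump_times by (subst AE_jump_law_iff) auto
    ultimately show ?thesis
      by eventually_elim (use u_cover in force)
  qed
  have repr: "AE \<omega> in P. \<forall>t\<ge>0. M t \<omega> = F t * indicator {\<omega>. ennreal t < \<gamma> \<omega>} \<omega>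
      + (H (enn2real (\<gamma> \<omega>)) + L \<omega>) * indicator {\<omega>. \<gamma> \<omega> \<le> ennreal t} \<omega>"
    using AE_good
  proof eventually_elim
    case (elim \<omega>)
    show ?case
    proof (intro allI impI)
      fix t :: real assume t: "0 \<le> t"
      show "M t \<omega> = F t * indicator {\<omega>. ennreal t < \<gamma> \<omega>} \<omega>
        + (H (enn2real (\<gamma> \<omega>)) + L \<omega>) * indicator {\<omega>. \<gamma> \<omega> \<le> ennreal t} \<omega>"
      proof (cases "ennreal t < \<gamma> \<omega>")
        case True
        then show ?thesis using good_F(1)[OF elim t True] by (simp add: not_le[THEN iffD2])
      next
        case False
        then have le: "\<gamma> \<omega> \<le> ennreal t" by simp
        then have fin: "\<gamma> \<omega> < \<infinity>" using t by (simp add: jump_le_iff)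
        then have "jump \<omega> \<in> ?T" by (rule goodD(5)[OF elim])
        then have "H (enn2real (\<gamma> \<omega>)) + L \<omega> = K \<omega>"
          using fin by (simp add: H_def L_def k_def jump_def)
        then show ?thesis using K_eq[OF elim t le] le False by simp
      qed
    qed
  qed
  have F_cont: "continuous (at_right t) F" if t: "0 \<le> t" "jump_end P \<gamma> \<le> ennreal t" for t
  proof -
    have zero: "F s = 0" if "t \<le> s" for s
      using order_trans[OF t(2) ennreal_leI[OF that]] by (simp add: F_def not_less[THEN iffD2])
    have "eventually (\<lambda>s. F s = F t) (at_right t)"
      using eventually_at_right_less[of t] by eventually_elim (simp add: zero)
    then show ?thesis unfolding continuous_within by (rule tendsto_eventually)
  qed
  have L_meas: "L \<in> borel_measurable P"
    unfolding L_def indicator_def mem_Collect_eq by measurable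
  show ?thesis
  proof (rule exI[of _ F], rule exI[of _ H], rule exI[of _ L], intro conjI cond L_meas repr)
    show "\<forall>t\<ge>0. jump_end P \<gamma> \<le> ennreal t \<longrightarrow> continuous (at_right t) F" using F_cont by blast
    show "\<forall>t. t \<notin> ?T \<longrightarrow> H t = 0" by (simp add: H_def)
    show "AE \<omega> in P. nn_cond_exp P (jump_sigma P \<gamma>) (\<lambda>\<omega>. ennreal \<bar>L \<omega>\<bar> * indicator {\<omega>. \<gamma> \<omega> > 0} \<omega>) \<omega> < \<infinity>"
      unfolding L_def by (rule centre_given_jump(2)[OF K dens_fin])
    show "gen_cond_exp_zero P (jump_sigma P \<gamma>) L"
      unfolding L_def by (rule centre_given_jump(1)[OF K])
  qed
qed

end

theorem theorem3:
  fixes P :: "'a measure" and \<gamma> :: "'a \<Rightarrow> ennreal" and M :: "real \<Rightarrow> 'a \<Rightarrow> real"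
  assumes "prob_space P"
    and "\<gamma> \<in> borel_measurable P"
    and "measure P {\<omega> \<in> space P. \<gamma> \<omega> > 0} > 0"
    and "adapted (sj_filtration P \<gamma>) M"
    and "\<And>\<omega>. \<omega> \<in> space P \<Longrightarrow> right_cont_path (\<lambda>t. M t \<omega>)"
  shows "sigma_martingale P (sj_filtration P \<gamma>) M \<longleftrightarrow>
    (\<exists>F H L.
       condition_M P \<gamma> F H \<and>
       (\<forall>t\<ge>0. jump_end P \<gamma> \<le> ennreal t \<longrightarrow> continuous (at_right t) F) \<and>
       (\<forall>t. t \<notin> jump_times P \<gamma> \<longrightarrow> H t = 0) \<and>
       L \<in> borel_measurable P \<and>
       (AE \<omega> in P. nn_cond_exp P (jump_sigma P \<gamma>)
          (\<lambda>\<omega>. ennreal \<bar>L \<omega>\<bar> * indicator {\<omega>. \<gamma> \<omega> > 0} \<omega>) \<omega> < \<infinity>) \<and>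
       gen_cond_exp_zero P (jump_sigma P \<gamma>) L \<and>
       (AE \<omega> in P. \<forall>t\<ge>0.
          M t \<omega> = F t * indicator {\<omega>. ennreal t < \<gamma> \<omega>} \<omega>
                 + (H (enn2real (\<gamma> \<omega>)) + L \<omega>) * indicator {\<omega>. \<gamma> \<omega> \<le> ennreal t} \<omega>))"
proof -
  interpret prob_space P by fact
  interpret single_jump P \<gamma> by standard fact+
  show ?thesis
    using representation_if_sigma_martingale[OF assms(4,5)]
      sigma_martingale_if_representation[OF assms(4,5)] by blast
qed

end
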